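(* For all $n\ge0$, $\Delta_n(\mathrm{cQSym}_n)\subseteq\mathrm{cQSym}_n\otimes\mathrm{QSym}_n$ and $\Delta_n(\mathrm{cQSym}^-_n)\subseteq\mathrm{cQSym}^-_n\otimes\mathrm{QSym}_n$, i.e. both are right comodules of $\mathrm{QSym}_n$ under the internal coproduct. Explicitly, for $n>1$ and every orbit $B$ of nonempty proper subsets of $[n]$, \[ \Delta_n(\hat F^{\mathrm{cyc}}_{n,B})=\sum_{A,\,J}\frac{d_A}{d_B}\,\tilde a_B^{AJ}\,\hat F^{\mathrm{cyc}}_{n,A}\otimes F_{n,J}, \] summing over orbits $A$ of nonempty proper subsets of $[n]$ and $J\subseteq[n-1]$, where $\tilde a_B^{AJ}:=\#\{(\sigma_1,\sigma_2)\in\mathfrak{S}_n\times\mathfrak{S}_n:\mathrm{cDes}(\sigma_1)\in A,\ \mathrm{Des}(\sigma_2)=J,\ \sigma_2\sigma_1=\pi\}$ does not depend on the choice of $\pi\in\mathfrak{S}_n$ with $\mathrm{cDes}(\pi)\in B$; the structure constants $\frac{d_A}{d_B}\tilde a_B^{AJ}$ are nonnegative integers. Moreover, for $n\ge1$, $\Delta_n(\hat F^{\mathrm{cyc}}_{n,\varnothing})=\Delta_n(h_n)=\sum_{\lambda\vdash n}s_\lambda\otimes s_\lambda$ and $\Delta_n(\hat F^{\mathrm{cyc}}_{n,[n]})=\Delta_n(e_n)=\sum_{\lambda\vdash n}s_\lambda\otimes s_{\lambda'}$, both lying in $\mathrm{Sym}_n\otimes\mathrm{Sym}_n$.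
   Context: $\mathrm{QSym}_n$ is the group of degree-$n$ quasi-symmetric functions, with fundamental basis $F_{n,J}=\sum x_{i_1}\cdots x_{i_n}$ ($J\subseteq[n-1]$), summing over $i_1\le\cdots\le i_n$ with $i_j<i_{j+1}$ for $j\in J$. For $\pi\in\mathfrak{S}_n$, $\mathrm{Des}(\pi)=\{i\in[n-1]:\pi_i>\pi_{i+1}\}$ and $\mathrm{cDes}(\pi)=\{i\in[n]:\pi_i>\pi_{i+1}\}$ with $\pi_{n+1}:=\pi_1$. Permutations multiply by composition. The internal coproduct $\Delta_n:\mathrm{QSym}_n\to\mathrm{QSym}_n\otimes\mathrm{QSym}_n$ is $\Delta_n(F_{n,K})=\sum_{I,J\subseteq[n-1]}a_K^{IJ}F_{n,I}\otimes F_{n,J}$, with $a_K^{IJ}=\#\{(\sigma_1,\sigma_2):\mathrm{Des}(\sigma_1)=I,\mathrm{Des}(\sigma_2)=J,\sigma_2\sigma_1=\pi\}$ for any $\pi$ with $\mathrm{Des}(\pi)=K$ (this is independent of $\pi$); equivalently $\Delta_n(f)$ is obtained by evaluating $f$ on the lexicographically ordered variables $x_iy_j$. For $J\subseteq[n]$, $F^{\mathrm{cyc}}_{n,J}:=\sum_{(w,k)}x_{w_1}\cdots x_{w_n}$ over pairs $w\in\{1,2,\dots\}^n$, $k\in[n]$ with $w_k\le\cdots\le w_n\le w_1\le\cdots\le w_{k-1}$ and $w_j<w_{j+1}$ for $j\in J\setminus\{k-1\}$ (indices mod $n$). $d_J$ is the order of the stabilizer of $J$ under cyclic shifts mod $n$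 (constant on orbits, written $d_A$), and $\hat F^{\mathrm{cyc}}_{n,A}:=F^{\mathrm{cyc}}_{n,J}/d_J$ for $J\in A$. $\mathrm{cQSym}_n$ is the group of degree-$n$ power series $f$ such that for $i_1<\dots<i_t$, $i'_1<\dots<i'_t$, exponents $m=(m_1,\dots,m_t)$ and any cyclic shift $m'$ of $m$, the coefficients of $x_{i_1}^{m_1}\cdots x_{i_t}^{m_t}$ and $x_{i'_1}^{m'_1}\cdots x_{i'_t}^{m'_t}$ agree. $\mathrm{cQSym}^-_n$ is the $\mathbb{Z}$-span of $\hat F^{\mathrm{cyc}}_{n,J}$, $\varnothing\ne J\ne[n]$, for $n>1$; $\mathrm{cQSym}^-_1=\mathbb{Z}e_1$, $\mathrm{cQSym}^-_0=\mathbb{Z}$. $\lambda'$ is the conjugate partition. *)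

theory Defs
  imports Complex_Main "HOL-Library.Multiset" "HOL-Library.Function_Algebras"
    "HOL-Combinatorics.Permutations"
begin

section \<open>Power series over the integers\<close>

text \<open>
  The variables are indexed by \<^typ>\<open>nat\<close>, so they are written \<open>x\<^sub>0, x\<^sub>1, \<dots>\<close> instead of
  \<open>x\<^sub>1, x\<^sub>2, \<dots>\<close>; only the order of the index set matters. The monomial
  \<open>x\<^bsub>w 1\<^esub> \<cdots> x\<^bsub>w n\<^esub>\<close> is the multiset of its indices, and a power series is the function
  taking each monomial to its coefficient. Addition of series (and finite sums) are pointwise.
\<close>

type_synonym series = "nat multiset \<Rightarrow> int"

definition zscale :: "int \<Rightarrow> ('a \<Rightarrow> int) \<Rightarrow> 'a \<Rightarrow> int" where
  "zscale c f = (\<lambda>x. c * f x)"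

global_interpretation zmod: module "zscale :: int \<Rightarrow> ('a \<Rightarrow> int) \<Rightarrow> 'a \<Rightarrow> int"
  by standard (simp_all add: zscale_def fun_eq_iff algebra_simps)

definition homogeneous :: "nat \<Rightarrow> series \<Rightarrow> bool" where
  "homogeneous n f \<longleftrightarrow> (\<forall>M. f M \<noteq> 0 \<longrightarrow> size M = n)"

text \<open>\<open>var_monom u m\<close> is \<open>x\<^bsub>u 1\<^esub>\<^bsup>m 1\<^esup> \<cdots> x\<^bsub>u t\<^esub>\<^bsup>m t\<^esup>\<close>.\<close>

definition var_monom :: "nat list \<Rightarrow> nat list \<Rightarrow> nat multiset" where
  "var_monom u m = (\<Sum>(i, k)\<leftarrow>zip u m. replicate_mset k i)"

definition QSym :: "nat \<Rightarrow> series set" where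
  "QSym n = {f. homogeneous n f \<and>
     (\<forall>u v m. sorted_wrt (<) u \<and> sorted_wrt (<) v \<and>
        length u = length m \<and> length v = length m \<and> 0 \<notin> set m \<longrightarrow>
        f (var_monom u m) = f (var_monom v m))}"

definition cQSym :: "nat \<Rightarrow> series set" where
  "cQSym n = {f. homogeneous n f \<and>
     (\<forall>u v m s. sorted_wrt (<) u \<and> sorted_wrt (<) v \<and>
        length u = length m \<and> length v = length m \<and> 0 \<notin> set m \<longrightarrow>
        f (var_monom u m) = f (var_monom v (rotate s m)))}"

definition Sym :: "nat \<Rightarrow> series set" where
  "Sym n = {f. homogeneous n f \<and> (\<forall>p M. bij p \<longrightarrow> f (image_mset p M) = f M)}"

definition hsym :: "nat \<Rightarrow> series" where
  "hsym n M = (if size M = n then 1 else 0)"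

definition esym :: "nat \<Rightarrow> series" where
  "esym n M = (if size M = n \<and> (\<forall>x. count M x \<le> 1) then 1 else 0)"

text \<open>The list \<open>w\<close> has entries \<open>w\<^sub>1, \<dots>, w\<^sub>n\<close> with \<open>w\<^sub>j = w ! (j - 1)\<close>.\<close>

definition F :: "nat \<Rightarrow> nat set \<Rightarrow> series" where
  "F n J M = int (card {w. length w = n \<and> sorted w \<and> (\<forall>j\<in>J. w ! (j - 1) < w ! j) \<and> mset w = M})"


section \<open>Schur functions\<close>

definition partitions :: "nat \<Rightarrow> nat list set" where
  "partitions n = {l. sorted_wrt (\<ge>) l \<and> 0 \<notin> set l \<and> sum_list l = n}"

definition conj_part :: "nat list \<Rightarrow> nat list" where
  "conj_part l = map (\<lambda>j. length (filter (\<lambda>r. j < r) l)) [0..<(if l = [] then 0 else hd l)]"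

text \<open>A tableau is the list of its rows.\<close>

definition ssyt :: "nat list \<Rightarrow> nat list list \<Rightarrow> bool" where
  "ssyt l T \<longleftrightarrow> map length T = l \<and> (\<forall>r\<in>set T. sorted r) \<and>
     (\<forall>i j. Suc i < length T \<longrightarrow> j < length (T ! Suc i) \<longrightarrow> T ! i ! j < T ! Suc i ! j)"

definition schur :: "nat list \<Rightarrow> series" where
  "schur l M = int (card {T. ssyt l T \<and> mset (concat T) = M})"


section \<open>Tensor products\<close>

text \<open>
  \<open>f \<otimes> g\<close> is realised as the power series \<open>f(x) g(y)\<close> in two alphabets, and the tensor product
  of groups \<open>A\<close>, \<open>B\<close> of power series as the integer span of the \<open>f \<otimes> g\<close>. For subgroups \<open>A\<close>, \<open>B\<close>
  of a free group of series this is the abstract tensor product: by the lemma below,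
  \<open>\<Sum>\<^sub>i b\<^sub>i \<otimes> g\<^sub>i\<close> with linearly independent \<open>b\<^sub>i\<close> vanishes only if all \<open>g\<^sub>i\<close> do.
\<close>

definition tens :: "('a \<Rightarrow> int) \<Rightarrow> ('b \<Rightarrow> int) \<Rightarrow> 'a \<times> 'b \<Rightarrow> int" (infixr "\<otimes>" 75) where
  "f \<otimes> g = (\<lambda>(M, N). f M * g N)"

definition tensor_group ::
    "('a \<Rightarrow> int) set \<Rightarrow> ('b \<Rightarrow> int) set \<Rightarrow> ('a \<times> 'b \<Rightarrow> int) set" where
  "tensor_group A B = zmod.span {f \<otimes> g | f g. f \<in> A \<and> g \<in> B}"

lemma sum_fun_apply: "(\<Sum>i\<in>I. (f i :: 'a \<Rightarrow> int)) x = (\<Sum>i\<in>I. f i x)"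
  by (induction I rule: infinite_finite_induct) auto

lemma tens_sum_eq_0:
  fixes b :: "'i \<Rightarrow> 'a \<Rightarrow> int" and g :: "'i \<Rightarrow> 'b \<Rightarrow> int"
  assumes "finite I" "inj_on b I" "zmod.independent (b ` I)"
    and "(\<Sum>i\<in>I. b i \<otimes> g i) = 0" and "i \<in> I"
  shows "g i = 0"
proof
  fix N
  let ?u = "\<lambda>v. g (the_inv_into I b v) N"
  have "(\<Sum>v\<in>b ` I. zscale (?u v) v) = (\<Sum>i\<in>I. zscale (g i N) (b i))"
    using assms(2) by (simp add: sum.reindex the_inv_into_f_f)
  also have "\<dots> = 0"
  proof
    fix M
    have "(\<Sum>i\<in>I. b i \<otimes> g i) (M, N) = 0"
      using assms(4) by simp
    then show "(\<Sum>i\<in>I. zscale (g i N) (b i)) M = 0 M"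
      by (simp add: sum_fun_apply tens_def zscale_def mult.commute)
  qed
  finally have "?u (b i) = 0"
    using zmod.independentD[OF assms(3), of "b ` I" ?u "b i"] assms(1,5) by blast
  then show "g i N = 0 N"
    using assms(2,5) by (simp add: the_inv_into_f_f)
qed


section \<open>Descents and the internal coproduct\<close>

text \<open>
  A permutation in \<open>S\<^sub>n\<close> is a function \<open>\<pi>\<close> with \<open>\<pi> permutes {1..n}\<close>; \<open>csucc n\<close> is the cyclic
  successor on \<open>{1..n}\<close>.
\<close>

definition csucc :: "nat \<Rightarrow> nat \<Rightarrow> nat" where
  "csucc n i = (if i = n then 1 else i + 1)"

definition Des :: "nat \<Rightarrow> (nat \<Rightarrow> nat) \<Rightarrow> nat set" where
  "Des n \<pi> = {i \<in> {1..<n}. \<pi> i > \<pi> (i + 1)}"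

definition cDes :: "nat \<Rightarrow> (nat \<Rightarrow> nat) \<Rightarrow> nat set" where
  "cDes n \<pi> = {i \<in> {1..n}. \<pi> i > \<pi> (csucc n i)}"

text \<open>
  The coefficient \<open>a\<^sub>K\<^sup>I\<^sup>J\<close>; the number is the same for every \<open>\<pi>\<close> with \<open>Des \<pi> = K\<close>.
\<close>

definition acoeff :: "nat \<Rightarrow> nat set \<Rightarrow> nat set \<Rightarrow> nat set \<Rightarrow> nat" where
  "acoeff n K I J = card {(\<sigma>\<^sub>1, \<sigma>\<^sub>2). \<sigma>\<^sub>1 permutes {1..n} \<and> \<sigma>\<^sub>2 permutes {1..n} \<and>
      Des n \<sigma>\<^sub>1 = I \<and> Des n \<sigma>\<^sub>2 = J \<and>
      \<sigma>\<^sub>2 \<circ> \<sigma>\<^sub>1 = (SOME \<pi>. \<pi> permutes {1..n} \<and> Des n \<pi> = K)}"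

text \<open>
  The linear extension of \<open>F\<^sub>n\<^sub>,\<^sub>K \<mapsto> \<Sum> a\<^sub>K\<^sup>I\<^sup>J F\<^sub>n\<^sub>,\<^sub>I \<otimes> F\<^sub>n\<^sub>,\<^sub>J\<close> from the basis \<open>F\<^sub>n\<^sub>,\<^sub>K\<close> of \<open>QSym\<^sub>n\<close>:
  \<open>zmod.representation\<close> yields the coordinates of \<open>f\<close>. Only meaningful for \<open>f \<in> QSym n\<close>.
\<close>

definition Delta :: "nat \<Rightarrow> series \<Rightarrow> nat multiset \<times> nat multiset \<Rightarrow> int" where
  "Delta n f =
     (\<Sum>K\<in>Pow {1..<n}. zscale (zmod.representation (F n ` Pow {1..<n}) f (F n K))
        (\<Sum>I\<in>Pow {1..<n}. \<Sum>J\<in>Pow {1..<n}. zscale (int (acoeff n K I J)) (F n I \<otimes> F n J)))"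

text \<open>
  The counit of \<open>QSym\<^sub>n\<close>: it sends \<open>f\<close> to \<open>f(1, 0, 0, \<dots>)\<close>, that is \<open>F\<^sub>n\<^sub>,\<^sub>\<emptyset> \<mapsto> 1\<close> and
  \<open>F\<^sub>n\<^sub>,\<^sub>K \<mapsto> 0\<close> for \<open>K \<noteq> \<emptyset>\<close>.
\<close>

definition counit :: "nat \<Rightarrow> series \<Rightarrow> int" where
  "counit n f = f (replicate_mset n 0)"

text \<open>
  A group \<open>V\<close> of quasi-symmetric functions that is a right comodule with coaction \<open>Delta n\<close>.
  In the realisation above, \<open>L \<otimes> id\<close> and \<open>id \<otimes> L\<close> apply \<open>L\<close> to a two-alphabet series with the
  monomial in the other alphabet held fixed, so the last two clauses are
  \<open>(\<Delta> \<otimes> id) \<Delta> f = (id \<otimes> \<Delta>) \<Delta> f\<close> and \<open>(id \<otimes> \<epsilon>) \<Delta> f = f\<close>.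
\<close>

definition right_comodule :: "nat \<Rightarrow> series set \<Rightarrow> bool" where
  "right_comodule n V \<longleftrightarrow>
     zmod.subspace V \<and> V \<subseteq> QSym n \<and>
     Delta n ` V \<subseteq> tensor_group V (QSym n) \<and>
     (\<forall>f\<in>V. \<forall>M N P. Delta n (\<lambda>X. Delta n f (X, P)) (M, N) = Delta n (\<lambda>Y. Delta n f (M, Y)) (N, P)) \<and>
     (\<forall>f\<in>V. \<forall>M. counit n (\<lambda>Y. Delta n f (M, Y)) = f M)"


section \<open>Cyclic quasi-symmetric functions\<close>

text \<open>
  \<open>rotate (k - 1) w\<close> is \<open>w\<^sub>k, \<dots>, w\<^sub>n, w\<^sub>1, \<dots>, w\<^bsub>k-1\<^esub>\<close>, and \<open>csucc n j \<noteq> k\<close> says that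
  \<open>j\<close> is not \<open>k - 1\<close> modulo \<open>n\<close>.
\<close>

definition Fcyc :: "nat \<Rightarrow> nat set \<Rightarrow> series" where
  "Fcyc n J M = int (card {(w, k). length w = n \<and> k \<in> {1..n} \<and> sorted (rotate (k - 1) w) \<and>
      (\<forall>j\<in>J. csucc n j \<noteq> k \<longrightarrow> w ! (j - 1) < w ! (csucc n j - 1)) \<and> mset w = M})"

definition cshift :: "nat \<Rightarrow> nat \<Rightarrow> nat set \<Rightarrow> nat set" where
  "cshift n s J = (csucc n ^^ s) ` J"

definition stab_order :: "nat \<Rightarrow> nat set \<Rightarrow> nat" where
  "stab_order n J = card {s. s < n \<and> cshift n s J = J}"

text \<open>
  The division is exact: the stabilizer of \<open>J\<close> acts on the pairs \<open>(w, k)\<close> of each given content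
  by simultaneously rotating \<open>w\<close> and \<open>k\<close>, and freely because it moves \<open>k\<close>.
\<close>

definition Fhat :: "nat \<Rightarrow> nat set \<Rightarrow> series" where
  "Fhat n J M = Fcyc n J M div int (stab_order n J)"

definition corbits :: "nat \<Rightarrow> nat set set set" where
  "corbits n = {{cshift n s J | s. s < n} | J. J \<subseteq> {1..n} \<and> J \<noteq> {} \<and> J \<noteq> {1..n}}"

text \<open>Versions for an orbit \<open>A\<close>; both are independent of the representative.\<close>

definition orb_d :: "nat \<Rightarrow> nat set set \<Rightarrow> nat" where
  "orb_d n A = stab_order n (SOME J. J \<in> A)"

definition orb_Fhat :: "nat \<Rightarrow> nat set set \<Rightarrow> series" where
  "orb_Fhat n A = Fhat n (SOME J. J \<in> A)"

definition cQSym_minus :: "nat \<Rightarrow> series set" where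
  "cQSym_minus n =
     (if n = 0 then zmod.span {\<lambda>M. if M = {#} then 1 else 0}
      else if n = 1 then zmod.span {esym 1}
      else zmod.span {Fhat n J | J. J \<subseteq> {1..n} \<and> J \<noteq> {} \<and> J \<noteq> {1..n}})"

text \<open>
  \<open>cyc_count n \<pi> A J\<close> counts the factorizations of a given \<open>\<pi>\<close>; \<open>atilde\<close> is its value at some
  \<open>\<pi>\<close> with cyclic descent set in \<open>B\<close>.
\<close>

definition cyc_count :: "nat \<Rightarrow> (nat \<Rightarrow> nat) \<Rightarrow> nat set set \<Rightarrow> nat set \<Rightarrow> nat" where
  "cyc_count n \<pi> A J = card {(\<sigma>\<^sub>1, \<sigma>\<^sub>2). \<sigma>\<^sub>1 permutes {1..n} \<and> \<sigma>\<^sub>2 permutes {1..n} \<and>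
      cDes n \<sigma>\<^sub>1 \<in> A \<and> Des n \<sigma>\<^sub>2 = J \<and> \<sigma>\<^sub>2 \<circ> \<sigma>\<^sub>1 = \<pi>}"

definition atilde :: "nat \<Rightarrow> nat set set \<Rightarrow> nat set set \<Rightarrow> nat set \<Rightarrow> nat" where
  "atilde n B A J = cyc_count n (SOME \<pi>. \<pi> permutes {1..n} \<and> cDes n \<pi> \<in> B) A J"

definition struct_const :: "nat \<Rightarrow> nat set set \<Rightarrow> nat set set \<Rightarrow> nat set \<Rightarrow> rat" where
  "struct_const n B A J = of_nat (orb_d n A) / of_nat (orb_d n B) * of_nat (atilde n B A J)"

end

theory Submission
  imports Defs "HOL-Library.Product_Lexorder"
begin

text \<open>
  The coefficient of a bimonomial \<open>x\<^sup>M y\<^sup>N\<close> in \<open>F\<^bsub>Des \<pi>\<^esub>\<close>, evaluated at the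
  lexicographically ordered variables \<open>x\<^sub>i y\<^sub>j\<close>, counts words depending only on \<open>Des \<pi>\<close>;
  standardizing them shows that it equals the sum of \<open>F\<^bsub>Des \<sigma>\<^sub>1\<^esub> \<otimes> F\<^bsub>Des \<sigma>\<^sub>2\<^esub>\<close> over all
  \<open>\<sigma>\<^sub>2 \<sigma>\<^sub>1 = \<pi>\<close>. Coassociativity and the counit law follow. The function \<open>Fcyc\<close> of \<open>cDes \<pi>\<close> is the
  sum of the \<open>F\<close> of \<open>Des (\<pi> c\<^sup>s)\<close> over the rotations \<open>c\<^sup>s\<close>, and these act on the factor \<open>\<sigma>\<^sub>1\<close> alone,
  which gives the cyclic coproduct formula. Its independence of \<open>\<pi>\<close> and the integrality of the
  structure constants come from unitriangularity: \<open>Fhat\<close> of an orbit \<open>A\<close> at a monomial with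
  ascent set \<open>S\<close> is the number of \<open>K \<in> A\<close> contained in \<open>S \<union> {n}\<close>.

  The coefficients of \<open>\<Delta> h\<^sub>n\<close> and \<open>\<Delta> e\<^sub>n\<close> count matrices with prescribed margins and entries in
  \<open>\<nat>\<close> or \<open>{0, 1}\<close>. The (dual) Cauchy identity is proved letter by letter from a local rule for
  adding and removing horizontal and vertical strips.
\<close>

section \<open>Ascent sets of monomials\<close>

text \<open>\<open>Delta\<close> is built from coordinates in the basis \<open>F\<close> and from
  coefficients taken at an arbitrarily chosen permutation. That the choice is harmless must be
  proved: the sum over all factorizations of \<open>\<pi>\<close> counts words that see only
  \<open>Des n \<pi>\<close>, and independence of the products \<open>F n I \<otimes> F n J\<close>
  turns this equality of series into equality of the single coefficients. In the cyclic case the sum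
  over rotations gives \<open>d\<^sub>B\<close> times the function of the orbit \<open>B\<close>,
  not the function itself; reading the identity modulo \<open>d\<^sub>B\<close> makes the structure
  constants integral. The position n plays a special role throughout. Adjoining n to an ascent set
  gives the partial sums of the exponent sequence, so that rotating exponents is a shift of this set
  modulo n. It is also the place where a cyclic word is cut open, and no inequality is imposed
  there. The full set \<open>{1..n}\<close> is never a cyclic descent set, although its function,
  the elementary symmetric one, is among the generators of the cyclic space. Its coproduct is
  therefore controlled by the matrix count, which is visibly symmetric in rows and in
  columns.\<close>

definition ascents :: "nat list \<Rightarrow> nat set" where
  "ascents w = {j \<in> {1..<length w}. w ! (j - 1) < w ! j}"

definition asc :: "nat multiset \<Rightarrow> nat set" where
  "asc M = ascents (sorted_list_of_multiset M)"

lemma length_sorted_list_of_multiset [simp]: "length (sorted_list_of_multiset M) = size M"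
  by (metis mset_sorted_list_of_multiset size_mset)

lemma sorted_list_of_multiset_unique:
  "sorted w \<Longrightarrow> mset w = M \<Longrightarrow> sorted_list_of_multiset M = w"
  by (metis sorted_list_of_multiset_mset sorted_sort_id)

lemma ascents_subset: "ascents w \<subseteq> {1..<length w}"
  by (auto simp: ascents_def)

lemma asc_subset: "asc M \<subseteq> {1..<size M}"
  using ascents_subset[of "sorted_list_of_multiset M"] by (simp add: asc_def)

lemma asc_mset: "sorted w \<Longrightarrow> asc (mset w) = ascents w"
  by (simp only: asc_def sorted_list_of_multiset_unique)

text \<open>A monomial has exactly one weakly increasing arrangement, so the defining count is 0 or
  1 and only tests whether the strict increases demanded by \<open>J\<close> occur in that
  arrangement. Series are handled through ascent sets from here on.\<close>

lemma F_eq: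
  assumes "J \<subseteq> {1..<n}"
  shows "F n J M = (if size M = n \<and> J \<subseteq> asc M then 1 else 0)"
proof -
  have "{w. length w = n \<and> sorted w \<and> (\<forall>j\<in>J. w ! (j - 1) < w ! j) \<and> mset w = M} =
      (if size M = n \<and> J \<subseteq> asc M then {sorted_list_of_multiset M} else {})" (is "?L = ?R")
  proof (intro set_eqI iffI)
    fix w assume "w \<in> ?L"
    then have w: "length w = n" "sorted w" "\<forall>j\<in>J. w ! (j - 1) < w ! j" "mset w = M" by auto
    have "sorted_list_of_multiset M = w" using w sorted_list_of_multiset_unique by blast
    moreover have "size M = n" using w by auto
    moreover have "J \<subseteq> asc M" using w assms by (auto simp: asc_mset ascents_def)
    ultimately show "w \<in> ?R" by simp
  next
    fix w assume "w \<in> ?R"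
    then have *: "w = sorted_list_of_multiset M" "size M = n" "J \<subseteq> asc M"
      by (auto split: if_splits)
    then show "w \<in> ?L" by (auto simp: asc_def ascents_def subset_iff)
  qed
  then show ?thesis by (simp add: F_def)
qed

lemma ex_asc:
  assumes "S \<subseteq> {1..<n}"
  shows "\<exists>M. size M = n \<and> asc M = S"
proof -
  \<comment> \<open>The word climbs by one exactly at the elements of \<open>S\<close>: its entry at
    index \<open>i\<close> is the number of elements of \<open>S\<close> up to
    \<open>i\<close>.\<close>
  define w where "w = map (\<lambda>i. card {j\<in>S. j \<le> i}) [0..<n]"
  have fin: "finite {j\<in>S. j \<le> i}" for i by simp
  have "sorted w" unfolding w_def sorted_iff_nth_mono
    by (auto intro!: card_mono)
  have "card {i\<in>S. i \<le> j - 1} < card {i\<in>S. i \<le> j} \<longleftrightarrow> j \<in> S" if "1 \<le> j" for j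
  proof (cases "j \<in> S")
    case True
    then have "j \<in> {i\<in>S. i \<le> j} - {i\<in>S. i \<le> j - 1}" using that by auto
    then have "{i\<in>S. i \<le> j - 1} \<subset> {i\<in>S. i \<le> j}" by auto
    then show ?thesis using True psubset_card_mono[OF fin] by blast
  next
    case False
    then have "{i\<in>S. i \<le> j - 1} = {i\<in>S. i \<le> j}" using that
      by (auto simp: le_less Suc_le_eq)
    then show ?thesis using False by simp
  qed
  then have "ascents w = S"
    using assms by (fastforce simp: ascents_def w_def)
  then have "asc (mset w) = S" using \<open>sorted w\<close> asc_mset by simp
  moreover have "size (mset w) = n" by (simp add: w_def)
  ultimately show ?thesis by blast
qed

text \<open>Partial sums of a composition, with the total included and 0 left out. For positive
  parts this is the usual correspondence between compositions of n and subsets of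
  \<open>{1..n}\<close> containing n.\<close>

primrec psums :: "nat list \<Rightarrow> nat set" where
  "psums [] = {}"
| "psums (a # m) = insert a ((+) a ` psums m)"

lemma psums_pos: "0 \<notin> set m \<Longrightarrow> x \<in> psums m \<Longrightarrow> 0 < x"
  by (induction m arbitrary: x) auto

lemma psums_le: "x \<in> psums m \<Longrightarrow> x \<le> sum_list m"
  by (induction m arbitrary: x) auto

lemma finite_psums [simp]: "finite (psums m)"
  by (induction m) auto

lemma psums_append: "psums (m @ m') = psums m \<union> (+) (sum_list m) ` psums m'"
  by (induction m) (auto simp: image_Un image_image add.assoc)

lemma psums_split: "p \<in> psums m \<Longrightarrow> \<exists>m1 m2. m = m1 @ m2 \<and> sum_list m1 = p"
proof (induction m arbitrary: p)
  case (Cons a m)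
  show ?case
  proof (cases "p = a")
    case True
    then show ?thesis by (intro exI[of _ "[a]"] exI[of _ m]) auto
  next
    case False
    then obtain q where "q \<in> psums m" "p = a + q" using Cons by auto
    then obtain m1 m2 where "m = m1 @ m2" "sum_list m1 = q" using Cons by blast
    then show ?thesis using \<open>p = a + q\<close> by (intro exI[of _ "a # m1"] exI[of _ m2]) auto
  qed
qed simp

text \<open>The least partial sum is the first part; deleting it and translating back leaves the
  partial sums of the tail, so the parts can be read off one by one.\<close>

lemma psums_inject:
  assumes "0 \<notin> set m" "0 \<notin> set m'" "psums m = psums m'"
  shows "m = m'"
  using assms
proof (induction m arbitrary: m')
  case Nil
  then show ?case by (cases m') auto
next
  case (Cons a m)
  then obtain b l where m': "m' = b # l" by (cases m') auto
  have hd: "Min (psums (c # k)) = c" for c k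
    by (intro Min_eqI) auto
  have ab: "a = b" using hd[of a m] hd[of b l] Cons.prems(3) m' by simp
  have rest: "(+) c ` psums k = psums (c # k) - {c}" if "0 \<notin> set k" for c k
  proof -
    have "0 \<notin> psums k" using psums_pos[OF that] by blast
    then show ?thesis by force
  qed
  have "0 \<notin> set m" "0 \<notin> set l" using Cons.prems m' by auto
  then have "(+) a ` psums m = (+) a ` psums l"
    using rest[of m a] rest[of l a] Cons.prems(3) unfolding m' ab by (metis (no_types))
  then have "psums m = psums l" by (simp add: inj_image_eq_iff)
  then show ?case using Cons m' ab by auto
qed

lemma var_monom_Nil [simp]: "var_monom [] m = {#}" "var_monom u [] = {#}"
  by (simp_all add: var_monom_def)

lemma var_monom_Cons [simp]: "var_monom (i # u) (k # m) = replicate_mset k i + var_monom u m"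
  by (simp add: var_monom_def)

lemma var_monom_append: "length u = length m \<Longrightarrow>
    var_monom (u @ u') (m @ m') = var_monom u m + var_monom u' m'"
  by (simp add: var_monom_def)

lemma size_var_monom: "length u = length m \<Longrightarrow> size (var_monom u m) = sum_list m"
  by (induction u m rule: list_induct2) auto

lemma set_var_monom: "set_mset (var_monom u m) \<subseteq> set u"
proof (induction u arbitrary: m)
  case (Cons a u)
  then show ?case by (cases m) (auto split: if_splits dest: subsetD[OF Cons])
qed simp

lemma image_var_monom: "image_mset p (var_monom u m) = var_monom (map p u) m"
proof (induction u arbitrary: m)
  case (Cons a u)
  then show ?case by (cases m) auto
qed simp

text \<open>Once the length is adjoined, ascent sets obey the recursion of \<open>psums\<close>: a
  leading block of \<open>k\<close> equal smaller letters contributes \<open>k\<close> and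
  translates everything else by \<open>k\<close>.\<close>

lemma insert_ascents_append:
  assumes "0 < k" "r \<noteq> []" "\<forall>y\<in>set r. x < y"
  shows "insert (k + length r) (ascents (replicate k x @ r)) = insert k ((+) k ` insert (length r) (ascents r))"
proof -
  have "j \<in> ascents (replicate k x @ r) \<longleftrightarrow> j = k \<or> j \<in> (+) k ` ascents r" for j
  proof -
    consider "j < k" | "j = k" | i where "j = k + Suc i"
      by (metis less_imp_Suc_add nat_neq_iff add_Suc_right)
    then show ?thesis
    proof cases
      case 3
      then show ?thesis using assms by (auto simp: ascents_def nth_append)
    qed (use assms in \<open>auto simp: ascents_def nth_append\<close>)
  qed
  then show ?thesis by auto
qed

text \<open>The link between two descriptions of a monomial: the exponent sequence, by which
  \<open>QSym\<close> and \<open>cQSym\<close> are defined, and the ascent set, which governs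
  \<open>F\<close> and \<open>Fcyc\<close>.\<close>

lemma asc_var_monom:
  assumes "sorted_wrt (<) u" "length u = length m" "0 \<notin> set m" "m \<noteq> []"
  shows "insert (sum_list m) (asc (var_monom u m)) = psums m"
proof -
  have "\<exists>w. sorted w \<and> mset w = var_monom u m \<and> insert (length w) (ascents w) = psums m"
    using assms(2,1,3,4)
  proof (induction u m rule: list_induct2)
    case (Cons i u k m)
    show ?case
    proof (cases "m = []")
      case True
      then have "ascents (replicate k i) = {}" by (auto simp: ascents_def)
      then show ?thesis using True Cons by (intro exI[of _ "replicate k i"]) auto
    next
      case False
      then obtain w where w: "sorted w" "mset w = var_monom u m"
          "insert (length w) (ascents w) = psums m" using Cons by auto
      have gt: "\<forall>y\<in>set w. i < y"
        using set_var_monom[of u m] Cons.prems w(2) by (metis set_mset_mset sorted_wrt.simps(2) subsetD)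
      have "0 \<notin> psums m" using psums_pos[of m 0] Cons.prems by auto
      then have "w \<noteq> []" using w(3) by (metis insertI1 list.size(3))
      then have "insert (k + length w) (ascents (replicate k i @ w)) = psums (k # m)"
        using insert_ascents_append[of k w i] gt Cons.prems w(3) by auto
      moreover have "sorted (replicate k i @ w)" using w gt by (auto simp: sorted_append less_imp_le)
      ultimately show ?thesis using w by (intro exI[of _ "replicate k i @ w"]) auto
    qed
  qed simp
  then show ?thesis using size_var_monom[OF assms(2)] asc_mset by (metis size_mset)
qed

lemma ex_var_monom:
  "\<exists>u m. sorted_wrt (<) u \<and> length u = length m \<and> 0 \<notin> set m \<and> M = var_monom u m"
proof -
  let ?u = "sorted_list_of_set (set_mset M)"
  have "count (var_monom u (map (count M) u)) x = (if x \<in> set u then count M x else 0)"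
    if "distinct u" for u x
    using that by (induction u) (auto simp: var_monom_def)
  then have "M = var_monom ?u (map (count M) ?u)"
    by (intro multiset_eqI) (auto simp: not_in_iff)
  then show ?thesis by (intro exI[of _ ?u] exI[of _ "map (count M) ?u"]) (auto simp: not_in_iff[symmetric])
qed

lemma ex_var_monom_psums:
  assumes "size M = n" "0 < n"
  obtains u m where "sorted_wrt (<) u" "length u = length m" "0 \<notin> set m" "M = var_monom u m"
    "sum_list m = n" "insert n (asc M) = psums m"
proof -
  obtain u m where *: "sorted_wrt (<) u" "length u = length m" "0 \<notin> set m" "M = var_monom u m"
    using ex_var_monom[of M] by (elim exE conjE)
  have n: "sum_list m = n" using size_var_monom[OF *(2)] *(4) assms(1) by simp
  then have "m \<noteq> []" using assms(2) by auto
  then have "insert n (asc M) = psums m" using asc_var_monom[OF *(1-3)] n *(4) by simp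
  with * n show ?thesis by (rule that)
qed

section \<open>Quasi-symmetry in terms of ascent sets\<close>

lemma QSym_D:
  "f \<in> QSym n \<Longrightarrow> sorted_wrt (<) u \<Longrightarrow> sorted_wrt (<) v \<Longrightarrow> length u = length m \<Longrightarrow>
    length v = length m \<Longrightarrow> 0 \<notin> set m \<Longrightarrow> f (var_monom u m) = f (var_monom v m)"
  unfolding QSym_def by blast

text \<open>Equal ascent sets mean equal exponent sequences, by \<open>asc_var_monom\<close> and
  \<open>psums_inject\<close>. Together with the converse \<open>QSym_I\<close>, quasi-symmetry
  becomes homogeneity plus coefficients that depend only on \<open>asc M\<close>.\<close>

lemma QSym_cong:
  assumes "f \<in> QSym n" "size M = n" "size M' = n" "asc M = asc M'"
  shows "f M = f M'"
proof (cases "n = 0")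
  case False
  then have "0 < n" by simp
  obtain u m where um: "sorted_wrt (<) u" "length u = length m" "0 \<notin> set m" "M = var_monom u m"
      "insert n (asc M) = psums m"
    using ex_var_monom_psums[OF assms(2) \<open>0 < n\<close>] by metis
  obtain u' m' where um': "sorted_wrt (<) u'" "length u' = length m'" "0 \<notin> set m'"
      "M' = var_monom u' m'" "insert n (asc M') = psums m'"
    using ex_var_monom_psums[OF assms(3) \<open>0 < n\<close>] by metis
  have "psums m = psums m'" using um um' assms(4) by simp
  then have "m = m'" using psums_inject um um' by blast
  then show ?thesis using QSym_D[OF assms(1) um(1) um'(1)] um um' by metis
next
  \<comment> \<open>Degree 0 is separate because \<open>psums []\<close> is empty and does not
    contain the total 0.\<close>
  case True
  then have "M = {#}" "M' = {#}" using assms(2,3) by auto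
  then show ?thesis by simp
qed

lemma QSym_homogeneous:
  assumes "f \<in> QSym n" "size M \<noteq> n"
  shows "f M = 0"
proof -
  have "homogeneous n f" using assms(1) unfolding QSym_def by blast
  then show ?thesis using assms(2) unfolding homogeneous_def by metis
qed

lemma QSym_I:
  assumes "\<And>M. size M \<noteq> n \<Longrightarrow> f M = 0"
    and "\<And>M M'. size M = n \<Longrightarrow> size M' = n \<Longrightarrow> asc M = asc M' \<Longrightarrow> f M = f M'"
  shows "f \<in> QSym n"
proof -
  have "f (var_monom u m) = f (var_monom v m)"
    if "sorted_wrt (<) u" "sorted_wrt (<) v" "length u = length m" "length v = length m" "0 \<notin> set m" for u v m
  proof (cases "m = [] \<or> sum_list m \<noteq> n")
    case True
    then show ?thesis using assms(1)[of "var_monom u m"] assms(1)[of "var_monom v m"]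
        size_var_monom[OF that(3)] size_var_monom[OF that(4)] by auto
  next
    case False
    have "asc (var_monom w m) = psums m - {n}" if "sorted_wrt (<) w" "length w = length m" for w
    proof -
      have "n \<notin> asc (var_monom w m)"
        using asc_subset[of "var_monom w m"] size_var_monom[OF that(2)] False by auto
      then show ?thesis using asc_var_monom[OF that] \<open>0 \<notin> set m\<close> False by auto
    qed
    then have "asc (var_monom u m) = asc (var_monom v m)" using that by metis
    then show ?thesis using False that by (intro assms(2)) (simp_all add: size_var_monom)
  qed
  moreover have "homogeneous n f" unfolding homogeneous_def using assms(1) by metis
  ultimately show ?thesis unfolding QSym_def by blast
qed

lemma F_in_QSym: "J \<subseteq> {1..<n} \<Longrightarrow> F n J \<in> QSym n"
  by (intro QSym_I) (auto simp: F_eq)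

lemma subspace_QSym: "zmod.subspace (QSym n)"
proof (rule zmod.subspaceI)
  show "0 \<in> QSym n" by (rule QSym_I) auto
next
  fix f g assume fg: "f \<in> QSym n" "g \<in> QSym n"
  show "f + g \<in> QSym n"
  proof (rule QSym_I)
    show "(f + g) M = (f + g) M'" if "size M = n" "size M' = n" "asc M = asc M'" for M M'
      using QSym_cong[OF fg(1) that] QSym_cong[OF fg(2) that] by simp
  qed (simp add: QSym_homogeneous[OF fg(1)] QSym_homogeneous[OF fg(2)])
next
  fix c f assume f: "f \<in> QSym n"
  show "zscale c f \<in> QSym n"
  proof (rule QSym_I)
    show "zscale c f M = zscale c f M'" if "size M = n" "size M' = n" "asc M = asc M'" for M M'
      using QSym_cong[OF f that] by (simp add: zscale_def)
  qed (simp add: zscale_def QSym_homogeneous[OF f])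
qed

section \<open>Triangular families\<close>

lemma sum_zscale_apply: "(\<Sum>i\<in>I. zscale (c i) (f i)) x = (\<Sum>i\<in>I. c i * f i x)"
  by (simp add: sum_fun_apply zscale_def)

text \<open>
  Both the fundamental basis and its cyclic analogue are unitriangular with respect to evaluation
  at suitable monomials \<open>p i\<close>.
\<close>

locale triangular =
  fixes I :: "'i set" and b :: "'i \<Rightarrow> 'a \<Rightarrow> int" and p :: "'i \<Rightarrow> 'a" and r :: "'i \<Rightarrow> nat"
  assumes finite_I: "finite I"
    and diag: "i \<in> I \<Longrightarrow> b i (p i) = 1"
    and upper: "i \<in> I \<Longrightarrow> j \<in> I \<Longrightarrow> i \<noteq> j \<Longrightarrow> r i \<le> r j \<Longrightarrow> b j (p i) = 0"
begin

text \<open>For \<open>d = 0\<close> this is linear independence.\<close>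

lemma dvd_coeffs:
  fixes d :: int
  assumes "\<And>x. d dvd (\<Sum>j\<in>I. c j * b j x)" and "i \<in> I"
  shows "d dvd c i"
  using assms(2)
proof (induction "r i" arbitrary: i rule: less_induct)
  case less
  \<comment> \<open>Evaluation at \<open>p i\<close> isolates \<open>c i\<close>: coefficients of
    smaller rank are divisible by induction, and the other basis elements of equal or larger rank
    vanish at this point.\<close>
  have "(\<Sum>j\<in>I. c j * b j (p i)) = c i + (\<Sum>j\<in>I - {i}. c j * b j (p i))"
    using less.prems finite_I by (simp add: sum.remove diag)
  moreover have "d dvd (\<Sum>j\<in>I - {i}. c j * b j (p i))"
  proof (rule dvd_sum)
    fix j assume j: "j \<in> I - {i}"
    show "d dvd c j * b j (p i)"
    proof (cases "r j < r i")
      case True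
      then show ?thesis using less j by simp
    next
      case False
      then show ?thesis using upper[of i j] less.prems j by auto
    qed
  qed
  ultimately show ?case using assms(1)[of "p i"] by (simp add: dvd_add_left_iff)
qed

lemma coeffs_unique:
  assumes "\<And>x. (\<Sum>j\<in>I. c j * b j x) = (\<Sum>j\<in>I. c' j * b j x)" and "i \<in> I"
  shows "c i = c' i"
proof -
  have "0 dvd c i - c' i"
    by (rule dvd_coeffs[of 0 "\<lambda>j. c j - c' j"])
      (use assms in \<open>simp_all add: left_diff_distrib sum_subtractf\<close>)
  then show ?thesis by simp
qed

lemma inj: "inj_on b I"
proof
  fix i j assume *: "i \<in> I" "j \<in> I" "b i = b j"
  show "i = j"
  proof (rule ccontr)
    assume "i \<noteq> j"
    then have "b j (p i) = 0 \<or> b i (p j) = 0" using upper * by (metis nat_le_linear)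
    then show False using * diag[of i] diag[of j] by auto
  qed
qed

lemma independent: "zmod.independent (b ` I)"
proof -
  have "c v = 0" if c: "(\<Sum>v\<in>b ` I. zscale (c v) v) = 0" and "v \<in> b ` I" for c v
  proof -
  from that obtain i where i: "i \<in> I" "v = b i" by auto
  have "(\<Sum>j\<in>I. zscale (c (b j)) (b j)) = 0"
    using c by (simp add: sum.reindex[OF inj])
  then have "(\<Sum>j\<in>I. c (b j) * b j x) = (\<Sum>j\<in>I. 0 * b j x)" for x
    using sum_zscale_apply[of "\<lambda>j. c (b j)" b I x] by simp
  from coeffs_unique[OF this i(1)] show "c v = 0" using i by simp
  qed
  then show ?thesis using finite_I by (auto simp: zmod.dependent_finite)
qed

text \<open>Elimination by rank. An approximation that is correct at all points of rank below
  \<open>k\<close> is repaired at rank \<open>k\<close> by adding multiples of the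
  \<open>b i\<close> of rank \<open>k\<close>; these vanish at the points of smaller rank and at
  each other's points, so nothing is spoiled. The ones on the diagonal keep the multiples integral,
  and \<open>det\<close> turns agreement at all points into equality.\<close>

lemma subset_span:
  assumes "zmod.subspace V" "b ` I \<subseteq> V"
    and det: "\<And>f. f \<in> V \<Longrightarrow> (\<And>i. i \<in> I \<Longrightarrow> f (p i) = 0) \<Longrightarrow> f = 0"
  shows "V \<subseteq> zmod.span (b ` I)"
proof
  fix f assume f: "f \<in> V"
  have spanV: "zmod.span (b ` I) \<subseteq> V" using assms by (simp add: zmod.span_minimal)
  have "\<exists>g\<in>zmod.span (b ` I). \<forall>i\<in>I. r i < k \<longrightarrow> f (p i) = g (p i)" for k
  proof (induction k)
    case 0
    then show ?case using zmod.span_zero by auto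
  next
    case (Suc k)
    then obtain g where g: "g \<in> zmod.span (b ` I)" "\<forall>i\<in>I. r i < k \<longrightarrow> f (p i) = g (p i)" by blast
    define J where "J = {i\<in>I. r i = k}"
    define h where "h = (\<Sum>i\<in>J. zscale (f (p i) - g (p i)) (b i))"
    have "h \<in> zmod.span (b ` I)" unfolding h_def J_def
      by (intro zmod.span_sum zmod.span_scale zmod.span_base) auto
    moreover have "f (p i) = (g + h) (p i)" if i: "i \<in> I" "r i < Suc k" for i
    proof (cases "r i = k")
      case True
      have "h (p i) = (\<Sum>j\<in>J. (f (p j) - g (p j)) * b j (p i))"
        by (simp add: h_def sum_zscale_apply)
      also have "\<dots> = (\<Sum>j\<in>J. if j = i then f (p j) - g (p j) else 0)"
        using upper diag True i by (intro sum.cong) (auto simp: J_def)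
      also have "\<dots> = f (p i) - g (p i)"
        using True i finite_I by (simp add: J_def)
      finally show ?thesis by simp
    next
      case False
      have "h (p i) = (\<Sum>j\<in>J. (f (p j) - g (p j)) * b j (p i))"
        by (simp add: h_def sum_zscale_apply)
      also have "\<dots> = 0"
      proof (rule sum.neutral, rule ballI)
        fix j assume "j \<in> J"
        then have "b j (p i) = 0" using i False by (intro upper) (auto simp: J_def)
        then show "(f (p j) - g (p j)) * b j (p i) = 0" by simp
      qed
      finally show ?thesis using g i False by simp
    qed
    ultimately show ?case using g zmod.span_add by (intro bexI[of _ "g + h"]) auto
  qed
  then obtain g where g: "g \<in> zmod.span (b ` I)"
      "\<forall>i\<in>I. r i < Suc (Max (r ` I)) \<longrightarrow> f (p i) = g (p i)" by blast
  have "f (p i) = g (p i)" if "i \<in> I" for i using g that finite_I by (simp add: less_Suc_eq_le)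
  moreover have "f - g \<in> V" using f g spanV assms(1) by (auto intro: zmod.subspace_diff)
  ultimately have "f - g = 0" by (intro det) auto
  then show "f \<in> zmod.span (b ` I)" using g by simp
qed

end

definition asc_rep :: "nat \<Rightarrow> nat set \<Rightarrow> nat multiset" where
  "asc_rep n S = (SOME M. size M = n \<and> asc M = S)"

lemma asc_rep:
  assumes "S \<subseteq> {1..<n}"
  shows "size (asc_rep n S) = n" "asc (asc_rep n S) = S"
  using someI_ex[OF ex_asc[OF assms]] by (auto simp: asc_rep_def)

text \<open>At a monomial with ascent set \<open>J\<close>, only the \<open>F n K\<close> with
  \<open>K\<close> inside \<open>J\<close> survive, so cardinality serves as the rank.\<close>

interpretation Ftri: triangular "Pow {1..<n}" "F n" "asc_rep n" card for n
proof
  fix J K assume *: "J \<in> Pow {1..<n}" "K \<in> Pow {1..<n}" "J \<noteq> K" "card J \<le> card K"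
  then have "\<not> K \<subseteq> J" by (metis PowD card_seteq finite_atLeastLessThan finite_subset)
  then show "F n K (asc_rep n J) = 0" using * by (simp add: F_eq asc_rep)
qed (auto simp: F_eq asc_rep)

lemma QSym_eq_span: "QSym n = zmod.span (F n ` Pow {1..<n})"
proof
  show "zmod.span (F n ` Pow {1..<n}) \<subseteq> QSym n"
    by (rule zmod.span_minimal) (auto simp: F_in_QSym subspace_QSym)
  show "QSym n \<subseteq> zmod.span (F n ` Pow {1..<n})"
  proof (rule Ftri.subset_span)
    fix f assume f: "f \<in> QSym n" "\<And>S. S \<in> Pow {1..<n} \<Longrightarrow> f (asc_rep n S) = 0"
    show "f = 0"
    proof
      fix M
      show "f M = 0 M"
      proof (cases "size M = n")
        case True
        then have "asc M \<subseteq> {1..<n}" using asc_subset by blast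
        then show ?thesis using QSym_cong[OF f(1), of M "asc_rep n (asc M)"] f(2) True asc_rep by auto
      qed (use QSym_homogeneous f in auto)
    qed
  qed (auto simp: subspace_QSym F_in_QSym)
qed

section \<open>Cyclic shifts\<close>

lemma csucc_pow: "i \<in> {1..n} \<Longrightarrow> (csucc n ^^ s) i = (i - 1 + s) mod n + 1"
proof (induction s)
  case (Suc s)
  then have "(csucc n ^^ Suc s) i = csucc n ((i - 1 + s) mod n + 1)" by simp
  also have "\<dots> = (i - 1 + Suc s) mod n + 1"
    unfolding add_Suc_right mod_Suc by (auto simp: csucc_def)
  finally show ?case .
qed auto

lemma csucc_pow_mem: "i \<in> {1..n} \<Longrightarrow> (csucc n ^^ s) i \<in> {1..n}"
  unfolding csucc_pow by (auto simp: Suc_le_eq)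

lemma csucc_pow_mod: "i \<in> {1..n} \<Longrightarrow> s mod n = t mod n \<Longrightarrow> (csucc n ^^ s) i = (csucc n ^^ t) i"
  unfolding csucc_pow by (metis mod_add_right_eq)

lemma csucc_pow_n: "i \<in> {1..n} \<Longrightarrow> n dvd s \<Longrightarrow> (csucc n ^^ s) i = i"
  using csucc_pow_mod[of i n s 0] by (simp add: dvd_eq_mod_eq_0)

lemma cshift_0 [simp]: "cshift n 0 J = J"
  by (simp add: cshift_def)

lemma cshift_cshift: "cshift n s (cshift n t J) = cshift n (s + t) J"
  by (simp add: cshift_def funpow_add image_comp)

lemma cshift_subset: "J \<subseteq> {1..n} \<Longrightarrow> cshift n s J \<subseteq> {1..n}"
  unfolding cshift_def using csucc_pow_mem by blast

lemma cshift_cong: "J \<subseteq> {1..n} \<Longrightarrow> s mod n = t mod n \<Longrightarrow> cshift n s J = cshift n t J"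
  unfolding cshift_def by (intro image_cong refl csucc_pow_mod) auto

lemma cshift_dvd: "J \<subseteq> {1..n} \<Longrightarrow> n dvd s \<Longrightarrow> cshift n s J = J"
  using cshift_cong[of J n s 0] by (simp add: dvd_eq_mod_eq_0)

lemma dvd_add_complement: "0 < n \<Longrightarrow> n dvd (n - s mod n) + s" for n s :: nat
  by (metis (no_types, lifting) add.commute dvd_eq_mod_eq_0 le_add_diff_inverse mod_add_left_eq
      mod_less_divisor mod_self order_less_imp_le)

lemma cshift_inverse: "0 < n \<Longrightarrow> J \<subseteq> {1..n} \<Longrightarrow> cshift n (n - s mod n) (cshift n s J) = J"
  unfolding cshift_cshift by (intro cshift_dvd dvd_add_complement)

lemma inj_on_csucc_pow: "inj_on (csucc n ^^ s) {1..n}"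
proof (cases "n = 0")
  case False
  show ?thesis
  proof (rule inj_on_inverseI[where g = "csucc n ^^ (n - s mod n)"])
    fix i assume "i \<in> {1..n}"
    then have "(csucc n ^^ (n - s mod n + s)) i = i"
      using False by (intro csucc_pow_n dvd_add_complement) auto
    then show "(csucc n ^^ (n - s mod n)) ((csucc n ^^ s) i) = i" by (simp add: funpow_add)
  qed
qed simp

lemma cshift_subset_iff:
  "J \<subseteq> {1..n} \<Longrightarrow> K \<subseteq> {1..n} \<Longrightarrow> cshift n s J \<subseteq> cshift n s K \<longleftrightarrow> J \<subseteq> K"
  unfolding cshift_def using inj_onD[OF inj_on_csucc_pow, of s n] by blast

lemma card_cshift: "J \<subseteq> {1..n} \<Longrightarrow> card (cshift n s J) = card J"
  unfolding cshift_def by (intro card_image inj_on_subset[OF inj_on_csucc_pow])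

lemma cshift_eq_empty [simp]: "cshift n s J = {} \<longleftrightarrow> J = {}"
  by (simp add: cshift_def)

lemma cshift_UNIV: "cshift n s {1..n} = {1..n}"
  by (intro card_seteq cshift_subset order_refl) (simp_all only: card_cshift[OF order_refl] finite_atLeastAtMost)

text \<open>Rotating \<open>m1 @ m2\<close> to \<open>m2 @ m1\<close> moves the cut after
  \<open>m1\<close> to the end, which subtracts \<open>sum_list m1\<close> modulo n. The sums from
  \<open>m2\<close> wrap around, and the residue 0 is written as n, in agreement with
  \<open>psums\<close> containing the total.\<close>

lemma cshift_psums:
  assumes "0 \<notin> set m1" "0 \<notin> set m2" "n = sum_list m1 + sum_list m2"
  shows "psums (m2 @ m1) = cshift n (n - sum_list m1) (psums (m1 @ m2))"
proof -
  let ?c = "csucc n ^^ (n - sum_list m1)"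
  have "?c x = sum_list m2 + x" if "x \<in> psums m1" for x
    using psums_pos[OF assms(1) that] psums_le[OF that] assms(3)
    by (subst csucc_pow) auto
  then have 1: "?c ` psums m1 = (+) (sum_list m2) ` psums m1" by (rule image_cong[OF refl])
  have "?c (sum_list m1 + x) = x" if "x \<in> psums m2" for x
  proof -
    have x: "1 \<le> x" "x \<le> sum_list m2" using psums_pos[OF assms(2) that] psums_le[OF that] by auto
    then have "?c (sum_list m1 + x) = (n + (x - 1)) mod n + 1"
      using assms(3) by (subst csucc_pow) (auto simp: add.assoc add.commute add.left_commute)
    also have "\<dots> = x - 1 + 1" using x assms(3) by (subst mod_add_self1) simp
    also have "\<dots> = x" using x by simp
    finally show ?thesis .
  qed
  then have 2: "?c ` (+) (sum_list m1) ` psums m2 = psums m2" by (force simp: image_image)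
  show ?thesis unfolding cshift_def psums_append image_Un 1 2 by auto
qed

section \<open>Cyclic quasi-symmetric functions\<close>

lemma cQSym_D:
  assumes "f \<in> cQSym n" "sorted_wrt (<) u" "sorted_wrt (<) v" "length u = length m"
    "length v = length m" "0 \<notin> set m"
  shows "f (var_monom u m) = f (var_monom v (rotate s m))"
  using assms unfolding cQSym_def by blast

lemma cQSym_homogeneous:
  assumes "f \<in> cQSym n" "size M \<noteq> n"
  shows "f M = 0"
proof -
  have "homogeneous n f" using assms(1) unfolding cQSym_def by blast
  then show ?thesis using assms(2) unfolding homogeneous_def by metis
qed

lemma cQSym_subset_QSym: "cQSym n \<subseteq> QSym n"
proof
  fix f assume f: "f \<in> cQSym n"
  then have "homogeneous n f" unfolding cQSym_def by blast
  moreover have "f (var_monom u m) = f (var_monom v m)"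
    if "sorted_wrt (<) u" "sorted_wrt (<) v" "length u = length m" "length v = length m" "0 \<notin> set m"
    for u v m
    using cQSym_D[OF f that, of 0] by simp
  ultimately show "f \<in> QSym n" unfolding QSym_def by blast
qed

lemma subspace_cQSym: "zmod.subspace (cQSym n)"
proof (rule zmod.subspaceI)
  show "0 \<in> cQSym n" by (simp add: cQSym_def homogeneous_def)
next
  fix f g assume fg: "f \<in> cQSym n" "g \<in> cQSym n"
  have "homogeneous n (f + g)"
    using cQSym_homogeneous[OF fg(1)] cQSym_homogeneous[OF fg(2)]
    unfolding homogeneous_def plus_fun_def by (metis add_0)
  moreover have "(f + g) (var_monom u m) = (f + g) (var_monom v (rotate s m))"
    if "sorted_wrt (<) u" "sorted_wrt (<) v" "length u = length m" "length v = length m" "0 \<notin> set m"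
    for u v m s
    using cQSym_D[OF fg(1) that, of s] cQSym_D[OF fg(2) that, of s] by simp
  ultimately show "f + g \<in> cQSym n" unfolding cQSym_def by blast
next
  fix c f assume f: "f \<in> cQSym n"
  have "homogeneous n (zscale c f)"
    using cQSym_homogeneous[OF f] unfolding homogeneous_def zscale_def by (metis mult_zero_right)
  moreover have "zscale c f (var_monom u m) = zscale c f (var_monom v (rotate s m))"
    if "sorted_wrt (<) u" "sorted_wrt (<) v" "length u = length m" "length v = length m" "0 \<notin> set m"
    for u v m s
    using cQSym_D[OF f that, of s] by (simp add: zscale_def)
  ultimately show "zscale c f \<in> cQSym n" unfolding cQSym_def by blast
qed

text \<open>The cyclic counterpart of \<open>QSym_cong\<close>: rotating exponents shifts the set of
  partial sums, so the invariant of a monomial is \<open>insert n (asc M)\<close> up to cyclic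
  shift. \<open>cQSym_I\<close> is the converse.\<close>

lemma cQSym_cong:
  assumes f: "f \<in> cQSym n" and M: "size M = n" "size M' = n" and "0 < n"
    and shift: "insert n (asc M') = cshift n s (insert n (asc M))"
  shows "f M = f M'"
proof -
  obtain u m where um: "sorted_wrt (<) u" "length u = length m" "0 \<notin> set m" "M = var_monom u m"
      "sum_list m = n" "insert n (asc M) = psums m"
    using ex_var_monom_psums[OF M(1) \<open>0 < n\<close>] by metis
  obtain u' m' where um': "sorted_wrt (<) u'" "length u' = length m'" "0 \<notin> set m'"
      "M' = var_monom u' m'" "sum_list m' = n" "insert n (asc M') = psums m'"
    using ex_var_monom_psums[OF M(2) \<open>0 < n\<close>] by metis
  have sub: "psums m \<subseteq> {1..n}" using psums_pos[OF um(3)] psums_le[of _ m] um(5) by (auto simp: Suc_le_eq)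
  \<comment> \<open>Some partial sum \<open>p\<close> is shifted to n. The exponent sequence has to
    be cut at \<open>p\<close>, and \<open>s\<close> is congruent to \<open>n - p\<close>.\<close>
  have "n \<in> cshift n s (psums m)" using shift um(6) insertI1 by metis
  then obtain p where p: "p \<in> psums m" "n = (csucc n ^^ s) p" by (auto simp: cshift_def)
  obtain m1 m2 where m12: "m = m1 @ m2" "sum_list m1 = p" using psums_split[OF p(1)] by blast
  have pn: "p \<in> {1..n}" using p sub by blast
  then have "(p - 1 + s) mod n = n - 1" using p(2) csucc_pow[OF pn, of s] \<open>0 < n\<close> by simp
  then have "(p - 1 + s + 1) mod n = 0" using \<open>0 < n\<close> mod_Suc[of "p - 1 + s" n] by simp
  then have "(p + s) mod n = 0" using pn by simp
  then have "(n - p + (p + s)) mod n = (n - p) mod n" by (metis add_0_right mod_add_right_eq)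
  then have "(n - p) mod n = s mod n" using pn by simp
  then have "psums m' = cshift n (n - p) (psums m)"
    using shift um(6) um'(6) cshift_cong[OF sub] by metis
  also have "\<dots> = psums (m2 @ m1)"
  proof -
    have "0 \<notin> set m1" "0 \<notin> set m2" "n = sum_list m1 + sum_list m2"
      using um(3,5) m12(1) by auto
    from cshift_psums[OF this] show ?thesis using m12 by simp
  qed
  finally have "psums m' = psums (m2 @ m1)" .
  moreover have "0 \<notin> set (m2 @ m1)" using um(3) m12(1) by auto
  ultimately have "m' = m2 @ m1" using um'(3) psums_inject by blast
  then have m': "m' = rotate (length m1) m" using m12 by (simp add: rotate_append)
  have "length u' = length m" using um'(2) m' by simp
  from cQSym_D[OF f um(1) um'(1) um(2) this um(3), of "length m1"] show ?thesis
    unfolding um(4) um'(4) m' .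
qed

lemma cQSym_I:
  assumes "0 < n" and hom: "\<And>M. size M \<noteq> n \<Longrightarrow> f M = 0"
    and inv: "\<And>M M' s. size M = n \<Longrightarrow> size M' = n \<Longrightarrow>
      insert n (asc M') = cshift n s (insert n (asc M)) \<Longrightarrow> f M = f M'"
  shows "f \<in> cQSym n"
proof -
  have "f (var_monom u m) = f (var_monom v (rotate s m))"
    if *: "sorted_wrt (<) u" "sorted_wrt (<) v" "length u = length m" "length v = length m" "0 \<notin> set m"
    for u v m s
  proof (cases "sum_list m = n")
    case True
    then have "m \<noteq> []" using assms(1) by auto
    define m1 m2 where "m1 = take (s mod length m) m" and "m2 = drop (s mod length m) m"
    have m: "m = m1 @ m2" "rotate s m = m2 @ m1" by (simp_all add: m1_def m2_def rotate_drop_take)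
    have sum: "sum_list (rotate s m) = n" "n = sum_list m1 + sum_list m2"
      using True m by (simp_all add: add.commute)
    have "insert n (asc (var_monom v (rotate s m))) = psums (rotate s m)"
      using asc_var_monom[of v "rotate s m"] * \<open>m \<noteq> []\<close> sum by simp
    moreover have "insert n (asc (var_monom u m)) = psums m"
      using asc_var_monom[of u m] * \<open>m \<noteq> []\<close> True by simp
    moreover have "0 \<notin> set m1" "0 \<notin> set m2" using *(5) m(1) by auto
    ultimately have "insert n (asc (var_monom v (rotate s m)))
        = cshift n (n - sum_list m1) (insert n (asc (var_monom u m)))"
      using cshift_psums[of m1 m2 n] sum(2) m by simp
    then show ?thesis using * True sum by (intro inv) (simp_all add: size_var_monom)
  next
    case False
    have "sum_list (rotate s m) = sum_list m"
      by (metis add.commute append_take_drop_id rotate_drop_take sum_list_append)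
    then show ?thesis using hom[of "var_monom u m"] hom[of "var_monom v (rotate s m)"] False *
      by (simp add: size_var_monom)
  qed
  moreover have "homogeneous n f" unfolding homogeneous_def using hom by metis
  ultimately show ?thesis unfolding cQSym_def by blast
qed

lemma mset_rotate [simp]: "mset (rotate s w) = mset w"
  by (metis add.commute append_take_drop_id mset_append rotate_drop_take)

text \<open>Since the rotation by \<open>k - 1\<close> sorts \<open>w\<close>, the word is
  determined by \<open>M\<close> and \<open>k\<close>. Rewriting the strictness conditions for the
  sorted word shifts \<open>J\<close> by \<open>s = n + 1 - k\<close>, and the exempt index
  \<open>k - 1\<close> lands on n. Hence n is adjoined to the ascent set: a condition there is
  always satisfied.\<close>

lemma Fcyc_eq:
  assumes "0 < n" "J \<subseteq> {1..n}"
  shows "Fcyc n J M = (if size M = n then int (card {s. s < n \<and> cshift n s J \<subseteq> insert n (asc M)}) else 0)"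
proof (cases "size M = n")
  case True
  define v where "v = sorted_list_of_multiset M"
  have v: "length v = n" "mset v = M" "sorted v" by (simp_all add: v_def True)
  let ?X = "{(w, k). length w = n \<and> k \<in> {1..n} \<and> sorted (rotate (k - 1) w) \<and>
      (\<forall>j\<in>J. csucc n j \<noteq> k \<longrightarrow> w ! (j - 1) < w ! (csucc n j - 1)) \<and> mset w = M}"
  \<comment> \<open>The range is \<open>{1..n}\<close> rather than \<open>{0..<n}\<close> so that
    \<open>k = n + 1 - s\<close> stays in \<open>{1..n}\<close>; at the end the shift by n is
    exchanged for the shift by 0.\<close>
  let ?Y = "{s \<in> {1..n}. cshift n s J \<subseteq> insert n (asc M)}"
  have ascM: "asc M = {j \<in> {1..<n}. v ! (j - 1) < v ! j}"
    using v by (simp add: asc_def ascents_def v_def)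
  have cond: "(\<forall>j\<in>J. csucc n j \<noteq> n + 1 - s \<longrightarrow> rotate s v ! (j - 1) < rotate s v ! (csucc n j - 1))
      \<longleftrightarrow> cshift n s J \<subseteq> insert n (asc M)" if s: "s \<in> {1..n}" for s
  proof -
    have rot: "rotate s v ! (i - 1) = v ! ((csucc n ^^ s) i - 1)" if "i \<in> {1..n}" for i
      using that v(1) by (auto simp: nth_rotate csucc_pow add.commute)
    have "(csucc n j \<noteq> n + 1 - s \<longrightarrow> rotate s v ! (j - 1) < rotate s v ! (csucc n j - 1))
        \<longleftrightarrow> (csucc n ^^ s) j \<in> insert n (asc M)" if "j \<in> J" for j
    proof -
      have j: "j \<in> {1..n}" using that assms by auto
      define c where "c = (csucc n ^^ s) j"
      have c: "c \<in> {1..n}" using j csucc_pow_mem unfolding c_def by blast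
      have sj: "csucc n j \<in> {1..n}" using csucc_pow_mem[OF j, of 1] by simp
      have sc: "(csucc n ^^ s) (csucc n j) = csucc n c"
        unfolding c_def by (metis funpow_swap1)
      \<comment> \<open>The index \<open>k = n + 1 - s\<close> is the one carried to 1, so the
        exemption \<open>csucc n j = k\<close> says precisely that \<open>j\<close> is carried to
        the last position.\<close>
      have "(csucc n ^^ s) (n + 1 - s) = 1" using s by (subst csucc_pow) auto
      moreover have "n + 1 - s \<in> {1..n}" using s by auto
      ultimately have "csucc n j = n + 1 - s \<longleftrightarrow> csucc n c = 1"
        using inj_onD[OF inj_on_csucc_pow, of s n "csucc n j" "n + 1 - s"] sj sc by metis
      also have "\<dots> \<longleftrightarrow> c = n" using c by (auto simp: csucc_def)
      finally have "(csucc n j \<noteq> n + 1 - s \<longrightarrow> rotate s v ! (j - 1) < rotate s v ! (csucc n j - 1))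
        \<longleftrightarrow> (c \<noteq> n \<longrightarrow> v ! (c - 1) < v ! (csucc n c - 1))"
        using rot[OF j] rot[OF sj] sc c_def by simp
      also have "\<dots> \<longleftrightarrow> c \<in> insert n (asc M)" using c by (auto simp: ascM csucc_def)
      finally show ?thesis unfolding c_def .
    qed
    then show ?thesis by (auto simp: cshift_def)
  qed
  let ?g = "\<lambda>s. (rotate s v, n + 1 - s)"
  have "inj_on ?g ?Y" by (auto intro!: inj_onI)
  moreover have "?g ` ?Y = ?X"
  proof (intro equalityI subsetI)
    fix a assume "a \<in> ?g ` ?Y"
    then obtain s where s: "s \<in> {1..n}" "cshift n s J \<subseteq> insert n (asc M)" "a = ?g s" by blast
    have "rotate (n + 1 - s - 1) (rotate s v) = v" using s v by (simp add: rotate_rotate)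
    moreover have "n + 1 - s \<in> {1..n}" using s by auto
    ultimately show "a \<in> ?X" using cond[OF s(1)] s v by simp
  next
    fix a assume a: "a \<in> ?X"
    obtain w k where a_eq: "a = (w, k)" by (cases a)
    have wk: "length w = n" "k \<in> {1..n}" "sorted (rotate (k - 1) w)" "mset w = M"
      "\<forall>j\<in>J. csucc n j \<noteq> k \<longrightarrow> w ! (j - 1) < w ! (csucc n j - 1)" using a a_eq by auto
    have "rotate (k - 1) w = v"
      unfolding v_def using wk by (intro sorted_list_of_multiset_unique[symmetric]) auto
    then have "rotate (n + 1 - k) v = rotate (n + 1 - k + (k - 1)) w" by (metis rotate_rotate)
    also have "\<dots> = w" using wk by simp
    finally have w: "w = rotate (n + 1 - k) v" by simp
    have k: "n + 1 - k \<in> {1..n}" "n + 1 - (n + 1 - k) = k" using wk by auto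
    have "cshift n (n + 1 - k) J \<subseteq> insert n (asc M)"
      using wk(5) unfolding w cond[OF k(1), unfolded k(2)] .
    then show "a \<in> ?g ` ?Y" using w k a_eq by (intro image_eqI[of _ _ "n + 1 - k"]) simp_all
  qed
  ultimately have "bij_betw ?g ?Y ?X" by (simp add: bij_betw_def)
  then have "card ?X = card ?Y" by (simp add: bij_betw_same_card)
  also have "\<dots> = card {s. s < n \<and> cshift n s J \<subseteq> insert n (asc M)}"
  proof -
    define P where "P s \<longleftrightarrow> cshift n s J \<subseteq> insert n (asc M)" for s
    have "P n \<longleftrightarrow> P 0" unfolding P_def cshift_dvd[OF assms(2) dvd_refl] by simp
    moreover have "{s \<in> {1..n}. P s} = (if P n then insert n {s \<in> {1..<n}. P s} else {s \<in> {1..<n}. P s})"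
      using assms(1) by (auto simp: le_less Suc_le_eq)
    moreover have "{s. s < n \<and> P s} = (if P 0 then insert 0 {s \<in> {1..<n}. P s} else {s \<in> {1..<n}. P s})"
      using assms(1) by (auto simp: Suc_le_eq intro: gr0I)
    ultimately have "card {s \<in> {1..n}. P s} = card {s. s < n \<and> P s}" by auto
    then show ?thesis unfolding P_def .
  qed
  finally show ?thesis using True by (simp add: Fcyc_def)
next
  case False
  then have "{(w, k). length w = n \<and> k \<in> {1..n} \<and> sorted (rotate (k - 1) w) \<and>
      (\<forall>j\<in>J. csucc n j \<noteq> k \<longrightarrow> w ! (j - 1) < w ! (csucc n j - 1)) \<and> mset w = M} = {}" by auto
  then show ?thesis using False by (simp only: Fcyc_def card.empty if_False of_nat_0)
qed

section \<open>Orbits of subsets under cyclic shifts\<close>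

definition cyc_orbit :: "nat \<Rightarrow> nat set \<Rightarrow> nat set set" where
  "cyc_orbit n J = {cshift n s J | s. s < n}"

lemma cyc_orbit_eq:
  assumes "0 < n" "J \<subseteq> {1..n}"
  shows "cyc_orbit n J = range (\<lambda>s. cshift n s J)"
proof -
  have "\<exists>t<n. cshift n s J = cshift n t J" for s
    using cshift_cong[OF assms(2), of s "s mod n"] assms(1) by (intro exI[of _ "s mod n"]) simp
  then show ?thesis unfolding cyc_orbit_def by blast
qed

lemma self_in_cyc_orbit: "0 < n \<Longrightarrow> J \<in> cyc_orbit n J"
  unfolding cyc_orbit_def using cshift_0 by blast

lemma cyc_orbit_cshift:
  assumes "0 < n" "J \<subseteq> {1..n}"
  shows "cyc_orbit n (cshift n t J) = cyc_orbit n J"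
proof -
  have *: "cshift n s J = cshift n (s + (n - t mod n)) (cshift n t J)" for s
    using cshift_inverse[OF assms] by (metis cshift_cshift)
  have "range (\<lambda>s. cshift n s (cshift n t J)) = range (\<lambda>s. cshift n s J)"
  proof
    show "range (\<lambda>s. cshift n s (cshift n t J)) \<subseteq> range (\<lambda>s. cshift n s J)"
      by (auto simp: cshift_cshift)
    show "range (\<lambda>s. cshift n s J) \<subseteq> range (\<lambda>s. cshift n s (cshift n t J))"
      using * by blast
  qed
  then show ?thesis using assms cshift_subset cyc_orbit_eq by metis
qed

lemma cyc_orbit_subset: "J \<subseteq> {1..n} \<Longrightarrow> K \<in> cyc_orbit n J \<Longrightarrow> K \<subseteq> {1..n}"
  unfolding cyc_orbit_def using cshift_subset[of J n] by blast

lemma finite_cyc_orbit [simp]: "finite (cyc_orbit n J)"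
  by (simp add: cyc_orbit_def)

text \<open>Orbit and stabilizer: the shifts that carry \<open>J\<close> to a fixed member of its
  orbit form a coset of the stabilizer, the translate by \<open>t\<close>.\<close>

lemma card_cshift_fiber:
  assumes "0 < n" "J \<subseteq> {1..n}" "t < n"
  shows "card {s. s < n \<and> cshift n s J = cshift n t J} = stab_order n J"
proof -
  let ?u = "n - t"
  have u: "n dvd ?u + t" "n dvd t + ?u" using assms by auto
  have "bij_betw (\<lambda>s. (s + t) mod n) {s. s < n \<and> cshift n s J = J}
      {s. s < n \<and> cshift n s J = cshift n t J}"
  proof (rule bij_betw_byWitness[where f' = "\<lambda>s. (s + ?u) mod n"])
    have *: "((s + a) mod n + b) mod n = s" if "s < n" "a + b = n" for s a b
      using that by (simp add: mod_add_left_eq add.assoc)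
    show "\<forall>s\<in>{s. s < n \<and> cshift n s J = J}. ((s + t) mod n + ?u) mod n = s"
      using *[of _ t ?u] assms(3) by simp
    show "\<forall>s\<in>{s. s < n \<and> cshift n s J = cshift n t J}. ((s + ?u) mod n + t) mod n = s"
      using *[of _ ?u t] assms(3) by simp
    have md: "cshift n ((s + a) mod n) J = cshift n a (cshift n s J)" for s a
      using cshift_cong[OF assms(2), of "(s + a) mod n" "s + a"] by (simp add: cshift_cshift add.commute)
    have "cshift n ((s + t) mod n) J = cshift n t J" if "cshift n s J = J" for s
      using md that by simp
    then show "(\<lambda>s. (s + t) mod n) ` {s. s < n \<and> cshift n s J = J}
        \<subseteq> {s. s < n \<and> cshift n s J = cshift n t J}" using assms by auto
    have "cshift n ((s + ?u) mod n) J = J" if "cshift n s J = cshift n t J" for s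
      unfolding md that cshift_cshift by (rule cshift_dvd[OF assms(2) u(1)])
    then show "(\<lambda>s. (s + ?u) mod n) ` {s. s < n \<and> cshift n s J = cshift n t J}
        \<subseteq> {s. s < n \<and> cshift n s J = J}" using assms by auto
  qed
  then show ?thesis by (simp add: bij_betw_same_card stab_order_def)
qed

lemma stab_order_pos: "0 < n \<Longrightarrow> 0 < stab_order n J"
  unfolding stab_order_def by (subst card_gt_0_iff) (auto intro: exI[of _ 0])

lemma card_cshift_subset:
  assumes "0 < n" "J \<subseteq> {1..n}"
  shows "card {s. s < n \<and> cshift n s J \<subseteq> E} = stab_order n J * card {K \<in> cyc_orbit n J. K \<subseteq> E}"
proof -
  let ?O = "{K \<in> cyc_orbit n J. K \<subseteq> E}"
  have "{s. s < n \<and> cshift n s J \<subseteq> E} = (\<Union>K\<in>?O. {s. s < n \<and> cshift n s J = K})"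
    by (auto simp: cyc_orbit_def)
  also have "card \<dots> = (\<Sum>K\<in>?O. card {s. s < n \<and> cshift n s J = K})"
    by (rule card_UN_disjoint) auto
  also have "\<dots> = (\<Sum>K\<in>?O. stab_order n J)"
    using card_cshift_fiber[OF assms] by (intro sum.cong) (auto simp: cyc_orbit_def)
  finally show ?thesis by simp
qed

text \<open>Each member of the orbit arises from as many shifts as the stabilizer has elements. The
  division in the definition is therefore exact and turns a count of shifts into a count of
  sets.\<close>

lemma Fhat_eq:
  assumes "0 < n" "J \<subseteq> {1..n}"
  shows "Fhat n J M = (if size M = n then int (card {K \<in> cyc_orbit n J. K \<subseteq> insert n (asc M)}) else 0)"
  unfolding Fhat_def Fcyc_eq[OF assms] card_cshift_subset[OF assms]
  using stab_order_pos[OF assms(1), of J] by simp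

lemma Fcyc_eq_Fhat:
  assumes "0 < n" "J \<subseteq> {1..n}"
  shows "Fcyc n J M = int (stab_order n J) * Fhat n J M"
  unfolding Fhat_eq[OF assms] Fcyc_eq[OF assms] card_cshift_subset[OF assms] by simp

lemma Fhat_cshift:
  assumes "0 < n" "J \<subseteq> {1..n}"
  shows "Fhat n (cshift n t J) = Fhat n J"
  unfolding Fhat_eq[OF assms, abs_def] Fhat_eq[OF assms(1) cshift_subset[OF assms(2)], abs_def]
    cyc_orbit_cshift[OF assms] ..

lemma stab_order_cshift:
  assumes "0 < n" "J \<subseteq> {1..n}"
  shows "stab_order n (cshift n t J) = stab_order n J"
proof -
  have "cshift n s (cshift n t J) = cshift n t J \<longleftrightarrow> cshift n s J = J" for s
  proof -
    have "cshift n s (cshift n t J) = cshift n t (cshift n s J)"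
      by (simp add: cshift_cshift add.commute)
    then show ?thesis using cshift_inverse[OF assms(1)] assms(2) cshift_subset by metis
  qed
  then show ?thesis by (simp add: stab_order_def)
qed

text \<open>The shift that relates the two ascent sets permutes the orbit and preserves inclusions,
  so it matches the sets counted at \<open>M\<close> with those counted at
  \<open>M'\<close>.\<close>

lemma Fhat_in_cQSym:
  assumes "0 < n" "J \<subseteq> {1..n}"
  shows "Fhat n J \<in> cQSym n"
proof (rule cQSym_I[OF assms(1)])
  fix M M' s
  assume M: "size M = n" "size M' = n" "insert n (asc M') = cshift n s (insert n (asc M))"
  have E: "insert n (asc M) \<subseteq> {1..n}" using asc_subset[of M] M assms(1) by auto
  have "bij_betw (cshift n s) {K \<in> cyc_orbit n J. K \<subseteq> insert n (asc M)}
      {K \<in> cyc_orbit n J. K \<subseteq> insert n (asc M')}"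
    (is "bij_betw _ ?A ?B")
  proof (rule bij_betw_byWitness[where f' = "cshift n (n - s mod n)"])
    have closed: "cshift n t K \<in> cyc_orbit n J" if "K \<in> cyc_orbit n J" for t K
      using that unfolding cyc_orbit_eq[OF assms] by (auto simp: cshift_cshift)
    have sub: "K \<subseteq> {1..n}" if "K \<in> cyc_orbit n J" for K
      using that cyc_orbit_subset assms by blast
    have inv: "cshift n s (cshift n (n - s mod n) K) = K" if "K \<in> cyc_orbit n J" for K
      using cshift_inverse[OF assms(1) sub[OF that], of s] by (simp add: cshift_cshift add.commute)
    show "\<forall>a\<in>?A. cshift n (n - s mod n) (cshift n s a) = a"
      using cshift_inverse[OF assms(1)] sub by blast
    show "\<forall>a\<in>?B. cshift n s (cshift n (n - s mod n) a) = a" using inv by blast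
    show "cshift n s ` ?A \<subseteq> ?B" using closed cshift_subset_iff[OF sub E] unfolding M(3) by blast
    show "cshift n (n - s mod n) ` ?B \<subseteq> ?A"
    proof clarify
      fix K assume K: "K \<in> cyc_orbit n J" "K \<subseteq> insert n (asc M')"
      then have "cshift n s (cshift n (n - s mod n) K) \<subseteq> cshift n s (insert n (asc M))"
        using inv M(3) by simp
      then have "cshift n (n - s mod n) K \<subseteq> insert n (asc M)"
        using cshift_subset_iff[OF sub[OF closed[OF K(1)]] E] by blast
      then show "cshift n (n - s mod n) K \<in> cyc_orbit n J \<and> cshift n (n - s mod n) K \<subseteq> insert n (asc M)"
        using closed K by blast
    qed
  qed
  then show "Fhat n J M = Fhat n J M'"
    unfolding Fhat_eq[OF assms] using M(1,2) by (simp add: bij_betw_same_card)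
qed (simp add: Fhat_eq[OF assms])

text \<open>Unlike in \<open>corbits\<close>, the orbit of the full set is kept, since these orbits
  index a basis of the whole cyclic space. The empty set is excluded because each orbit must have a
  member containing n.\<close>

definition cyc_orbits :: "nat \<Rightarrow> nat set set set" where
  "cyc_orbits n = cyc_orbit n ` (Pow {1..n} - {{}})"

lemma corbits_eq: "corbits n = cyc_orbit n ` (Pow {1..n} - {{}, {1..n}})"
  unfolding corbits_def cyc_orbit_def by auto

lemma corbits_subset: "corbits n \<subseteq> cyc_orbits n"
  unfolding corbits_eq cyc_orbits_def by blast

lemma finite_cyc_orbits [simp]: "finite (cyc_orbits n)"
  by (simp add: cyc_orbits_def)

lemma finite_corbits [simp]: "finite (corbits n)"
  by (simp add: corbits_eq)

lemma cyc_orbitsE: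
  assumes "0 < n" "A \<in> cyc_orbits n" "K \<in> A"
  shows "K \<subseteq> {1..n}" "K \<noteq> {}" "A = cyc_orbit n K"
proof -
  obtain J where J: "J \<subseteq> {1..n}" "J \<noteq> {}" "A = cyc_orbit n J" using assms(2) by (auto simp: cyc_orbits_def)
  then obtain s where s: "K = cshift n s J" using assms(3) by (auto simp: cyc_orbit_def)
  show "K \<subseteq> {1..n}" using J s cshift_subset by simp
  show "K \<noteq> {}" using J s by simp
  show "A = cyc_orbit n K" using J s assms(1) cyc_orbit_cshift by simp
qed

lemma corbitsE:
  assumes "0 < n" "A \<in> corbits n" "K \<in> A"
  shows "K \<subseteq> {1..n}" "K \<noteq> {}" "K \<noteq> {1..n}" "A = cyc_orbit n K"
proof -
  show *: "K \<subseteq> {1..n}" "K \<noteq> {}" "A = cyc_orbit n K"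
    using cyc_orbitsE[OF assms(1) _ assms(3)] assms(2) corbits_subset by blast+
  obtain J where J: "J \<subseteq> {1..n}" "J \<noteq> {1..n}" "A = cyc_orbit n J" using assms(2) by (auto simp: corbits_eq)
  then obtain s where s: "K = cshift n s J" using assms(3) by (auto simp: cyc_orbit_def)
  show "K \<noteq> {1..n}"
  proof
    assume "K = {1..n}"
    then have "card J = card {1..n}" using s card_cshift[OF J(1), of s] by simp
    then show False using J card_subset_eq[of "{1..n}" J] by simp
  qed
qed

lemma cyc_orbits_nonempty: "0 < n \<Longrightarrow> A \<in> cyc_orbits n \<Longrightarrow> (SOME K. K \<in> A) \<in> A"
  unfolding cyc_orbits_def using self_in_cyc_orbit by (metis imageE someI_ex)

lemma orb_Fhat_eq_Fhat:
  assumes "0 < n" "A \<in> cyc_orbits n" "K \<in> A"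
  shows "orb_Fhat n A = Fhat n K"
proof -
  note S = cyc_orbitsE[OF assms(1,2) cyc_orbits_nonempty[OF assms(1,2)]]
  have "K \<in> cyc_orbit n (SOME K. K \<in> A)" using S(3) assms(3) by simp
  then obtain s where "K = cshift n s (SOME K. K \<in> A)" by (auto simp: cyc_orbit_def)
  then show ?thesis using Fhat_cshift[OF assms(1) S(1)] by (simp add: orb_Fhat_def)
qed

lemma orb_d_eq:
  assumes "0 < n" "A \<in> cyc_orbits n" "K \<in> A"
  shows "orb_d n A = stab_order n K"
proof -
  note S = cyc_orbitsE[OF assms(1,2) cyc_orbits_nonempty[OF assms(1,2)]]
  have "K \<in> cyc_orbit n (SOME K. K \<in> A)" using S(3) assms(3) by simp
  then obtain s where "K = cshift n s (SOME K. K \<in> A)" by (auto simp: cyc_orbit_def)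
  then show ?thesis using stab_order_cshift[OF assms(1) S(1)] by (simp add: orb_d_def)
qed

lemma orb_Fhat_eq:
  assumes "0 < n" "A \<in> cyc_orbits n"
  shows "orb_Fhat n A M = (if size M = n then int (card {K \<in> A. K \<subseteq> insert n (asc M)}) else 0)"
proof -
  note S = cyc_orbitsE[OF assms cyc_orbits_nonempty[OF assms]]
  show ?thesis unfolding orb_Fhat_def Fhat_eq[OF assms(1) S(1)] S(3)[symmetric] ..
qed

section \<open>Unitriangularity of the cyclic functions\<close>

lemma ex_orbit_top:
  assumes "0 < n" "A \<in> cyc_orbits n"
  shows "\<exists>K. K \<in> A \<and> n \<in> K"
proof -
  obtain J j where J: "J \<subseteq> {1..n}" "j \<in> J" "A = cyc_orbit n J" using assms(2) by (auto simp: cyc_orbits_def)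
  have j: "j \<in> {1..n}" using J by blast
  have "(csucc n ^^ (n - j)) j = n" using j by (subst csucc_pow) auto
  then have "n \<in> cshift n (n - j) J" using J(2) unfolding cshift_def by (metis imageI)
  moreover have "cshift n (n - j) J \<in> A" using j J(3) by (auto simp: cyc_orbit_def)
  ultimately show ?thesis by blast
qed

text \<open>A representative containing n is the extended ascent set \<open>insert n (asc M)\<close>
  of some monomial; that monomial is the evaluation point \<open>orb_rep\<close> of the
  orbit.\<close>

definition orb_top :: "nat \<Rightarrow> nat set set \<Rightarrow> nat set" where
  "orb_top n A = (SOME K. K \<in> A \<and> n \<in> K)"

lemma orb_top:
  assumes "0 < n" "A \<in> cyc_orbits n"
  shows "orb_top n A \<in> A" "n \<in> orb_top n A"
  using someI_ex[OF ex_orbit_top[OF assms]] by (auto simp: orb_top_def)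

definition orb_rep :: "nat \<Rightarrow> nat set set \<Rightarrow> nat multiset" where
  "orb_rep n A = asc_rep n (orb_top n A - {n})"

lemma orb_rep:
  assumes "0 < n" "A \<in> cyc_orbits n"
  shows "size (orb_rep n A) = n" "insert n (asc (orb_rep n A)) = orb_top n A"
proof -
  have "orb_top n A \<subseteq> {1..n}" using cyc_orbitsE(1)[OF assms orb_top(1)[OF assms]] .
  then have "orb_top n A - {n} \<subseteq> {1..<n}" by (auto simp: order_less_le)
  from asc_rep[OF this] show "size (orb_rep n A) = n" "insert n (asc (orb_rep n A)) = orb_top n A"
    unfolding orb_rep_def using orb_top(2)[OF assms] by (simp_all add: insert_absorb)
qed

text \<open>All members of an orbit have the same size. A member of \<open>B\<close> contained in
  the representative of \<open>A\<close> and at least as large must be equal to it, and then the two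
  orbits coincide. The index set is left variable because both \<open>cyc_orbits n\<close> and
  \<open>corbits n\<close> occur later.\<close>

lemma triangular_orb_Fhat:
  assumes "0 < n" "I \<subseteq> cyc_orbits n"
  shows "triangular I (orb_Fhat n) (orb_rep n) (\<lambda>A. card (orb_top n A))"
proof
  show "finite I" using assms(2) finite_cyc_orbits by (rule finite_subset)
  have eq: "K = orb_top n A"
    if A: "A \<in> I" "K \<subseteq> orb_top n A" "card (orb_top n A) \<le> card K" for K A
  proof -
    have "A \<in> cyc_orbits n" using A(1) assms(2) by blast
    then have "orb_top n A \<subseteq> {1..n}" using cyc_orbitsE(1) orb_top(1) assms(1) by metis
    then have "finite (orb_top n A)" using finite_subset by blast
    then show ?thesis using A card_seteq by blast
  qed
  have card_eq: "card K = card (orb_top n A)" if "A \<in> I" "K \<in> A" for K A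
  proof -
    have A: "A \<in> cyc_orbits n" using that assms by blast
    note T = cyc_orbitsE[OF assms(1) A orb_top(1)[OF assms(1) A]]
    have "K \<in> cyc_orbit n (orb_top n A)" using that(2) T(3) by simp
    then show ?thesis using card_cshift[OF T(1)] by (auto simp: cyc_orbit_def)
  qed
  show "orb_Fhat n A (orb_rep n A) = 1" if "A \<in> I" for A
  proof -
    have A: "A \<in> cyc_orbits n" using that assms by blast
    have "K = orb_top n A" if "K \<in> A" "K \<subseteq> orb_top n A" for K
      using eq[OF \<open>A \<in> I\<close> that(2)] card_eq[OF \<open>A \<in> I\<close> that(1)] by simp
    then have "{K \<in> A. K \<subseteq> orb_top n A} = {orb_top n A}"
      using orb_top(1)[OF assms(1) A] by blast
    then have "card {K \<in> A. K \<subseteq> orb_top n A} = 1" by simp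
    then show ?thesis unfolding orb_Fhat_eq[OF assms(1) A] orb_rep[OF assms(1) A] by simp
  qed
  show "orb_Fhat n B (orb_rep n A) = 0"
    if AB: "A \<in> I" "B \<in> I" "A \<noteq> B" "card (orb_top n A) \<le> card (orb_top n B)" for A B
  proof -
    have A: "A \<in> cyc_orbits n" and B: "B \<in> cyc_orbits n" using AB assms by auto
    have "K \<notin> B" if "K \<subseteq> orb_top n A" for K
    proof
      assume K: "K \<in> B"
      then have "K = orb_top n A" using eq[OF AB(1) that] card_eq[OF AB(2) K] AB(4) by simp
      then have "K \<in> A" using orb_top(1)[OF assms(1) A] by simp
      then show False using cyc_orbitsE(3)[OF assms(1) A] cyc_orbitsE(3)[OF assms(1) B K] AB(3) by simp
    qed
    then have "{K \<in> B. K \<subseteq> orb_top n A} = {}" by blast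
    then show ?thesis unfolding orb_Fhat_eq[OF assms(1) B] orb_rep[OF assms(1) A]
      by (simp only: card.empty of_nat_0 if_cancel)
  qed
qed

text \<open>By \<open>cQSym_cong\<close> a cyclic quasi-symmetric function is determined by one
  value for each orbit, which is the determinacy hypothesis of \<open>subset_span\<close>.\<close>

lemma cQSym_eq_span:
  assumes "0 < n"
  shows "cQSym n = zmod.span (Fhat n ` (Pow {1..n} - {{}}))"
proof
  show "zmod.span (Fhat n ` (Pow {1..n} - {{}})) \<subseteq> cQSym n"
    by (intro zmod.span_minimal subspace_cQSym image_subsetI Fhat_in_cQSym[OF assms]) simp
  interpret triangular "cyc_orbits n" "orb_Fhat n" "orb_rep n" "\<lambda>A. card (orb_top n A)"
    using triangular_orb_Fhat[OF assms] by simp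
  have F: "orb_Fhat n ` cyc_orbits n \<subseteq> Fhat n ` (Pow {1..n} - {{}})"
  proof clarify
    fix A assume A: "A \<in> cyc_orbits n"
    note S = cyc_orbits_nonempty[OF assms A]
    show "orb_Fhat n A \<in> Fhat n ` (Pow {1..n} - {{}})"
      using orb_Fhat_eq_Fhat[OF assms A S] cyc_orbitsE[OF assms A S] by blast
  qed
  have "cQSym n \<subseteq> zmod.span (orb_Fhat n ` cyc_orbits n)"
  proof (rule subset_span[OF subspace_cQSym])
    have "Fhat n ` (Pow {1..n} - {{}}) \<subseteq> cQSym n"
      by (intro image_subsetI Fhat_in_cQSym[OF assms]) simp
    then show "orb_Fhat n ` cyc_orbits n \<subseteq> cQSym n" using F by (rule subset_trans[rotated])
    fix f assume f: "f \<in> cQSym n" "\<And>A. A \<in> cyc_orbits n \<Longrightarrow> f (orb_rep n A) = 0"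
    show "f = 0"
    proof
      fix M
      show "f M = 0 M"
      proof (cases "size M = n")
        case True
        let ?E = "insert n (asc M)"
        let ?A = "cyc_orbit n ?E"
        have "?E \<subseteq> {1..n}" using asc_subset[of M] assms True by auto
        then have A: "?A \<in> cyc_orbits n" by (auto simp: cyc_orbits_def)
        obtain s where "orb_top n ?A = cshift n s ?E"
          using orb_top(1)[OF assms A] by (auto simp: cyc_orbit_def)
        then have "f M = f (orb_rep n ?A)"
          using cQSym_cong[OF f(1) True orb_rep(1)[OF assms A] assms] orb_rep(2)[OF assms A] by simp
        then show ?thesis using f(2) A by simp
      qed (simp add: cQSym_homogeneous[OF f(1)])
    qed
  qed
  then show "cQSym n \<subseteq> zmod.span (Fhat n ` (Pow {1..n} - {{}}))"
    using zmod.span_mono[OF F] by blast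
qed

lemma cQSym_minus_eq_span:
  assumes "1 < n"
  shows "cQSym_minus n = zmod.span (Fhat n ` (Pow {1..n} - {{}, {1..n}}))"
proof -
  have "{Fhat n J | J. J \<subseteq> {1..n} \<and> J \<noteq> {} \<and> J \<noteq> {1..n}} = Fhat n ` (Pow {1..n} - {{}, {1..n}})"
    by auto
  then show ?thesis using assms by (simp add: cQSym_minus_def)
qed

section \<open>Complete and elementary symmetric functions as extreme cases\<close>

lemma hsym_eq_F: "hsym n = F n {}"
  by (auto simp: hsym_def F_eq)

lemma asc_eq_all_iff: "asc M = {1..<size M} \<longleftrightarrow> (\<forall>x. count M x \<le> 1)"
proof -
  let ?v = "sorted_list_of_multiset M"
  have "asc M = {1..<size M} \<longleftrightarrow> sorted_wrt (<) ?v"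
  proof -
    have "asc M = {1..<size M} \<longleftrightarrow> (\<forall>j\<in>{1..<length ?v}. ?v ! (j - 1) < ?v ! j)"
      by (auto simp: asc_def ascents_def)
    also have "\<dots> \<longleftrightarrow> (\<forall>i. Suc i < length ?v \<longrightarrow> ?v ! i < ?v ! Suc i)"
      by (metis (no_types, lifting) One_nat_def Suc_le_D Suc_le_mono atLeastLessThan_iff diff_Suc_1 le0)
    also have "\<dots> \<longleftrightarrow> sorted_wrt (<) ?v" using sorted_wrt_iff_nth_Suc_transp[of "(<)" ?v]
      by (simp add: transp_on_def)
    finally show ?thesis .
  qed
  also have "\<dots> \<longleftrightarrow> distinct ?v" using strict_sorted_iff[of ?v] by simp
  also have "\<dots> \<longleftrightarrow> (\<forall>x. count M x = (if x \<in># M then 1 else 0))"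
    unfolding distinct_count_atmost_1 by simp
  also have "\<dots> \<longleftrightarrow> (\<forall>x. count M x \<le> 1)"
    by (metis count_greater_eq_one_iff le_antisym not_in_iff zero_le_one order_refl)
  finally show ?thesis .
qed

lemma esym_eq_F: "esym n = F n {1..<n}"
proof
  fix M
  have "{1..<n} \<subseteq> asc M \<longleftrightarrow> (\<forall>x. count M x \<le> 1)" if "size M = n"
    using asc_eq_all_iff[of M] asc_subset[of M] that by auto
  then show "esym n M = F n {1..<n} M" by (auto simp: esym_def F_eq)
qed

lemma Fhat_empty: "0 < n \<Longrightarrow> Fhat n {} = hsym n"
proof
  fix M assume "0 < n"
  moreover from this have "cyc_orbit n {} = {{}}" by (auto simp: cyc_orbit_def cshift_def)
  moreover have "{K. K = {} \<and> K \<subseteq> insert n (asc M)} = {{}}" by auto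
  ultimately show "Fhat n {} M = hsym n M" by (auto simp: Fhat_eq hsym_def)
qed

lemma Fhat_full: "0 < n \<Longrightarrow> Fhat n {1..n} = esym n"
proof
  fix M assume n: "0 < n"
  then have "cyc_orbit n {1..n} = {{1..n}}" by (auto simp: cyc_orbit_def cshift_UNIV simp del: One_nat_def)
  moreover have "{K. K = {1..n} \<and> K \<subseteq> insert n (asc M)} = (if {1..n} \<subseteq> insert n (asc M) then {{1..n}} else {})"
    by auto
  moreover have "{1..n} = insert n {1..<n}" using n by auto
  ultimately show "Fhat n {1..n} M = esym n M"
    unfolding Fhat_eq[OF n order_refl] esym_eq_F F_eq[OF order_refl] by (auto simp: subset_insert)
qed

section \<open>Permutations with prescribed descents\<close>

text \<open>Standardization of pairwise distinct keys: every key is replaced by its rank.\<close>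

lemma ex_perm_order:
  fixes key :: "nat \<Rightarrow> nat"
  assumes "inj_on key {1..n}"
  shows "\<exists>\<tau>. \<tau> permutes {1..n} \<and> (\<forall>x\<in>{1..n}. \<forall>y\<in>{1..n}. \<tau> x < \<tau> y \<longleftrightarrow> key x < key y)"
proof -
  define \<tau> where "\<tau> x = (if x \<in> {1..n} then card {y \<in> {1..n}. key y \<le> key x} else x)" for x
  have less: "\<tau> x < \<tau> y" if "x \<in> {1..n}" "y \<in> {1..n}" "key x < key y" for x y
  proof -
    have "{z \<in> {1..n}. key z \<le> key x} \<subseteq> {z \<in> {1..n}. key z \<le> key y}" using that by auto
    moreover have "y \<notin> {z \<in> {1..n}. key z \<le> key x}" "y \<in> {z \<in> {1..n}. key z \<le> key y}" using that by auto
    ultimately have "{z \<in> {1..n}. key z \<le> key x} \<subset> {z \<in> {1..n}. key z \<le> key y}" by blast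
    then have "card {z \<in> {1..n}. key z \<le> key x} < card {z \<in> {1..n}. key z \<le> key y}"
      by (rule psubset_card_mono[rotated]) simp
    then show ?thesis using that(1,2) unfolding \<tau>_def by presburger
  qed
  have iff: "\<tau> x < \<tau> y \<longleftrightarrow> key x < key y" if "x \<in> {1..n}" "y \<in> {1..n}" for x y
  proof
    assume "\<tau> x < \<tau> y"
    then show "key x < key y"
      using less[OF that(2,1)] inj_onD[OF assms _ that] by (metis nat_neq_iff order_less_asym)
  qed (rule less[OF that])
  have inj: "inj_on \<tau> {1..n}"
    by (rule inj_onI) (metis iff assms inj_onD nat_neq_iff)
  have "\<tau> x \<in> {1..n}" if x: "x \<in> {1..n}" for x
  proof -
    have "card {x} \<le> card {y \<in> {1..n}. key y \<le> key x}" using x by (intro card_mono) auto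
    moreover have "card {y \<in> {1..n}. key y \<le> key x} \<le> card {1..n}" by (intro card_mono) auto
    ultimately show ?thesis using x unfolding \<tau>_def by simp
  qed
  then have "\<tau> ` {1..n} = {1..n}" using inj by (intro endo_inj_surj) auto
  then have "bij_betw \<tau> {1..n} {1..n}" using inj unfolding bij_betw_def by blast
  moreover have "\<tau> x = x" if "x \<notin> {1..n}" for x using that unfolding \<tau>_def by presburger
  ultimately have "\<tau> permutes {1..n}" by (rule bij_imp_permutes)
  then show ?thesis using iff by blast
qed

text \<open>A value of a permutation of \<open>{1..n}\<close> is one more than the number of smaller
  values, so the comparisons determine it.\<close>

lemma perm_order_unique:
  fixes \<tau> \<tau>' :: "nat \<Rightarrow> nat"
  assumes "\<tau> permutes {1..n}" "\<tau>' permutes {1..n}"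
    and "\<And>x y. x \<in> {1..n} \<Longrightarrow> y \<in> {1..n} \<Longrightarrow> \<tau> x < \<tau> y \<longleftrightarrow> \<tau>' x < \<tau>' y"
  shows "\<tau> = \<tau>'"
proof -
  have card: "card {y \<in> {1..n}. \<sigma> y < \<sigma> x} + 1 = \<sigma> x" if \<sigma>: "\<sigma> permutes {1..n}" and x: "x \<in> {1..n}" for \<sigma> x
  proof -
    have "\<sigma> ` {y \<in> {1..n}. \<sigma> y < \<sigma> x} = {1..<\<sigma> x}"
    proof (intro equalityI subsetI)
      fix z assume z: "z \<in> {1..<\<sigma> x}"
      have "\<sigma> x \<in> {1..n}" using permutes_in_image[OF \<sigma>] x by blast
      then have "inv \<sigma> z \<in> {1..n}" using z permutes_in_image[OF permutes_inv[OF \<sigma>], of z] by auto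
      then show "z \<in> \<sigma> ` {y \<in> {1..n}. \<sigma> y < \<sigma> x}"
        using z permutes_inverses(1)[OF \<sigma>, of z] by (intro image_eqI[of _ _ "inv \<sigma> z"]) auto
    next
      fix z assume "z \<in> \<sigma> ` {y \<in> {1..n}. \<sigma> y < \<sigma> x}"
      then obtain y where "y \<in> {1..n}" "\<sigma> y < \<sigma> x" "z = \<sigma> y" by blast
      then show "z \<in> {1..<\<sigma> x}" using permutes_in_image[OF \<sigma>, of y] by auto
    qed
    then have "card {y \<in> {1..n}. \<sigma> y < \<sigma> x} = card {1..<\<sigma> x}"
      using card_image[OF inj_on_subset[OF permutes_inj_on[OF \<sigma>]]] by (metis subset_UNIV)
    moreover have "\<sigma> x \<in> {1..n}" using permutes_in_image[OF \<sigma>] x by blast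
    ultimately show ?thesis by simp
  qed
  show ?thesis
  proof
    fix x
    show "\<tau> x = \<tau>' x"
    proof (cases "x \<in> {1..n}")
      case True
      then have "{y \<in> {1..n}. \<tau> y < \<tau> x} = {y \<in> {1..n}. \<tau>' y < \<tau>' x}" using assms(3) by blast
      then show ?thesis using card[OF assms(1) True] card[OF assms(2) True] by metis
    next
      case False
      then show ?thesis using assms(1,2) by (metis permutes_not_in)
    qed
  qed
qed

text \<open>Packs the lexicographic order of pairs with second entry at most n into one number.
  Words with repeated letters thereby get distinct keys, with ties broken by the second
  entry.\<close>

lemma lex_key:
  fixes a a' x x' n :: nat
  assumes "x \<le> n" "x' \<le> n"
  shows "a * (n + 1) + x < a' * (n + 1) + x' \<longleftrightarrow> a < a' \<or> a = a' \<and> x < x'"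
proof -
  have lt: "b * (n + 1) + y < b' * (n + 1) + y'" if "b < b'" "y \<le> n" for b b' y y'
  proof -
    have "b * (n + 1) + y < Suc b * (n + 1)" using that by simp
    also have "\<dots> \<le> b' * (n + 1)" using that by (intro mult_le_mono1) simp
    finally show ?thesis by simp
  qed
  consider "a < a'" | "a = a'" | "a' < a" by linarith
  then show ?thesis
  proof cases
    case 1 then show ?thesis using lt[of a a' x x'] assms by simp
  next
    case 2 then show ?thesis by simp
  next
    case 3 then show ?thesis using lt[of a' a x' x] assms by simp
  qed
qed

lemma inj_on_lex_key: "inj_on (\<lambda>x. z x * (n + 1) + x) {1..n :: nat}"
proof (rule inj_onI)
  fix x y assume xy: "x \<in> {1..n}" "y \<in> {1..n}" "z x * (n + 1) + x = z y * (n + 1) + y"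
  then have "\<not> (z x * (n + 1) + x < z y * (n + 1) + y)" "\<not> (z y * (n + 1) + y < z x * (n + 1) + x)" by simp_all
  moreover have "x \<le> n" "y \<le> n" using xy by auto
  ultimately show "x = y" using lex_key by (metis nat_neq_iff)
qed

lemma Des_subset: "Des n \<pi> \<subseteq> {1..<n}"
  by (auto simp: Des_def)

lemma not_Des_iff:
  assumes "\<pi> permutes {1..n}" "k \<in> {1..<n}"
  shows "k \<notin> Des n \<pi> \<longleftrightarrow> \<pi> k < \<pi> (k + 1)"
  using assms(2) permutes_inj[OF assms(1)] by (auto simp: Des_def not_less le_less inj_eq)

lemma ex_Des:
  assumes "K \<subseteq> {1..<n}"
  shows "\<exists>\<pi>. \<pi> permutes {1..n} \<and> Des n \<pi> = K"
proof -
  \<comment> \<open>\<open>c i\<close> is the index of the run of position \<open>i\<close> when the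
    positions are cut after the elements of \<open>K\<close>. Ordering by \<open>n - c i\<close> and
    then by position gives later runs smaller values, so descents occur exactly at the cuts.\<close>
  define c where "c i = card {k \<in> K. k < i}" for i
  have fin: "finite K" using assms finite_subset by blast
  have "c i \<le> card {1..<n}" for i unfolding c_def using assms by (intro card_mono) auto
  then have cn: "c i \<le> n" for i by (metis card_atLeastLessThan diff_le_self order_trans)
  have c: "c (i + 1) = (if i \<in> K then c i + 1 else c i)" for i
  proof -
    have "{k \<in> K. k < i + 1} = (if i \<in> K then insert i {k \<in> K. k < i} else {k \<in> K. k < i})"
      by (auto simp: less_Suc_eq)
    then show ?thesis using fin by (simp add: c_def)
  qed
  obtain \<pi> where \<pi>: "\<pi> permutes {1..n}"
    "\<And>x y. x \<in> {1..n} \<Longrightarrow> y \<in> {1..n} \<Longrightarrow> \<pi> x < \<pi> y \<longleftrightarrow> (n - c x) * (n + 1) + x < (n - c y) * (n + 1) + y"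
    using ex_perm_order[OF inj_on_lex_key[of "\<lambda>x. n - c x" n]] by blast
  have "k \<in> Des n \<pi> \<longleftrightarrow> k \<in> K" if k: "k \<in> {1..<n}" for k
  proof -
    have "k \<in> Des n \<pi> \<longleftrightarrow> \<pi> (k + 1) < \<pi> k" using k by (simp add: Des_def)
    also have "\<dots> \<longleftrightarrow> (n - c (k + 1)) * (n + 1) + (k + 1) < (n - c k) * (n + 1) + k"
      using k by (intro \<pi>(2)) auto
    also have "\<dots> \<longleftrightarrow> n - c (k + 1) < n - c k" using k lex_key[of "k + 1" n k] by auto
    also have "\<dots> \<longleftrightarrow> k \<in> K" using c[of k] cn[of "k + 1"] by auto
    finally show ?thesis .
  qed
  then have "Des n \<pi> = K" using Des_subset[of n \<pi>] assms by blast
  then show ?thesis using \<pi>(1) by blast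
qed

text \<open>Start from a permutation with ordinary descent set \<open>K - {n}\<close> and raise its
  last value to the maximum. This creates a cyclic descent at n, removes any descent at
  \<open>n - 1\<close>, and changes no comparison elsewhere.\<close>

lemma ex_cDes_top:
  assumes "1 < n" "K \<subseteq> {1..n}" "n \<in> K" "n - 1 \<notin> K"
  shows "\<exists>\<pi>. \<pi> permutes {1..n} \<and> cDes n \<pi> = K"
proof -
  have "K - {n} \<subseteq> {1..<n}" using assms(2) by (auto simp: order_less_le)
  then obtain \<rho> where \<rho>: "\<rho> permutes {1..n}" "Des n \<rho> = K - {n}" using ex_Des by blast
  define key where "key i = (if i = n then n + 1 else \<rho> i)" for i
  have \<rho>_le: "\<rho> i \<le> n" if "i \<in> {1..n}" for i using permutes_in_image[OF \<rho>(1), of i] that by auto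
  have "inj_on key {1..n}"
  proof (rule inj_onI)
    fix x y assume xy: "x \<in> {1..n}" "y \<in> {1..n}" "key x = key y"
    then show "x = y" using \<rho>_le[OF xy(1)] \<rho>_le[OF xy(2)] permutes_inj[OF \<rho>(1)]
      by (auto simp: key_def inj_eq split: if_splits)
  qed
  then obtain \<pi> where \<pi>: "\<pi> permutes {1..n}"
    "\<And>x y. x \<in> {1..n} \<Longrightarrow> y \<in> {1..n} \<Longrightarrow> \<pi> x < \<pi> y \<longleftrightarrow> key x < key y"
    using ex_perm_order by blast
  have "k \<in> cDes n \<pi> \<longleftrightarrow> k \<in> K" if k: "k \<in> {1..n}" for k
  proof -
    have "csucc n k \<in> {1..n}" using k by (auto simp: csucc_def)
    then have D: "k \<in> cDes n \<pi> \<longleftrightarrow> key (csucc n k) < key k" using k \<pi>(2) by (auto simp: cDes_def)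
    consider "k = n" | "k = n - 1" | "k < n - 1" using k by fastforce
    then show ?thesis
    proof cases
      case 1
      then show ?thesis using D assms \<rho>_le[of 1] by (auto simp: csucc_def key_def)
    next
      case 2
      then show ?thesis using D assms \<rho>_le[OF k] by (auto simp: csucc_def key_def)
    next
      case 3
      then have "k \<in> cDes n \<pi> \<longleftrightarrow> k \<in> Des n \<rho>" using D k by (auto simp: csucc_def key_def Des_def)
      moreover have "k \<noteq> n" using 3 by simp
      ultimately show ?thesis unfolding \<rho>(2) by simp
    qed
  qed
  moreover have "cDes n \<pi> \<subseteq> {1..n}" by (auto simp: cDes_def)
  ultimately have "cDes n \<pi> = K" using assms(2) by blast
  then show ?thesis using \<pi>(1) by blast
qed

text \<open>Walking around the cycle, a nonempty proper set must be entered somewhere: there is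
  \<open>i\<close> outside \<open>J\<close> whose successor lies in \<open>J\<close>. Shifting that
  successor to n gives a member of the orbit to which \<open>ex_cDes_top\<close> applies.\<close>

lemma ex_cDes:
  assumes n: "1 < n" and B: "B \<in> corbits n"
  shows "\<exists>\<pi>. \<pi> permutes {1..n} \<and> cDes n \<pi> \<in> B"
proof -
  have "0 < n" using n by simp
  obtain J where J: "J \<subseteq> {1..n}" "J \<noteq> {}" "J \<noteq> {1..n}" "B = cyc_orbit n J" using B by (auto simp: corbits_eq)
  have "\<exists>i\<in>{1..n}. i \<notin> J \<and> csucc n i \<in> J"
  proof (rule ccontr)
    assume *: "\<not> (\<exists>i\<in>{1..n}. i \<notin> J \<and> csucc n i \<in> J)"
    obtain i where i: "i \<in> {1..n}" "i \<notin> J" using J by blast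
    have "(csucc n ^^ s) i \<notin> J" for s
      using * i csucc_pow_mem[OF i(1)] by (induction s) auto
    moreover obtain j where j: "j \<in> J" "j \<in> {1..n}" using J by blast
    moreover have "(csucc n ^^ (n - i + j)) i = j"
    proof -
      have "i - 1 + (n - i + j) = n + (j - 1)" using i(1) j(2) by auto
      then show ?thesis using j(2) by (simp only: csucc_pow[OF i(1)] mod_add_self1) auto
    qed
    ultimately show False by metis
  qed
  then obtain i where i: "i \<in> {1..n}" "i \<notin> J" "csucc n i \<in> J" by blast
  define t where "t = n - csucc n i"
  define K where "K = cshift n t J"
  have si: "csucc n i \<in> {1..n}" using i J by blast
  have top: "(csucc n ^^ t) (csucc n i) = n" using si by (subst csucc_pow) (auto simp: t_def)
  have "n \<in> K" unfolding K_def cshift_def using top i(3) by (metis imageI)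
  moreover have "n - 1 \<notin> K"
  proof
    assume "n - 1 \<in> K"
    then obtain j where j: "j \<in> J" "(csucc n ^^ t) j = n - 1" by (auto simp: K_def cshift_def)
    have "csucc n ((csucc n ^^ t) i) = n" using top by (metis funpow_swap1)
    then have "(csucc n ^^ t) i = n - 1" using n by (auto simp: csucc_def split: if_splits)
    then have "i = j" using inj_onD[OF inj_on_csucc_pow, of t n i j] j i(1) J(1) by auto
    then show False using i j by blast
  qed
  moreover have "K \<subseteq> {1..n}" unfolding K_def using J(1) cshift_subset by blast
  moreover have "K \<in> B"
    using J(4) si \<open>0 < n\<close> unfolding K_def cyc_orbit_def t_def by fastforce
  ultimately show ?thesis using ex_cDes_top[OF n, of K] by metis
qed

section \<open>The coproduct formula\<close>

text \<open>
  The coefficient of \<open>x\<^sup>M y\<^sup>N\<close> in \<open>F\<^sub>n\<^sub>,\<^sub>K\<close> evaluated at the lexicographically ordered variables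
  \<open>x\<^sub>i y\<^sub>j\<close>: the \<open>x\<close>-indices are forced to be the sorted list of \<open>M\<close>, and \<open>y\<close> is the list of the
  \<open>y\<close>-indices.
\<close>

definition biwords :: "nat \<Rightarrow> nat set \<Rightarrow> nat multiset \<Rightarrow> nat multiset \<Rightarrow> nat list set" where
  "biwords n K M N = {y. length y = n \<and> mset y = N \<and>
     (\<forall>k\<in>{1..<n} - asc M. y ! (k - 1) < y ! k \<or> y ! (k - 1) = y ! k \<and> k \<notin> K)}"

lemma mset_permuted_list:
  assumes "\<rho> permutes {1..n}"
  shows "mset (map (\<lambda>k. f (\<rho> k)) [1..<Suc n]) = image_mset f (mset_set {1..n})"
proof -
  have "mset [1..<Suc n] = mset_set {1..n}"
    by (metis atLeastLessThanSuc_atLeastAtMost mset_upt)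
  then have "mset (map (\<lambda>k. f (\<rho> k)) [1..<Suc n]) = image_mset f (image_mset \<rho> (mset_set {1..n}))"
    by (simp only: mset_map multiset.map_comp comp_def)
  then show ?thesis by (simp only: permutes_image_mset[OF assms])
qed

lemma mset_eq_image_nth:
  assumes "length v = n"
  shows "mset v = image_mset (\<lambda>k. v ! (k - 1)) (mset_set {1..n})"
proof -
  have "v = map (\<lambda>k. v ! (k - 1)) [1..<Suc n]"
    using assms by (intro nth_equalityI) (auto simp del: upt_Suc)
  then have "mset v = mset (map (\<lambda>k. v ! (k - 1)) [1..<Suc n])" by (rule arg_cong)
  then show ?thesis using mset_permuted_list[OF permutes_id, of "\<lambda>k. v ! (k - 1)" n]
    unfolding id_apply by (rule trans)
qed

lemma nth_map_upt_Suc: "k \<in> {1..n} \<Longrightarrow> map f [1..<Suc n] ! (k - 1) = f k"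
  by (auto simp del: upt_Suc)

text \<open>A block of equal letters of \<open>v\<close> contains no ascent, so
  \<open>inv \<tau>\<close> increases on it. Hence \<open>\<tau>\<close> orders its arguments first
  by the letter they receive and then by size, and can be recovered from these letters.\<close>

lemma standardization_order:
  assumes \<tau>: "\<tau> permutes {1..n}" and v: "sorted v" "length v = n"
    and D: "Des n (inv \<tau>) \<subseteq> ascents v" and x: "x \<in> {1..n}" "x' \<in> {1..n}"
  shows "\<tau> x < \<tau> x' \<longleftrightarrow> v ! (\<tau> x - 1) * (n + 1) + x < v ! (\<tau> x' - 1) * (n + 1) + x'"
proof -
  have incr: "inv \<tau> a < inv \<tau> b" if ab: "v ! (a - 1) = v ! (b - 1)" "1 \<le> a" "b \<le> n" "a < b" for a b
  proof -
    have step: "inv \<tau> m < inv \<tau> (Suc m)" if m: "a \<le> m" "m < b" for m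
    proof -
      have "v ! (a - 1) \<le> v ! (m - 1)" "v ! (m - 1) \<le> v ! m" "v ! m \<le> v ! (b - 1)"
        using v(2) m ab sorted_nth_mono[OF v(1), of "a - 1" "m - 1"]
          sorted_nth_mono[OF v(1), of "m - 1" m] sorted_nth_mono[OF v(1), of m "b - 1"] by auto
      then have "m \<notin> ascents v" using ab(1) by (auto simp: ascents_def)
      then have "m \<notin> Des n (inv \<tau>)" using D by blast
      then show ?thesis using not_Des_iff[OF permutes_inv[OF \<tau>], of m] m ab by simp
    qed
    have "Suc a \<le> b" using ab by simp
    then show ?thesis
    proof (induction b rule: dec_induct)
      case base
      then show ?case using step ab(4) by blast
    next
      case (step m)
      have "inv \<tau> m < inv \<tau> (Suc m)" using step.hyps \<open>\<And>m. a \<le> m \<Longrightarrow> m < b \<Longrightarrow> inv \<tau> m < inv \<tau> (Suc m)\<close> by simp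
      then show ?case using step.IH by simp
    qed
  qed
  have main: "v ! (\<tau> y - 1) * (n + 1) + y < v ! (\<tau> y' - 1) * (n + 1) + y'"
    if y: "y \<in> {1..n}" "y' \<in> {1..n}" "\<tau> y < \<tau> y'" for y y'
  proof -
    have t: "\<tau> y \<in> {1..n}" "\<tau> y' \<in> {1..n}" using permutes_in_image[OF \<tau>] y by blast+
    then have "v ! (\<tau> y - 1) \<le> v ! (\<tau> y' - 1)" using v y(3) by (intro sorted_nth_mono) auto
    moreover have "y < y'" if "v ! (\<tau> y - 1) = v ! (\<tau> y' - 1)"
      using incr[OF that] t y(3) permutes_inverses(2)[OF \<tau>] by simp
    ultimately show ?thesis using lex_key[of y n y'] y by auto
  qed
  show ?thesis
  proof
    assume key: "v ! (\<tau> x - 1) * (n + 1) + x < v ! (\<tau> x' - 1) * (n + 1) + x'"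
    then have "\<not> \<tau> x' < \<tau> x" using main[OF x(2,1)] by linarith
    moreover have "\<tau> x \<noteq> \<tau> x'" using key permutes_inj[OF \<tau>] by (auto simp: inj_eq)
    ultimately show "\<tau> x < \<tau> x'" by simp
  qed (rule main[OF x])
qed

text \<open>The permutation \<open>\<tau>\<close> corresponds to the word whose letter number
  \<open>k\<close> is the entry of the sorted \<open>N\<close> at place
  \<open>\<tau> (\<pi> k)\<close>. Thus \<open>\<tau> \<circ> \<pi>\<close> standardizes the word,
  with ties broken by the value of \<open>\<pi>\<close> rather than by position. This makes the
  clause \<open>k \<notin> K\<close> for equal neighbours, with \<open>K = Des n \<pi>\<close>, say
  the same as \<open>k\<close> not being a descent of \<open>\<tau> \<circ> \<pi>\<close>.\<close>

lemma card_biwords: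
  assumes \<pi>: "\<pi> permutes {1..n}" and N: "size N = n"
  shows "card (biwords n (Des n \<pi>) M N) =
    card {\<tau>. \<tau> permutes {1..n} \<and> Des n (\<tau> \<circ> \<pi>) \<subseteq> asc M \<and> Des n (inv \<tau>) \<subseteq> asc N}"
proof -
  define v where "v = sorted_list_of_multiset N"
  have v: "sorted v" "length v = n" "mset v = N" by (simp_all add: v_def N)
  have aN: "asc N = ascents v" by (simp add: asc_def v_def)
  let ?T = "{\<tau>. \<tau> permutes {1..n} \<and> Des n (\<tau> \<circ> \<pi>) \<subseteq> asc M \<and> Des n (inv \<tau>) \<subseteq> asc N}"
  define h where "h \<tau> = map (\<lambda>k. v ! (\<tau> (\<pi> k) - 1)) [1..<Suc n]" for \<tau>
  have h_nth: "h \<tau> ! (k - 1) = v ! (\<tau> (\<pi> k) - 1)" if "k \<in> {1..n}" for \<tau> k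
    unfolding h_def using nth_map_upt_Suc[OF that] .
  have \<pi>_in: "\<pi> k \<in> {1..n}" if "k \<in> {1..n}" for k using permutes_in_image[OF \<pi>] that by blast
  have cond: "h \<tau> \<in> biwords n (Des n \<pi>) M N \<longleftrightarrow> Des n (\<tau> \<circ> \<pi>) \<subseteq> asc M"
    if \<tau>: "\<tau> permutes {1..n}" "Des n (inv \<tau>) \<subseteq> asc N" for \<tau>
  proof -
    have len: "length (h \<tau>) = n" by (simp add: h_def)
    have "mset (h \<tau>) = image_mset (\<lambda>k. v ! (k - 1)) (mset_set {1..n})"
      unfolding h_def using mset_permuted_list[OF permutes_compose[OF \<pi> \<tau>(1)], of "\<lambda>k. v ! (k - 1)"]
      by (simp only: comp_def)
    then have ms: "mset (h \<tau>) = N" using mset_eq_image_nth[OF v(2)] v(3) by simp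
    have "h \<tau> ! (k - 1) < h \<tau> ! k \<or> h \<tau> ! (k - 1) = h \<tau> ! k \<and> k \<notin> Des n \<pi> \<longleftrightarrow> k \<notin> Des n (\<tau> \<circ> \<pi>)"
      if k: "k \<in> {1..<n}" for k
    proof -
      have kn: "k \<in> {1..n}" "k + 1 \<in> {1..n}" using k by auto
      have "k \<notin> Des n (\<tau> \<circ> \<pi>) \<longleftrightarrow> \<tau> (\<pi> k) < \<tau> (\<pi> (k + 1))"
        using not_Des_iff[OF permutes_compose[OF \<pi> \<tau>(1)] k] by simp
      also have "\<dots> \<longleftrightarrow> v ! (\<tau> (\<pi> k) - 1) * (n + 1) + \<pi> k < v ! (\<tau> (\<pi> (k + 1)) - 1) * (n + 1) + \<pi> (k + 1)"
        using standardization_order[OF \<tau>(1) v(1,2) _ \<pi>_in[OF kn(1)] \<pi>_in[OF kn(2)]] \<tau>(2) aN by simp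
      also have "\<dots> \<longleftrightarrow> h \<tau> ! (k - 1) < h \<tau> ! k \<or> h \<tau> ! (k - 1) = h \<tau> ! k \<and> \<pi> k < \<pi> (k + 1)"
        using lex_key[of "\<pi> k" n "\<pi> (k + 1)"] \<pi>_in[OF kn(1)] \<pi>_in[OF kn(2)] h_nth[OF kn(1)] h_nth[OF kn(2)]
        by simp
      finally show ?thesis using not_Des_iff[OF \<pi> k] by simp
    qed
    then show ?thesis using len ms Des_subset[of n "\<tau> \<circ> \<pi>"] unfolding biwords_def by blast
  qed
  have "inj_on h ?T"
  proof (rule inj_onI)
    fix \<tau> \<tau>' assume t: "\<tau> \<in> ?T" "\<tau>' \<in> ?T" "h \<tau> = h \<tau>'"
    have eq: "v ! (\<tau> x - 1) = v ! (\<tau>' x - 1)" if "x \<in> {1..n}" for x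
    proof -
      have i: "inv \<pi> x \<in> {1..n}" using permutes_in_image[OF permutes_inv[OF \<pi>]] that by blast
      show ?thesis using h_nth[OF i, of \<tau>] h_nth[OF i, of \<tau>'] t(3) permutes_inverses(1)[OF \<pi>] by simp
    qed
    show "\<tau> = \<tau>'"
    proof (rule perm_order_unique)
      show "\<tau> permutes {1..n}" "\<tau>' permutes {1..n}" using t by auto
      fix x y assume xy: "x \<in> {1..n}" "y \<in> {1..n}"
      show "\<tau> x < \<tau> y \<longleftrightarrow> \<tau>' x < \<tau>' y"
        using standardization_order[OF _ v(1,2) _ xy, of \<tau>] standardization_order[OF _ v(1,2) _ xy, of \<tau>']
          t(1,2) aN eq[OF xy(1)] eq[OF xy(2)] by simp
    qed
  qed
  moreover have "h ` ?T = biwords n (Des n \<pi>) M N"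
  proof (intro equalityI subsetI)
    fix y assume "y \<in> h ` ?T"
    then show "y \<in> biwords n (Des n \<pi>) M N" using cond by blast
  next
    fix y assume y: "y \<in> biwords n (Des n \<pi>) M N"
    then have yl: "length y = n" "mset y = N" by (simp_all add: biwords_def)
    \<comment> \<open>The given word indexed by the values of \<open>\<pi>\<close> instead of by
      positions; its standardization is the required \<open>\<tau>\<close>.\<close>
    define z where "z x = y ! (inv \<pi> x - 1)" for x
    obtain \<tau> where \<tau>: "\<tau> permutes {1..n}"
      "\<And>x x'. x \<in> {1..n} \<Longrightarrow> x' \<in> {1..n} \<Longrightarrow> \<tau> x < \<tau> x' \<longleftrightarrow> z x * (n + 1) + x < z x' * (n + 1) + x'"
      using ex_perm_order[OF inj_on_lex_key[of z n]] by blast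
    note \<tau>i = permutes_inv[OF \<tau>(1)]
    have ord: "z (inv \<tau> k) * (n + 1) + inv \<tau> k < z (inv \<tau> k') * (n + 1) + inv \<tau> k'"
      if "k \<in> {1..n}" "k' \<in> {1..n}" "k < k'" for k k'
      using \<tau>(2)[of "inv \<tau> k" "inv \<tau> k'"] permutes_in_image[OF \<tau>i] that permutes_inverses(1)[OF \<tau>(1)]
      by simp
    have lex: "z (inv \<tau> k) < z (inv \<tau> k') \<or> z (inv \<tau> k) = z (inv \<tau> k') \<and> inv \<tau> k < inv \<tau> k'"
      if "k \<in> {1..n}" "k' \<in> {1..n}" "k < k'" for k k'
    proof -
      have "inv \<tau> k \<in> {1..n}" "inv \<tau> k' \<in> {1..n}" using permutes_in_image[OF \<tau>i] that by blast+
      then show ?thesis using ord[OF that] lex_key[of "inv \<tau> k" n "inv \<tau> k'"] by simp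
    qed
    let ?l = "map (\<lambda>k. z (inv \<tau> k)) [1..<Suc n]"
    have "mset ?l = image_mset (\<lambda>k. y ! (k - 1)) (mset_set {1..n})"
      unfolding z_def
      using mset_permuted_list[OF permutes_compose[OF \<tau>i permutes_inv[OF \<pi>]], of "\<lambda>k. y ! (k - 1)"]
      by (simp only: comp_def)
    then have "mset ?l = N" using mset_eq_image_nth[OF yl(1)] yl(2) by simp
    moreover have "sorted ?l"
    proof (rule sorted_wrt_map_mono[of "(<)"])
      show "sorted_wrt (<) [1..<Suc n]" by (rule sorted_wrt_upt)
      fix k k' assume "k \<in> set [1..<Suc n]" "k' \<in> set [1..<Suc n]" "k < k'"
      then have "k \<in> {1..n}" "k' \<in> {1..n}" "k < k'" by auto
      from lex[OF this] show "z (inv \<tau> k) \<le> z (inv \<tau> k')" by auto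
    qed
    ultimately have l: "?l = v" unfolding v_def by (rule sorted_list_of_multiset_unique[symmetric, rotated])
    have vz: "v ! (k - 1) = z (inv \<tau> k)" if "k \<in> {1..n}" for k
      unfolding l[symmetric] by (rule nth_map_upt_Suc[OF that])
    have "Des n (inv \<tau>) \<subseteq> asc N"
    proof
      fix k assume k: "k \<in> Des n (inv \<tau>)"
      then have k': "k \<in> {1..n}" "k + 1 \<in> {1..n}" "k \<in> {1..<n}" "\<not> inv \<tau> k < inv \<tau> (k + 1)" by (auto simp: Des_def)
      then have "z (inv \<tau> k) < z (inv \<tau> (k + 1))" using lex[OF k'(1,2)] by auto
      then have "v ! (k - 1) < v ! k" using vz[OF k'(1)] vz[OF k'(2)] by simp
      then show "k \<in> asc N" using k'(3) v(2) by (simp add: aN ascents_def)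
    qed
    moreover have "h \<tau> = y"
    proof (rule nth_equalityI)
      show "length (h \<tau>) = length y" by (simp add: h_def yl)
      fix i assume "i < length (h \<tau>)"
      then have i: "Suc i \<in> {1..n}" by (simp add: h_def del: upt_Suc)
      have "\<tau> (\<pi> (Suc i)) \<in> {1..n}" using permutes_in_image[OF \<tau>(1)] \<pi>_in[OF i] by blast
      then show "h \<tau> ! i = y ! i" using h_nth[OF i, of \<tau>] vz
        by (simp add: z_def permutes_inverses(2)[OF \<tau>(1)] permutes_inverses(2)[OF \<pi>])
    qed
    ultimately have "\<tau> \<in> ?T" using \<tau>(1) cond y by blast
    then show "y \<in> h ` ?T" using \<open>h \<tau> = y\<close> by blast
  qed
  ultimately show ?thesis using card_image[of h ?T] by (simp only:)
qed

section \<open>Strips of partitions\<close>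

text \<open>Partitions are functions on all row indices, zero from some row on, so that partitions
  of different lengths can be compared row by row.\<close>

definition is_part :: "(nat \<Rightarrow> nat) \<Rightarrow> bool" where
  "is_part \<alpha> \<longleftrightarrow> antimono \<alpha> \<and> (\<exists>L. \<forall>i\<ge>L. \<alpha> i = 0)"

definition psize :: "(nat \<Rightarrow> nat) \<Rightarrow> nat" where
  "psize \<alpha> = (\<Sum>i | \<alpha> i \<noteq> 0. \<alpha> i)"

text \<open>The interlacing form of the condition that the skew shape has at most one cell in each
  column.\<close>

definition hstrip :: "(nat \<Rightarrow> nat) \<Rightarrow> (nat \<Rightarrow> nat) \<Rightarrow> bool" where
  "hstrip \<mu> \<nu> \<longleftrightarrow> (\<forall>i. \<mu> i \<le> \<nu> i \<and> \<nu> (Suc i) \<le> \<mu> i)"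

definition vstrip :: "(nat \<Rightarrow> nat) \<Rightarrow> (nat \<Rightarrow> nat) \<Rightarrow> bool" where
  "vstrip \<mu> \<nu> \<longleftrightarrow> (\<forall>i. \<mu> i \<le> \<nu> i \<and> \<nu> i \<le> Suc (\<mu> i))"

lemma is_partI:
  assumes "\<And>i. \<alpha> (Suc i) \<le> \<alpha> i" "\<And>i. i \<ge> L \<Longrightarrow> \<alpha> i = 0"
  shows "is_part \<alpha>"
  using assms unfolding is_part_def antimono_iff_le_Suc by blast

lemma is_part_Suc: "is_part \<alpha> \<Longrightarrow> \<alpha> (Suc i) \<le> \<alpha> i"
  by (simp add: is_part_def antimono_iff_le_Suc)

lemma is_part_bound2:
  assumes "is_part \<alpha>" "is_part \<mu>"
  shows "\<exists>L. (\<forall>i\<ge>L. \<alpha> i = 0) \<and> (\<forall>i\<ge>L. \<mu> i = 0)"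
proof -
  obtain L1 L2 where "\<forall>i\<ge>L1. \<alpha> i = 0" "\<forall>i\<ge>L2. \<mu> i = 0" using assms by (auto simp: is_part_def)
  then show ?thesis by (intro exI[of _ "max L1 L2"]) auto
qed

lemma psize_eq:
  assumes "\<And>i. i \<ge> L \<Longrightarrow> \<alpha> i = 0"
  shows "psize \<alpha> = (\<Sum>i<L. \<alpha> i)"
proof -
  have "{i. \<alpha> i \<noteq> 0} \<subseteq> {..<L}"
  proof
    fix i assume "i \<in> {i. \<alpha> i \<noteq> 0}"
    then show "i \<in> {..<L}" using assms[of i] by (cases "L \<le> i") auto
  qed
  then show ?thesis unfolding psize_def by (intro sum.mono_neutral_left) auto
qed

lemma psize_mono:
  assumes "is_part \<alpha>" "\<And>i. \<mu> i \<le> \<alpha> i"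
  shows "psize \<mu> \<le> psize \<alpha>"
proof -
  obtain L where L: "\<And>i. i \<ge> L \<Longrightarrow> \<alpha> i = 0" using assms(1) by (auto simp: is_part_def)
  then have "\<mu> i = 0" if "i \<ge> L" for i using assms(2)[of i] that by simp
  then show ?thesis using psize_eq[OF L] psize_eq[of L \<mu>] sum_mono[of "{..<L}" \<mu> \<alpha>] assms(2) by simp
qed

lemma is_part_zero [simp]: "is_part (\<lambda>_. 0)"
  by (rule is_partI) auto

lemma psize_eq_0_iff:
  assumes "is_part \<alpha>"
  shows "psize \<alpha> = 0 \<longleftrightarrow> \<alpha> = (\<lambda>_. 0)"
proof -
  obtain L where L: "\<And>i. i \<ge> L \<Longrightarrow> \<alpha> i = 0" using assms by (auto simp: is_part_def)
  have "(\<Sum>i<L. \<alpha> i) = 0 \<Longrightarrow> \<alpha> i = 0" for i using L by (cases "i < L") auto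
  then show ?thesis using psize_eq[OF L] by auto
qed

lemma is_part_bounds:
  assumes "is_part \<alpha>"
  shows "\<alpha> i \<le> psize \<alpha>" "psize \<alpha> \<le> i \<Longrightarrow> \<alpha> i = 0"
proof -
  obtain L where L: "\<And>i. i \<ge> L \<Longrightarrow> \<alpha> i = 0" using assms by (auto simp: is_part_def)
  note ps = psize_eq[OF L]
  show "\<alpha> i \<le> psize \<alpha>"
  proof (cases "i < L")
    case True
    then show ?thesis using member_le_sum[of i "{..<L}" \<alpha>] ps by simp
  qed (use L in simp)
  show "\<alpha> i = 0" if "psize \<alpha> \<le> i"
  proof (rule ccontr)
    assume nz: "\<alpha> i \<noteq> 0"
    then have "i < L" using L by (meson not_less)
    have "1 \<le> \<alpha> j" if "j \<le> i" for j
    proof -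
      have "\<alpha> i \<le> \<alpha> j" using assms that unfolding is_part_def antimono_def by blast
      then show ?thesis using nz by simp
    qed
    then have "(\<Sum>j<Suc i. 1) \<le> (\<Sum>j<Suc i. \<alpha> j)" by (intro sum_mono) auto
    also have "\<dots> \<le> (\<Sum>j<L. \<alpha> j)" using \<open>i < L\<close> by (intro sum_mono2) auto
    finally show False using ps that by simp
  qed
qed

definition Par :: "nat \<Rightarrow> (nat \<Rightarrow> nat) set" where
  "Par n = {\<alpha>. is_part \<alpha> \<and> psize \<alpha> = n}"

lemma finite_Par [simp]: "finite (Par n)"
proof (rule finite_subset)
  show "Par n \<subseteq> {f. \<forall>x. (x \<in> {..<n} \<longrightarrow> f x \<in> {..n}) \<and> (x \<notin> {..<n} \<longrightarrow> f x = 0)}"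
    using is_part_bounds by (auto simp: Par_def)
qed (rule finite_set_of_finite_funs; simp)

lemma finite_Par_subset: "(\<And>\<alpha>. P \<alpha> \<Longrightarrow> is_part \<alpha> \<and> psize \<alpha> \<le> n) \<Longrightarrow> finite {\<alpha>. P \<alpha>}"
  by (rule finite_subset[where B = "\<Union>m\<le>n. Par m"]) (force simp: Par_def, simp)

text \<open>Summed over all rows, a maximum plus a minimum is \<open>\<alpha> i + \<mu> i\<close>.
  The toggles use every minimum but skip the maximum in row 0, which accounts for the correction by
  \<open>\<nu> 0\<close>.\<close>

lemma toggle_size:
  fixes \<alpha> \<mu> \<nu> \<kappa> :: "nat \<Rightarrow> nat"
  assumes "is_part \<alpha>" "is_part \<mu>" "is_part \<nu>" "is_part \<kappa>"
    and toggle: "\<And>i. \<kappa> i + \<nu> (Suc i) = max (\<alpha> (Suc i)) (\<mu> (Suc i)) + min (\<alpha> i) (\<mu> i)"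
  shows "psize \<kappa> + psize \<nu> + max (\<alpha> 0) (\<mu> 0) = psize \<alpha> + psize \<mu> + \<nu> 0"
proof -
  obtain L1 where L1: "\<And>i. i \<ge> L1 \<Longrightarrow> \<alpha> i = 0" "\<And>i. i \<ge> L1 \<Longrightarrow> \<mu> i = 0" using is_part_bound2[OF assms(1,2)] by blast
  obtain L2 where L2: "\<And>i. i \<ge> L2 \<Longrightarrow> \<nu> i = 0" "\<And>i. i \<ge> L2 \<Longrightarrow> \<kappa> i = 0" using is_part_bound2[OF assms(3,4)] by blast
  define L where "L = max L1 L2"
  have L: "\<alpha> i = 0" "\<mu> i = 0" "\<nu> i = 0" "\<kappa> i = 0" if "i \<ge> L" for i using that L1 L2 by (auto simp: L_def)
  let ?m = "\<lambda>i. max (\<alpha> i) (\<mu> i)"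
  have "psize \<kappa> + psize \<nu> = (\<Sum>i<L. \<kappa> i) + (\<Sum>i<Suc L. \<nu> i)"
    using L psize_eq[of L \<kappa>] psize_eq[of "Suc L" \<nu>] by simp
  also have "\<dots> = (\<Sum>i<L. \<kappa> i + \<nu> (Suc i)) + \<nu> 0"
    by (simp only: sum.lessThan_Suc_shift sum.distrib)
  also have "\<dots> = (\<Sum>i<L. ?m (Suc i)) + (\<Sum>i<L. min (\<alpha> i) (\<mu> i)) + \<nu> 0"
    by (simp only: toggle sum.distrib)
  finally have "psize \<kappa> + psize \<nu> + ?m 0 = (?m 0 + (\<Sum>i<L. ?m (Suc i))) + (\<Sum>i<L. min (\<alpha> i) (\<mu> i)) + \<nu> 0"
    by simp
  also have "?m 0 + (\<Sum>i<L. ?m (Suc i)) = (\<Sum>i<L. ?m i)"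
    using sum.lessThan_Suc_shift[of ?m L] L[of L] by simp
  also have "(\<Sum>i<L. ?m i) + (\<Sum>i<L. min (\<alpha> i) (\<mu> i)) = (\<Sum>i<L. \<alpha> i) + (\<Sum>i<L. \<mu> i)"
    unfolding sum.distrib[symmetric] by (intro sum.cong refl) auto
  finally show ?thesis using L psize_eq[of L \<alpha>] psize_eq[of L \<mu>] by simp
qed

text \<open>
  Given \<open>\<alpha>\<close> and \<open>\<mu>\<close>, the parts \<open>\<nu>\<^bsub>i+1\<^esub>\<close> and \<open>\<kappa>\<^sub>i\<close> range over the same interval from
  \<open>max \<alpha>\<^bsub>i+1\<^esub> \<mu>\<^bsub>i+1\<^esub>\<close> to \<open>min \<alpha>\<^sub>i \<mu>\<^sub>i\<close>; the bijection reflects this interval and records the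
  excess of \<open>\<nu>\<^sub>0\<close> as \<open>k\<close>.
\<close>

lemma local_rule_hstrip:
  assumes \<alpha>: "is_part \<alpha>" and \<mu>: "is_part \<mu>" and ab: "psize \<mu> + b = psize \<alpha> + a"
  shows "card {\<nu>. is_part \<nu> \<and> hstrip \<alpha> \<nu> \<and> hstrip \<mu> \<nu> \<and> psize \<nu> = psize \<alpha> + a} =
    (\<Sum>k\<le>min a b. card {\<kappa>. is_part \<kappa> \<and> hstrip \<kappa> \<alpha> \<and> hstrip \<kappa> \<mu> \<and> psize \<kappa> + b = psize \<alpha> + k})"
proof -
  let ?S = "{\<nu>. is_part \<nu> \<and> hstrip \<alpha> \<nu> \<and> hstrip \<mu> \<nu> \<and> psize \<nu> = psize \<alpha> + a}"
  let ?T = "\<lambda>k. {\<kappa>. is_part \<kappa> \<and> hstrip \<kappa> \<alpha> \<and> hstrip \<kappa> \<mu> \<and> psize \<kappa> + b = psize \<alpha> + k}"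
  define mx where "mx i = max (\<alpha> i) (\<mu> i)" for i
  define mn where "mn i = min (\<alpha> i) (\<mu> i)" for i
  define up where "up \<nu> = (\<nu> 0 - mx 0, \<lambda>i. mx (Suc i) + mn i - \<nu> (Suc i))" for \<nu> :: "nat \<Rightarrow> nat"
  define dn where "dn k \<kappa> i = (case i of 0 \<Rightarrow> mx 0 + k | Suc j \<Rightarrow> mx (Suc j) + mn j - \<kappa> j)"
    for k :: nat and \<kappa> :: "nat \<Rightarrow> nat" and i :: nat
  have mn_mx: "mn i \<le> mx i" for i by (auto simp: mn_def mx_def)
  obtain L where L: "\<And>i. i \<ge> L \<Longrightarrow> \<alpha> i = 0" "\<And>i. i \<ge> L \<Longrightarrow> \<mu> i = 0" using is_part_bound2[OF \<alpha> \<mu>] by blast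
  have mn_L: "mn i = 0" if "i \<ge> L" for i using L that by (simp add: mn_def)
  have S: "mx i \<le> \<nu> i" "\<nu> (Suc i) \<le> mn i" if "\<nu> \<in> ?S" for \<nu> i
    using that by (auto simp: hstrip_def mx_def mn_def)
  have T: "mx (Suc i) \<le> \<kappa> i" "\<kappa> i \<le> mn i" if "\<kappa> \<in> ?T k" for \<kappa> i k
    using that by (auto simp: hstrip_def mx_def mn_def)
  have up_mem: "up \<nu> \<in> Sigma {..min a b} ?T" if \<nu>: "\<nu> \<in> ?S" for \<nu>
  proof -
    define \<kappa> where "\<kappa> i = mx (Suc i) + mn i - \<nu> (Suc i)" for i
    have tog: "\<kappa> i + \<nu> (Suc i) = mx (Suc i) + mn i" for i using S[OF \<nu>, of i] by (simp add: \<kappa>_def)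
    have \<kappa>: "mx (Suc i) \<le> \<kappa> i" "\<kappa> i \<le> mn i" for i
      using S(1)[OF \<nu>, of "Suc i"] S(2)[OF \<nu>, of i] by (simp_all add: \<kappa>_def)
    have part: "is_part \<kappa>"
    proof (rule is_partI[of _ L])
      show "\<kappa> (Suc i) \<le> \<kappa> i" for i using \<kappa>(1)[of i] \<kappa>(2)[of "Suc i"] mn_mx[of "Suc i"] by linarith
      show "\<kappa> i = 0" if "i \<ge> L" for i using \<kappa>(2)[of i] mn_L[OF that] by simp
    qed
    have strip: "hstrip \<kappa> \<alpha>" "hstrip \<kappa> \<mu>"
      using \<kappa> by (simp_all add: hstrip_def mx_def mn_def)
    have "psize \<kappa> + psize \<nu> + mx 0 = psize \<alpha> + psize \<mu> + \<nu> 0"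
      unfolding mx_def using \<nu> part tog by (intro toggle_size \<alpha> \<mu>) (auto simp: mx_def mn_def)
    moreover have "psize \<nu> = psize \<alpha> + a" "mx 0 \<le> \<nu> 0" using \<nu> S(1)[OF \<nu>] by auto
    ultimately have size: "psize \<kappa> + b = psize \<alpha> + (\<nu> 0 - mx 0)" "psize \<kappa> + a = psize \<mu> + (\<nu> 0 - mx 0)"
      using ab by linarith+
    \<comment> \<open>\<open>\<kappa>\<close> lies inside both \<open>\<alpha>\<close> and
      \<open>\<mu>\<close>, which bounds the excess by \<open>b\<close> and by \<open>a\<close>
      respectively.\<close>
    moreover have "psize \<kappa> \<le> psize \<alpha>" "psize \<kappa> \<le> psize \<mu>"
      using strip by (auto intro: psize_mono \<alpha> \<mu> simp: hstrip_def)
    ultimately have "\<nu> 0 - mx 0 \<le> min a b" by linarith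
    then show ?thesis using part strip size unfolding up_def \<kappa>_def[symmetric] by auto
  qed
  have dn_mem: "dn k \<kappa> \<in> ?S" if \<kappa>: "\<kappa> \<in> ?T k" for k \<kappa>
  proof -
    have tog: "\<kappa> i + dn k \<kappa> (Suc i) = mx (Suc i) + mn i" for i using T[OF \<kappa>, of i] by (simp add: dn_def)
    have nu: "mx i \<le> dn k \<kappa> i" "dn k \<kappa> (Suc i) \<le> mn i" for i
      using T[OF \<kappa>, of i] T[OF \<kappa>, of "i - 1"] by (auto simp: dn_def split: nat.split)
    have part: "is_part (dn k \<kappa>)"
    proof (rule is_partI[of _ "Suc L"])
      show "dn k \<kappa> (Suc i) \<le> dn k \<kappa> i" for i using nu[of i] mn_mx[of i] by linarith
      show "dn k \<kappa> i = 0" if "i \<ge> Suc L" for i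
        using nu(2)[of "i - 1"] mn_L[of "i - 1"] that by simp
    qed
    have "psize \<kappa> + psize (dn k \<kappa>) + mx 0 = psize \<alpha> + psize \<mu> + dn k \<kappa> 0"
      unfolding mx_def using \<kappa> part tog by (intro toggle_size \<alpha> \<mu>) (auto simp: mx_def mn_def)
    moreover have "psize \<kappa> + b = psize \<alpha> + k" using \<kappa> by simp
    ultimately have "psize (dn k \<kappa>) = psize \<alpha> + a" using ab by (simp add: dn_def)
    then show ?thesis using part nu by (simp add: hstrip_def mx_def mn_def)
  qed
  have "bij_betw up ?S (Sigma {..min a b} ?T)"
  proof (rule bij_betw_byWitness[where f' = "\<lambda>(k, \<kappa>). dn k \<kappa>"])
    show "\<forall>\<nu>\<in>?S. (case up \<nu> of (k, \<kappa>) \<Rightarrow> dn k \<kappa>) = \<nu>"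
    proof
      fix \<nu> assume \<nu>: "\<nu> \<in> ?S"
      have "dn (\<nu> 0 - mx 0) (\<lambda>i. mx (Suc i) + mn i - \<nu> (Suc i)) i = \<nu> i" for i
      proof (cases i)
        case 0
        then show ?thesis using S(1)[OF \<nu>, of 0] by (simp add: dn_def)
      next
        case (Suc j)
        then show ?thesis using S(2)[OF \<nu>, of j] by (simp add: dn_def)
      qed
      then have "dn (\<nu> 0 - mx 0) (\<lambda>i. mx (Suc i) + mn i - \<nu> (Suc i)) = \<nu>" by (rule ext)
      then show "(case up \<nu> of (k, \<kappa>) \<Rightarrow> dn k \<kappa>) = \<nu>" by (simp add: up_def)
    qed
    show "\<forall>x\<in>Sigma {..min a b} ?T. up (case x of (k, \<kappa>) \<Rightarrow> dn k \<kappa>) = x"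
    proof (rule ballI)
      fix x assume "x \<in> Sigma {..min a b} ?T"
      then obtain k \<kappa> where x: "x = (k, \<kappa>)" "\<kappa> \<in> ?T k" by blast
      have "mx (Suc i) + mn i - (mx (Suc i) + mn i - \<kappa> i) = \<kappa> i" for i
        using T(2)[OF x(2), of i] by simp
      then show "up (case x of (k, \<kappa>) \<Rightarrow> dn k \<kappa>) = x" by (simp add: x(1) up_def dn_def)
    qed
    show "up ` ?S \<subseteq> Sigma {..min a b} ?T" using up_mem by (rule image_subsetI)
    show "(\<lambda>(k, \<kappa>). dn k \<kappa>) ` Sigma {..min a b} ?T \<subseteq> ?S"
    proof (rule image_subsetI)
      fix x assume "x \<in> Sigma {..min a b} ?T"
      then obtain k \<kappa> where x: "x = (k, \<kappa>)" "\<kappa> \<in> ?T k" by blast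
      then show "(case x of (k, \<kappa>) \<Rightarrow> dn k \<kappa>) \<in> ?S" using dn_mem[OF x(2)] by (simp only: prod.case)
    qed
  qed
  then have "card ?S = card (Sigma {..min a b} ?T)" by (rule bij_betw_same_card)
  also have "\<dots> = (\<Sum>k\<le>min a b. card (?T k))"
  proof (rule card_SigmaI)
    show "\<forall>k\<in>{..min a b}. finite (?T k)"
      using psize_mono[OF \<alpha>] by (intro ballI finite_Par_subset[of _ "psize \<alpha>"]) (auto simp: hstrip_def)
  qed simp
  finally show ?thesis .
qed

text \<open>
  Here the rows in which \<open>\<nu>\<close> may exceed \<open>max \<alpha> \<mu>\<close> form a set \<open>A\<close>, and those in which \<open>\<kappa>\<close> may
  fall below \<open>min \<alpha> \<mu>\<close> a set \<open>B\<close>; \<open>A\<close> has one more element than \<open>B\<close> by a telescoping sum, and the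
  rule is Pascal's identity.
\<close>

lemma local_rule_vstrip:
  assumes \<alpha>: "is_part \<alpha>" and \<mu>: "is_part \<mu>" and ab: "psize \<mu> + b = psize \<alpha> + a"
  shows "card {\<nu>. is_part \<nu> \<and> hstrip \<alpha> \<nu> \<and> vstrip \<mu> \<nu> \<and> psize \<nu> = psize \<alpha> + a} =
    (\<Sum>k\<in>{0, 1} \<inter> {..min a b}. card {\<kappa>. is_part \<kappa> \<and> vstrip \<kappa> \<alpha> \<and> hstrip \<kappa> \<mu> \<and> psize \<kappa> + b = psize \<alpha> + k})"
proof -
  let ?S = "{\<nu>. is_part \<nu> \<and> hstrip \<alpha> \<nu> \<and> vstrip \<mu> \<nu> \<and> psize \<nu> = psize \<alpha> + a}"
  let ?T = "\<lambda>k. {\<kappa>. is_part \<kappa> \<and> vstrip \<kappa> \<alpha> \<and> hstrip \<kappa> \<mu> \<and> psize \<kappa> + b = psize \<alpha> + k}"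
  have bound: "k \<le> min a b" if "\<kappa> \<in> ?T k" for k \<kappa>
  proof -
    have "psize \<kappa> \<le> psize \<alpha>" "psize \<kappa> \<le> psize \<mu>"
      using that by (auto intro: psize_mono \<alpha> \<mu> simp: hstrip_def vstrip_def)
    moreover have "psize \<kappa> + b = psize \<alpha> + k" using that by simp
    ultimately show ?thesis using ab by linarith
  qed
  have "(\<Sum>k\<in>{0, 1} \<inter> {..min a b}. card (?T k)) = (\<Sum>k\<in>{0, 1}. card (?T k))"
  proof (rule sum.mono_neutral_left)
    show "\<forall>k\<in>{0, 1} - {0, 1} \<inter> {..min a b}. card (?T k) = 0"
    proof
      fix k assume "k \<in> {0, 1} - {0, 1} \<inter> {..min a b}"
      then have "\<not> k \<le> min a b" by simp
      then have "?T k = {}" using bound by blast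
      then show "card (?T k) = 0" by (simp only: card.empty)
    qed
  qed auto
  also have "\<dots> = card (?T 0) + card (?T 1)" by simp
  also have "\<dots> = card ?S"
  \<comment> \<open>The existence of either a \<open>\<nu>\<close> or a \<open>\<kappa>\<close>
    forces these inequalities, so both sides are 0 when they fail.\<close>
  proof (cases "\<forall>i. \<alpha> i \<le> Suc (\<mu> i) \<and> \<mu> (Suc i) \<le> \<alpha> i")
    case False
    have "\<alpha> i \<le> Suc (\<mu> i) \<and> \<mu> (Suc i) \<le> \<alpha> i" if "\<nu> \<in> ?S" for \<nu> i
    proof -
      have "\<alpha> i \<le> \<nu> i" "\<nu> i \<le> Suc (\<mu> i)" "\<mu> (Suc i) \<le> \<nu> (Suc i)" "\<nu> (Suc i) \<le> \<alpha> i"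
        using that by (auto simp: hstrip_def vstrip_def)
      then show ?thesis by linarith
    qed
    then have S: "?S = {}" using False by blast
    have "\<alpha> i \<le> Suc (\<mu> i) \<and> \<mu> (Suc i) \<le> \<alpha> i" if "\<kappa> \<in> ?T k" for k \<kappa> i
    proof -
      have "\<alpha> i \<le> Suc (\<kappa> i)" "\<kappa> i \<le> \<mu> i" "\<mu> (Suc i) \<le> \<kappa> i" "\<kappa> i \<le> \<alpha> i"
        using that by (auto simp: hstrip_def vstrip_def)
      then show ?thesis by linarith
    qed
    then have "?T k = {}" for k using False by blast
    then show ?thesis unfolding S by (simp only: card.empty)
  next
    case True
    then have pre: "\<alpha> i \<le> Suc (\<mu> i)" "\<mu> (Suc i) \<le> \<alpha> i" for i by auto
    define mx where "mx i = max (\<alpha> i) (\<mu> i)" for i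
    define mn where "mn i = min (\<alpha> i) (\<mu> i)" for i
    \<comment> \<open>\<open>g i\<close> says that a row \<open>i\<close> of length
      \<open>\<mu> i\<close> can take one more cell without exceeding row \<open>i - 1\<close> of
      \<open>\<alpha>\<close>. Read at \<open>Suc i\<close>, the same condition says that row
      \<open>i\<close> of \<open>\<alpha>\<close> can lose a cell and still cover row
      \<open>Suc i\<close> of \<open>\<mu>\<close>.\<close>
    define g where "g i \<longleftrightarrow> i = 0 \<or> \<mu> i < \<alpha> (i - 1)" for i
    define A where "A = {i. \<alpha> i \<le> \<mu> i \<and> g i}"
    define B where "B = {i. \<alpha> i \<le> \<mu> i \<and> g (Suc i)}"
    obtain L where L: "\<And>i. i \<ge> L \<Longrightarrow> \<alpha> i = 0" "\<And>i. i \<ge> L \<Longrightarrow> \<mu> i = 0" using is_part_bound2[OF \<alpha> \<mu>] by blast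
    have AB: "A \<subseteq> {..<Suc L}" "B \<subseteq> {..<Suc L}"
      using L by (auto simp: A_def B_def g_def not_less intro!: leI)
        (metis One_nat_def Suc_le_lessD diff_Suc_1 less_nat_zero_code less_or_eq_imp_le not_less_eq Suc_le_D not_less)+
    then have fin: "finite A" "finite B" using finite_subset by blast+
    have sum_X: "(\<Sum>i<Suc L. of_bool (i \<in> X)) = card X" if "X \<subseteq> {..<Suc L}" for X
    proof -
      have "(\<Sum>i<Suc L. of_bool (i \<in> X)) = (\<Sum>i\<in>X. 1 :: nat)"
        using that by (intro sum.mono_neutral_cong_right) auto
      then show ?thesis by simp
    qed
    have sum_X_int: "int (card X) = (\<Sum>i<Suc L. of_bool (i \<in> X))" if "X \<subseteq> {..<Suc L}" for X
      unfolding sum_X[OF that, symmetric] of_nat_sum of_nat_of_bool ..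
    have "int (card A) - int (card B) = (\<Sum>i<Suc L. of_bool (i \<in> A) - of_bool (i \<in> B))"
      by (simp only: sum_X_int AB sum_subtractf)
    also have "\<dots> = (\<Sum>i<Suc L. of_bool (g i) - of_bool (g (Suc i)))"
    proof (rule sum.cong[OF refl])
      fix i
      \<comment> \<open>A row with \<open>\<mu> i < \<alpha> i\<close> belongs to neither set and
        satisfies \<open>g\<close> at both ends, so the summand has the telescoping form in every
        row.\<close>
      have "g i \<and> g (Suc i)" if "\<mu> i < \<alpha> i"
        using that is_part_Suc[OF \<alpha>, of "i - 1"] is_part_Suc[OF \<mu>, of i] by (cases i) (auto simp: g_def)
      then show "of_bool (i \<in> A) - of_bool (i \<in> B) = (of_bool (g i) - of_bool (g (Suc i)) :: int)"
        by (cases "\<mu> i < \<alpha> i") (auto simp: A_def B_def)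
    qed
    also have "\<dots> = of_bool (g 0) - of_bool (g (Suc L))" by (rule sum_lessThan_telescope')
    \<comment> \<open>\<open>g 0\<close> holds by convention, while \<open>g\<close> fails beyond
      the support of both partitions.\<close>
    also have "\<dots> = 1" using L by (simp add: g_def)
    finally have cardA: "card A = Suc (card B)" by simp
    have mxmn: "psize mx + psize mn = psize \<alpha> + psize \<mu>"
    proof -
      have "psize mx + psize mn = (\<Sum>i<L. mx i) + (\<Sum>i<L. mn i)"
        using L by (simp add: psize_eq[of L] mx_def mn_def)
      also have "\<dots> = (\<Sum>i<L. \<alpha> i) + (\<Sum>i<L. \<mu> i)"
        unfolding sum.distrib[symmetric] by (intro sum.cong refl) (auto simp: mx_def mn_def)
      finally show ?thesis using L by (simp add: psize_eq[of L])
    qed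
    define up where "up X i = mx i + of_bool (i \<in> X)" for X and i :: nat
    define dn where "dn X i = mn i - of_bool (i \<in> X)" for X and i :: nat
    have up_part: "is_part (up X)" and up_size: "psize (up X) = psize mx + card X"
      and up_strip: "hstrip \<alpha> (up X)" "vstrip \<mu> (up X)" if X: "X \<subseteq> A" for X
    proof -
      have X': "\<alpha> i \<le> \<mu> i \<and> g i" if "i \<in> X" for i using that X by (auto simp: A_def)
      have gt: "up X (Suc i) \<le> \<alpha> i" for i
        using pre(2)[of i] is_part_Suc[OF \<alpha>, of i] X'[of "Suc i"] by (auto simp: up_def mx_def g_def)
      have le: "\<alpha> i \<le> up X i" "\<mu> i \<le> up X i" for i by (auto simp: up_def mx_def)
      have zero: "up X i = 0" if "i \<ge> Suc L" for i
        using gt[of "i - 1"] L(1)[of "i - 1"] that by simp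
      show "is_part (up X)"
        using gt le zero by (intro is_partI[of _ "Suc L"]) (auto intro: order_trans)
      have "up X i \<le> Suc (\<mu> i)" for i
        using pre(1)[of i] X'[of i] by (auto simp: up_def mx_def)
      then show "hstrip \<alpha> (up X)" "vstrip \<mu> (up X)" using gt le by (auto simp: hstrip_def vstrip_def)
      have "psize (up X) = (\<Sum>i<Suc L. up X i)" using zero by (rule psize_eq)
      also have "\<dots> = (\<Sum>i<Suc L. mx i) + (\<Sum>i<Suc L. of_bool (i \<in> X))"
        by (simp only: up_def sum.distrib)
      also have "(\<Sum>i<Suc L. mx i) = psize mx" using L by (intro psize_eq[symmetric]) (simp add: mx_def)
      also have "X \<subseteq> {..<Suc L}" using X AB by blast
      note sum_X[OF this]
      finally show "psize (up X) = psize mx + card X" .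
    qed
    have dn_part: "is_part (dn X)" and dn_size: "psize (dn X) + card X = psize mn"
      and dn_strip: "vstrip (dn X) \<alpha>" "hstrip (dn X) \<mu>" if X: "X \<subseteq> B" for X
    proof -
      have X': "\<alpha> i \<le> \<mu> i \<and> \<mu> (Suc i) < \<alpha> i" if "i \<in> X" for i using that X by (auto simp: B_def g_def)
      have ge: "\<mu> (Suc i) \<le> dn X i" for i
        using pre(2)[of i] is_part_Suc[OF \<mu>, of i] X'[of i] by (auto simp: dn_def mn_def)
      have le: "dn X i \<le> \<alpha> i" "dn X i \<le> \<mu> i" for i by (auto simp: dn_def mn_def)
      have zero: "dn X i = 0" if "i \<ge> Suc L" for i using le(1)[of i] L(1)[of i] that by simp
      show "is_part (dn X)"
        using ge le zero by (intro is_partI[of _ "Suc L"]) (auto intro: order_trans)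
      have "\<alpha> i \<le> Suc (dn X i)" for i
        using pre(1)[of i] X'[of i] by (auto simp: dn_def mn_def)
      then show "vstrip (dn X) \<alpha>" "hstrip (dn X) \<mu>" using ge le by (auto simp: hstrip_def vstrip_def)
      have eq: "dn X i + of_bool (i \<in> X) = mn i" for i using X'[of i] by (auto simp: dn_def mn_def)
      have "psize (dn X) = (\<Sum>i<Suc L. dn X i)" using zero by (rule psize_eq)
      moreover have "X \<subseteq> {..<Suc L}" using X AB by blast
      ultimately have "psize (dn X) + card X = (\<Sum>i<Suc L. dn X i) + (\<Sum>i<Suc L. of_bool (i \<in> X))"
        by (simp only: sum_X)
      also have "\<dots> = (\<Sum>i<Suc L. mn i)" by (simp only: eq flip: sum.distrib)
      also have "\<dots> = psize mn" using L by (intro psize_eq[symmetric]) (simp add: mn_def)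
      finally show "psize (dn X) + card X = psize mn" .
    qed
    have S: "?S = up ` {X. X \<subseteq> A \<and> psize mx + card X = psize \<alpha> + a}"
    proof (intro equalityI subsetI)
      fix \<nu> assume \<nu>: "\<nu> \<in> ?S"
      let ?X = "{i. mx i < \<nu> i}"
      have n: "\<alpha> i \<le> \<nu> i" "\<nu> (Suc i) \<le> \<alpha> i" "\<mu> i \<le> \<nu> i" "\<nu> i \<le> Suc (\<mu> i)" for i
        using \<nu> by (auto simp: hstrip_def vstrip_def)
      have X: "?X \<subseteq> A"
      proof
        fix i assume "i \<in> ?X"
        then have "\<alpha> i < \<nu> i" "\<mu> i < \<nu> i" by (auto simp: mx_def)
        then show "i \<in> A" using n[of i] n(2)[of "i - 1"] by (cases i) (auto simp: A_def g_def)
      qed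
      have "\<nu> i = up ?X i" for i using n[of i] by (auto simp: up_def mx_def)
      then have eq: "\<nu> = up ?X" by (rule ext)
      have "psize (up ?X) = psize \<alpha> + a" using \<nu> eq by simp
      then have "psize mx + card ?X = psize \<alpha> + a" using up_size[OF X] by simp
      then show "\<nu> \<in> up ` {X. X \<subseteq> A \<and> psize mx + card X = psize \<alpha> + a}" using X eq by blast
    next
      fix \<nu> assume "\<nu> \<in> up ` {X. X \<subseteq> A \<and> psize mx + card X = psize \<alpha> + a}"
      then obtain X where "\<nu> = up X" "X \<subseteq> A" "psize mx + card X = psize \<alpha> + a" by blast
      then show "\<nu> \<in> ?S" using up_part up_size up_strip by simp
    qed
    have T: "?T k = dn ` {X. X \<subseteq> B \<and> psize mx + card X + k = psize \<alpha> + a}" for k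
    proof (intro equalityI subsetI)
      fix \<kappa> assume \<kappa>: "\<kappa> \<in> ?T k"
      let ?X = "{i. \<kappa> i < mn i}"
      have n: "\<kappa> i \<le> \<alpha> i" "\<alpha> i \<le> Suc (\<kappa> i)" "\<kappa> i \<le> \<mu> i" "\<mu> (Suc i) \<le> \<kappa> i" for i
        using \<kappa> by (auto simp: hstrip_def vstrip_def)
      have X: "?X \<subseteq> B"
      proof
        fix i assume "i \<in> ?X"
        then have "\<kappa> i < \<alpha> i" "\<kappa> i < \<mu> i" by (auto simp: mn_def)
        then show "i \<in> B" using n[of i] by (auto simp: B_def g_def)
      qed
      have "\<kappa> i = dn ?X i" for i using n[of i] by (auto simp: dn_def mn_def)
      then have eq: "\<kappa> = dn ?X" by (rule ext)
      have "psize (dn ?X) + b = psize \<alpha> + k" using \<kappa> eq by simp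
      then have "psize mx + card ?X + k = psize \<alpha> + a" using dn_size[OF X] mxmn ab by linarith
      then show "\<kappa> \<in> dn ` {X. X \<subseteq> B \<and> psize mx + card X + k = psize \<alpha> + a}" using X eq by blast
    next
      fix \<kappa> assume "\<kappa> \<in> dn ` {X. X \<subseteq> B \<and> psize mx + card X + k = psize \<alpha> + a}"
      then obtain X where X: "\<kappa> = dn X" "X \<subseteq> B" "psize mx + card X + k = psize \<alpha> + a" by blast
      then have "psize \<kappa> + b = psize \<alpha> + k" using dn_size[OF X(2)] mxmn ab by simp
      then show "\<kappa> \<in> ?T k" using X(1) dn_part[OF X(2)] dn_strip[OF X(2)] by simp
    qed
    have inj_up: "inj_on up {X. X \<subseteq> A \<and> psize mx + card X = psize \<alpha> + a}"
    proof (rule inj_onI)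
      fix X Y assume eq: "up X = up Y"
      have iff: "i \<in> X \<longleftrightarrow> up X i \<noteq> mx i" for X i by (simp add: up_def)
      have "i \<in> X \<longleftrightarrow> i \<in> Y" for i unfolding iff eq ..
      then show "X = Y" by blast
    qed
    have inj_dn: "inj_on dn {X. X \<subseteq> B \<and> psize mx + card X + k = psize \<alpha> + a}" for k
    proof (rule inj_onI)
      fix X Y assume X: "X \<in> {X. X \<subseteq> B \<and> psize mx + card X + k = psize \<alpha> + a}"
        and Y: "Y \<in> {X. X \<subseteq> B \<and> psize mx + card X + k = psize \<alpha> + a}" and eq: "dn X = dn Y"
      have iff: "i \<in> Z \<longleftrightarrow> dn Z i \<noteq> mn i" if "Z \<subseteq> B" for Z i
        using that by (auto simp: dn_def mn_def B_def g_def)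
      have XY: "X \<subseteq> B" "Y \<subseteq> B" using X Y by simp_all
      have "i \<in> X \<longleftrightarrow> i \<in> Y" for i unfolding iff[OF XY(1)] iff[OF XY(2)] eq ..
      then show "X = Y" by blast
    qed
    have "card {X. X \<subseteq> A \<and> psize mx + card X = psize \<alpha> + a} =
        card {X. X \<subseteq> B \<and> psize mx + card X + 0 = psize \<alpha> + a} + card {X. X \<subseteq> B \<and> psize mx + card X + 1 = psize \<alpha> + a}"
    proof (cases "psize mx \<le> psize \<alpha> + a")
      case True
      then obtain p where p: "psize \<alpha> + a = psize mx + p" by (metis le_add_diff_inverse)
      show ?thesis
      proof (cases p)
        case 0
        then show ?thesis using fin unfolding p by (simp add: n_subsets cardA)
      next
        case (Suc q)
        then show ?thesis using fin unfolding p by (simp add: n_subsets cardA)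
      qed
    next
      case False
      then have "{X. X \<subseteq> A \<and> psize mx + card X = psize \<alpha> + a} = {}"
        "{X. X \<subseteq> B \<and> psize mx + card X + 0 = psize \<alpha> + a} = {}"
        "{X. X \<subseteq> B \<and> psize mx + card X + 1 = psize \<alpha> + a} = {}" by auto
      then show ?thesis by (simp only: card.empty)
    qed
    then show ?thesis unfolding S T card_image[OF inj_up] card_image[OF inj_dn] by simp
  qed
  finally show ?thesis by simp
qed

section \<open>The Pieri rule and the Cauchy identities\<close>

lemma filter_mset_all: "\<forall>x\<in>#X. P x \<Longrightarrow> filter_mset P X = X"
  by (induction X) auto

lemma filter_mset_none: "\<forall>x\<in>#X. \<not> P x \<Longrightarrow> filter_mset P X = {#}"
  by (induction X) auto

lemma finite_submultisets: "finite {C. C \<subseteq># N \<and> P C}"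
proof (rule finite_subset)
  let ?X = "{xs. set xs \<subseteq> set_mset N \<and> length xs \<le> size N}"
  show "{C. C \<subseteq># N \<and> P C} \<subseteq> mset ` ?X"
  proof
    fix C assume C: "C \<in> {C. C \<subseteq># N \<and> P C}"
    obtain xs where xs: "C = mset xs" using ex_mset by metis
    have "set_mset C \<subseteq> set_mset N" "size C \<le> size N"
      using C by (auto dest: mset_subset_eqD size_mset_mono)
    then show "C \<in> mset ` ?X" using xs by auto
  qed
  show "finite (mset ` ?X)" by (intro finite_imageI finite_lists_length_le) simp
qed

text \<open>
  \<open>K \<nu> N\<close> plays the role of a Kostka number: the number of chains of \<open>R\<close>-strips from the empty
  partition to \<open>\<nu>\<close> with sizes given by the multiplicities in \<open>N\<close>. The set \<open>Ks\<close> restricts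
  the multiplicities of the pairs of letters: it is everything for horizontal strips and
  \<open>{0, 1}\<close> for vertical strips.
\<close>

locale kostka =
  fixes R :: "(nat \<Rightarrow> nat) \<Rightarrow> (nat \<Rightarrow> nat) \<Rightarrow> bool" and Ks :: "nat set"
    and K :: "(nat \<Rightarrow> nat) \<Rightarrow> nat multiset \<Rightarrow> nat"
  assumes zero_Ks: "0 \<in> Ks"
    and local_rule: "is_part \<alpha> \<Longrightarrow> is_part \<mu> \<Longrightarrow> psize \<mu> + b = psize \<alpha> + a \<Longrightarrow>
      card {\<nu>. is_part \<nu> \<and> hstrip \<alpha> \<nu> \<and> R \<mu> \<nu> \<and> psize \<nu> = psize \<alpha> + a} =
      (\<Sum>k\<in>Ks \<inter> {..min a b}. card {\<kappa>. is_part \<kappa> \<and> R \<kappa> \<alpha> \<and> hstrip \<kappa> \<mu> \<and> psize \<kappa> + b = psize \<alpha> + k})"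
    and K_empty: "is_part \<nu> \<Longrightarrow> K \<nu> {#} = (if \<nu> = (\<lambda>_. 0) then 1 else 0)"
    and K_rec: "is_part \<nu> \<Longrightarrow> \<forall>x\<in>#N. x \<le> t \<Longrightarrow> K \<nu> N =
      (\<Sum>\<mu> | is_part \<mu> \<and> R \<mu> \<nu> \<and> psize \<mu> + count N t = psize \<nu>. K \<mu> (filter_mset (\<lambda>x. x < t) N))"
begin

text \<open>Induction on the largest letter: its strip is peeled off the chain for
  \<open>\<nu>\<close>, commuted past the horizontal strip by the local rule, and the Pieri rule for
  the smaller letters is applied to what remains. The parameter \<open>k\<close> of the local rule
  becomes the multiplicity of \<open>t\<close> in \<open>C\<close>.\<close>

lemma pieri:
  assumes "is_part \<alpha>" "\<forall>x\<in>#N. x < t"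
  shows "(\<Sum>\<nu> | is_part \<nu> \<and> hstrip \<alpha> \<nu> \<and> psize \<nu> = psize \<alpha> + a. K \<nu> N) =
    (\<Sum>C | C \<subseteq># N \<and> size C = a \<and> (\<forall>x. count C x \<in> Ks). K \<alpha> (N - C))"
  using assms
proof (induction t arbitrary: N \<alpha> a)
  case 0
  then have N: "N = {#}" by auto
  have fin: "finite {\<nu>. is_part \<nu> \<and> hstrip \<alpha> \<nu> \<and> psize \<nu> = psize \<alpha> + a}"
    by (rule finite_Par_subset[of _ "psize \<alpha> + a"]) auto
  have mem: "(\<lambda>_. 0) \<in> {\<nu>. is_part \<nu> \<and> hstrip \<alpha> \<nu> \<and> psize \<nu> = psize \<alpha> + a} \<longleftrightarrow> \<alpha> = (\<lambda>_. 0) \<and> a = 0"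
    by (auto simp: hstrip_def fun_eq_iff psize_def)
  have "(\<Sum>\<nu> | is_part \<nu> \<and> hstrip \<alpha> \<nu> \<and> psize \<nu> = psize \<alpha> + a. K \<nu> N) =
      (\<Sum>\<nu> | is_part \<nu> \<and> hstrip \<alpha> \<nu> \<and> psize \<nu> = psize \<alpha> + a. if \<nu> = (\<lambda>_. 0) then 1 else 0)"
    unfolding N by (intro sum.cong) (simp_all add: K_empty)
  also have "\<dots> = (if \<alpha> = (\<lambda>_. 0) \<and> a = 0 then 1 else 0)"
    unfolding sum.delta[OF fin] mem ..
  also have "{C. C \<subseteq># N \<and> size C = a \<and> (\<forall>x. count C x \<in> Ks)} = (if a = 0 then {{#}} else {})"
    using zero_Ks by (auto simp: N)
  then have "(\<Sum>C | C \<subseteq># N \<and> size C = a \<and> (\<forall>x. count C x \<in> Ks). K \<alpha> (N - C)) =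
      (if \<alpha> = (\<lambda>_. 0) \<and> a = 0 then 1 else 0)"
    using K_empty[OF 0(1)] by (simp add: N)
  finally show ?case by simp
next
  case (Suc t)
  note \<alpha> = Suc.prems(1)
  define N' where "N' = filter_mset (\<lambda>x. x < t) N"
  define b where "b = count N t"
  have N_le: "\<forall>x\<in>#N. x \<le> t" using Suc.prems(2) by auto
  have N: "N = N' + replicate_mset b t"
    using N_le by (intro multiset_eqI) (auto simp: N'_def b_def not_in_iff[symmetric] order_less_le)
  have N'_lt: "\<forall>x\<in>#N'. x < t" by (simp add: N'_def)
  let ?U = "{\<nu>. is_part \<nu> \<and> hstrip \<alpha> \<nu> \<and> psize \<nu> = psize \<alpha> + a}"
  let ?W = "{\<mu>. is_part \<mu> \<and> psize \<mu> + b = psize \<alpha> + a}"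
  let ?Q = "Ks \<inter> {..min a b}"
  let ?X = "\<lambda>k. {\<kappa>. is_part \<kappa> \<and> R \<kappa> \<alpha> \<and> psize \<kappa> + b = psize \<alpha> + k}"
  let ?C = "{C. C \<subseteq># N \<and> size C = a \<and> (\<forall>x. count C x \<in> Ks)}"
  let ?C' = "\<lambda>k. {C. C \<subseteq># N' \<and> size C = a - k \<and> (\<forall>x. count C x \<in> Ks)}"
  have finU: "finite ?U" by (rule finite_Par_subset[of _ "psize \<alpha> + a"]) auto
  have finW: "finite ?W" by (rule finite_Par_subset[of _ "psize \<alpha> + a"]) auto
  have finX: "finite (?X k)" for k by (rule finite_Par_subset[of _ "psize \<alpha> + k"]) auto
  have "(\<Sum>\<nu>\<in>?U. K \<nu> N) = (\<Sum>\<nu>\<in>?U. \<Sum>\<mu> | \<mu> \<in> ?W \<and> R \<mu> \<nu>. K \<mu> N')"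
  proof (rule sum.cong[OF refl])
    fix \<nu> assume "\<nu> \<in> ?U"
    then have "{\<mu>. is_part \<mu> \<and> R \<mu> \<nu> \<and> psize \<mu> + count N t = psize \<nu>} = {\<mu>. \<mu> \<in> ?W \<and> R \<mu> \<nu>}"
      by (auto simp: b_def)
    then show "K \<nu> N = (\<Sum>\<mu> | \<mu> \<in> ?W \<and> R \<mu> \<nu>. K \<mu> N')"
      using K_rec[OF _ N_le, of \<nu>] \<open>\<nu> \<in> ?U\<close> by (simp add: N'_def)
  qed
  also have "\<dots> = (\<Sum>\<mu>\<in>?W. \<Sum>\<nu> | \<nu> \<in> ?U \<and> R \<mu> \<nu>. K \<mu> N')"
    by (rule sum.swap_restrict[OF finU finW])
  \<comment> \<open>The corner \<open>\<nu>\<close> above \<open>\<alpha>\<close> and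
    \<open>\<mu>\<close> is exchanged for a corner \<open>\<kappa>\<close> below them;
    \<open>k\<close> copies of \<open>t\<close> are set aside for \<open>C\<close>.\<close>
  also have "\<dots> = (\<Sum>\<mu>\<in>?W. \<Sum>k\<in>?Q. \<Sum>\<kappa> | \<kappa> \<in> ?X k \<and> hstrip \<kappa> \<mu>. K \<mu> N')"
  proof (rule sum.cong[OF refl])
    fix \<mu> assume \<mu>: "\<mu> \<in> ?W"
    have "{\<nu>. \<nu> \<in> ?U \<and> R \<mu> \<nu>} = {\<nu>. is_part \<nu> \<and> hstrip \<alpha> \<nu> \<and> R \<mu> \<nu> \<and> psize \<nu> = psize \<alpha> + a}" by auto
    then have "card {\<nu>. \<nu> \<in> ?U \<and> R \<mu> \<nu>} =
        (\<Sum>k\<in>?Q. card {\<kappa>. is_part \<kappa> \<and> R \<kappa> \<alpha> \<and> hstrip \<kappa> \<mu> \<and> psize \<kappa> + b = psize \<alpha> + k})"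
      using local_rule[OF \<alpha>, of \<mu> b a] \<mu> by simp
    also have "\<dots> = (\<Sum>k\<in>?Q. card {\<kappa>. \<kappa> \<in> ?X k \<and> hstrip \<kappa> \<mu>})"
      by (intro sum.cong refl arg_cong[of _ _ card]) auto
    finally show "(\<Sum>\<nu> | \<nu> \<in> ?U \<and> R \<mu> \<nu>. K \<mu> N') = (\<Sum>k\<in>?Q. \<Sum>\<kappa> | \<kappa> \<in> ?X k \<and> hstrip \<kappa> \<mu>. K \<mu> N')"
      by (simp only: sum_constant sum_distrib_right of_nat_id)
  qed
  also have "\<dots> = (\<Sum>k\<in>?Q. \<Sum>\<mu>\<in>?W. \<Sum>\<kappa> | \<kappa> \<in> ?X k \<and> hstrip \<kappa> \<mu>. K \<mu> N')"
    by (rule sum.swap)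
  also have "\<dots> = (\<Sum>k\<in>?Q. \<Sum>\<kappa>\<in>?X k. \<Sum>\<mu> | \<mu> \<in> ?W \<and> hstrip \<kappa> \<mu>. K \<mu> N')"
    by (intro sum.cong refl sum.swap_restrict finW finX)
  also have "\<dots> = (\<Sum>k\<in>?Q. \<Sum>\<kappa>\<in>?X k. \<Sum>C\<in>?C' k. K \<kappa> (N' - C))"
  proof (intro sum.cong refl)
    fix k \<kappa> assume k: "k \<in> ?Q" and \<kappa>: "\<kappa> \<in> ?X k"
    have "{\<mu>. \<mu> \<in> ?W \<and> hstrip \<kappa> \<mu>} = {\<mu>. is_part \<mu> \<and> hstrip \<kappa> \<mu> \<and> psize \<mu> = psize \<kappa> + (a - k)}"
      using k \<kappa> by auto
    then show "(\<Sum>\<mu> | \<mu> \<in> ?W \<and> hstrip \<kappa> \<mu>. K \<mu> N') = (\<Sum>C\<in>?C' k. K \<kappa> (N' - C))"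
      using Suc.IH[of \<kappa> N' "a - k"] \<kappa> N'_lt by simp
  qed
  also have "\<dots> = (\<Sum>k\<in>?Q. \<Sum>C\<in>?C' k. \<Sum>\<kappa>\<in>?X k. K \<kappa> (N' - C))"
    by (intro sum.cong refl sum.swap)
  also have "\<dots> = (\<Sum>k\<in>?Q. \<Sum>C\<in>?C' k. K \<alpha> (N - (C + replicate_mset k t)))"
  proof (intro sum.cong refl)
    fix k C assume k: "k \<in> ?Q" and C: "C \<in> ?C' k"
    have tC: "count C t = 0" using C N'_lt by (metis (no_types, lifting) count_eq_zero_iff less_irrefl mem_Collect_eq mset_subset_eqD)
    have tN': "count N' t = 0" using N'_lt by (meson less_irrefl not_in_iff)
    have eq: "N - (C + replicate_mset k t) = (N' - C) + replicate_mset (b - k) t"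
      using k tC tN' by (intro multiset_eqI) (auto simp: N)
    have "\<forall>x\<in>#N - (C + replicate_mset k t). x \<le> t" using N_le by (meson in_diffD)
    from K_rec[OF \<alpha> this] have "K \<alpha> (N - (C + replicate_mset k t)) =
        (\<Sum>\<mu> | is_part \<mu> \<and> R \<mu> \<alpha> \<and> psize \<mu> + (b - k) = psize \<alpha>.
          K \<mu> (filter_mset (\<lambda>x. x < t) (N - (C + replicate_mset k t))))"
      using tC tN' by (simp add: eq)
    also have "filter_mset (\<lambda>x. x < t) (N - (C + replicate_mset k t)) = N' - C"
    proof -
      have "\<forall>x\<in>#N' - C. x < t" using N'_lt by (meson in_diffD)
      then have "filter_mset (\<lambda>x. x < t) (N' - C) = N' - C" by (rule filter_mset_all)
      moreover have "filter_mset (\<lambda>x. x < t) (replicate_mset (b - k) t) = {#}"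
        by (rule filter_mset_none) simp
      ultimately show ?thesis unfolding eq filter_union_mset by (simp only: add_0_right)
    qed
    also have "{\<mu>. is_part \<mu> \<and> R \<mu> \<alpha> \<and> psize \<mu> + (b - k) = psize \<alpha>} = ?X k" using k by auto
    finally show "(\<Sum>\<kappa>\<in>?X k. K \<kappa> (N' - C)) = K \<alpha> (N - (C + replicate_mset k t))" by simp
  qed
  \<comment> \<open>A submultiset of \<open>N\<close> is the number of its copies of
    \<open>t\<close> together with the submultiset of its smaller letters.\<close>
  also have "\<dots> = (\<Sum>x\<in>Sigma ?Q ?C'. K \<alpha> (N - (snd x + replicate_mset (fst x) t)))"
    by (subst sum.Sigma) (simp_all add: split_def finite_submultisets)
  also have "\<dots> = (\<Sum>C\<in>?C. K \<alpha> (N - C))"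
  proof (rule sum.reindex_bij_witness[where i = "\<lambda>C. (count C t, filter_mset (\<lambda>x. x < t) C)"
        and j = "\<lambda>x. snd x + replicate_mset (fst x) t"])
    fix x assume "x \<in> Sigma ?Q ?C'"
    then obtain k C where x: "x = (k, C)" "k \<in> ?Q" "C \<in> ?C' k" by blast
    have lt: "\<forall>y\<in>#C. y < t" using x(3) N'_lt by (auto dest: mset_subset_eqD)
    then have tC: "count C t = 0" by (meson less_irrefl not_in_iff)
    have f: "filter_mset (\<lambda>y. y < t) C = C" using lt by (rule filter_mset_all)
    show "(count (snd x + replicate_mset (fst x) t) t,
        filter_mset (\<lambda>y. y < t) (snd x + replicate_mset (fst x) t)) = x"
      using tC f by (simp add: x(1))
    have "C + replicate_mset k t \<subseteq># N" unfolding N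
      using x by (intro subset_mset.add_mono) (auto simp: subseteq_mset_def)
    then show "snd x + replicate_mset (fst x) t \<in> ?C"
      using x tC by auto
  next
    fix C assume C: "C \<in> ?C"
    let ?D = "filter_mset (\<lambda>x. x < t) C"
    have le: "\<forall>x\<in>#C. x \<le> t" using C N_le by (auto dest: mset_subset_eqD)
    then show eq: "snd (count C t, ?D) + replicate_mset (fst (count C t, ?D)) t = C"
      by (intro multiset_eqI) (auto simp: not_in_iff[symmetric] order_less_le)
    have "size ?D + count C t = size C" using arg_cong[OF eq, of size] by simp
    then have sz: "size ?D + count C t = a" using C by simp
    have "?D \<subseteq># N'" unfolding N'_def using C by (intro multiset_filter_mono) simp
    moreover have "count C t \<le> b" unfolding b_def using C by (simp add: mset_subset_eq_count)
    moreover have "\<forall>x. count ?D x \<in> Ks" using C zero_Ks by simp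
    ultimately show "(count C t, ?D) \<in> Sigma ?Q ?C'" using sz C by auto
  qed simp
  finally show ?case .
qed

end

text \<open>A multiset of pairs is a matrix of natural numbers whose entries are the multiplicities.
  \<open>M\<close> and \<open>N\<close> record the row and column sums, and \<open>Ks\<close> is the
  set of admissible entries.\<close>

definition margins :: "nat set \<Rightarrow> nat multiset \<Rightarrow> nat multiset \<Rightarrow> (nat \<times> nat) multiset set" where
  "margins Ks M N = {P. image_mset fst P = M \<and> image_mset snd P = N \<and> (\<forall>p. count P p \<in> Ks)}"

lemma finite_margins [simp]: "finite (margins Ks M N)"
proof (rule finite_subset)
  let ?X = "{xs. set xs \<subseteq> set_mset M \<times> set_mset N \<and> length xs = size M}"
  show "margins Ks M N \<subseteq> mset ` ?X"
  proof
    fix P assume P: "P \<in> margins Ks M N"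
    obtain xs where xs: "P = mset xs" using ex_mset by metis
    have "set xs \<subseteq> set_mset M \<times> set_mset N" "length xs = size M"
      using P by (force simp: margins_def xs)+
    then show "P \<in> mset ` ?X" using xs by blast
  qed
  show "finite (mset ` ?X)" by (intro finite_imageI finite_lists_length_eq) simp
qed

lemma count_image_Pair: "count (image_mset (Pair t) C) (x, y) = (if x = t then count C y else 0)"
  by (induction C) auto

text \<open>\<open>C\<close> is the row with index \<open>t\<close> of the matrix: its size is the
  prescribed row sum, and removing it lowers the column sums from \<open>N\<close> to
  \<open>N - C\<close>.\<close>

lemma card_margins_rec:
  assumes "0 \<in> Ks" "\<forall>x\<in>#M. x \<le> t"
  shows "card (margins Ks M N) = (\<Sum>C | C \<subseteq># N \<and> size C = count M t \<and> (\<forall>x. count C x \<in> Ks).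
    card (margins Ks (filter_mset (\<lambda>x. x < t) M) (N - C)))"
proof -
  let ?M = "filter_mset (\<lambda>x. x < t) M"
  let ?C = "{C. C \<subseteq># N \<and> size C = count M t \<and> (\<forall>x. count C x \<in> Ks)}"
  let ?S = "Sigma ?C (\<lambda>C. margins Ks ?M (N - C))"
  have M: "M = ?M + replicate_mset (count M t) t"
    using assms(2) by (intro multiset_eqI) (auto simp: not_in_iff[symmetric] order_less_le)
  define join where "join x = snd x + image_mset (Pair t) (fst x)" for x :: "nat multiset \<times> (nat \<times> nat) multiset"
  define split where "split P = (image_mset snd (filter_mset (\<lambda>p. fst p = t) P), filter_mset (\<lambda>p. fst p < t) P)"
    for P :: "(nat \<times> nat) multiset"
  have lt: "fst p < t" if "P \<in> margins Ks ?M N'" "p \<in># P" for P N' p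
  proof -
    have "image_mset fst P = ?M" using that(1) unfolding margins_def by blast
    moreover have "fst p \<in># image_mset fst P" using that(2) by simp
    ultimately have "fst p \<in># ?M" by (simp only:)
    then show ?thesis by simp
  qed
  have "bij_betw join ?S (margins Ks M N)"
  proof (rule bij_betw_byWitness[where f' = split])
    show "\<forall>x\<in>?S. split (join x) = x"
    proof
      fix x assume "x \<in> ?S"
      then obtain C P where x: "x = (C, P)" "P \<in> margins Ks ?M (N - C)" by blast
      have "filter_mset (\<lambda>p. fst p = t) P = {#}" "filter_mset (\<lambda>p. fst p < t) P = P"
        using lt[OF x(2)] by (intro filter_mset_all filter_mset_none; force)+
      moreover have "filter_mset (\<lambda>p. fst p = t) (image_mset (Pair t) C) = image_mset (Pair t) C"
        "filter_mset (\<lambda>p. fst p < t) (image_mset (Pair t) C) = {#}"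
        by (auto intro!: filter_mset_all filter_mset_none)
      ultimately show "split (join x) = x"
        by (simp add: x(1) split_def join_def multiset.map_comp comp_def)
    qed
    show "\<forall>P\<in>margins Ks M N. join (split P) = P"
    proof
      fix P assume P: "P \<in> margins Ks M N"
      have le: "fst p \<le> t" if "p \<in># P" for p
      proof -
        have "image_mset fst P = M" using P unfolding margins_def by blast
        moreover have "fst p \<in># image_mset fst P" using that by simp
        ultimately have "fst p \<in># M" by (simp only:)
        then show ?thesis using assms(2) by blast
      qed
      have "image_mset (Pair t) (image_mset snd (filter_mset (\<lambda>p. fst p = t) P)) = filter_mset (\<lambda>p. fst p = t) P"
        unfolding multiset.map_comp comp_def by (rule trans[OF image_mset_cong[of _ _ id]]) auto
      moreover have "filter_mset (\<lambda>p. fst p < t) P + filter_mset (\<lambda>p. fst p = t) P = P"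
        using le by (intro multiset_eqI) (auto simp: not_in_iff[symmetric] order_less_le)
      ultimately show "join (split P) = P" by (simp add: join_def split_def)
    qed
    show "join ` ?S \<subseteq> margins Ks M N"
    proof (rule image_subsetI)
      fix x assume "x \<in> ?S"
      then obtain C P where x: "x = (C, P)" "C \<in> ?C" "P \<in> margins Ks ?M (N - C)" by blast
      have "image_mset fst (join x) = M"
        using x(2,3) M by (simp add: x(1) join_def margins_def multiset.map_comp comp_def image_mset_const_eq)
      moreover have "image_mset snd (join x) = N"
        using x(2,3) by (simp add: x(1) join_def margins_def multiset.map_comp comp_def)
      moreover have "count (join x) p \<in> Ks" for p
      proof (cases "fst p = t")
        case True
        then have "count P p = 0" using lt[OF x(3), of p] by (meson count_inI less_irrefl)
        then show ?thesis using True x(2) by (cases p) (simp add: x(1) join_def count_image_Pair)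
      next
        case False
        then show ?thesis using x(3) by (cases p) (simp add: x(1) join_def count_image_Pair margins_def)
      qed
      ultimately show "join x \<in> margins Ks M N" by (simp add: margins_def)
    qed
    show "split ` margins Ks M N \<subseteq> ?S"
    proof (rule image_subsetI)
      fix P assume P: "P \<in> margins Ks M N"
      let ?P = "filter_mset (\<lambda>p. fst p < t) P"
      let ?D = "filter_mset (\<lambda>p. fst p = t) P"
      have fstP: "image_mset fst P = M" and sndP: "image_mset snd P = N" using P by (auto simp: margins_def)
      have le: "fst p \<le> t" if "p \<in># P" for p
      proof -
        have "fst p \<in># image_mset fst P" using that by simp
        then have "fst p \<in># M" unfolding fstP .
        then show ?thesis using assms(2) by blast
      qed
      have dec: "?P + ?D = P"
        using le by (intro multiset_eqI) (auto simp: not_in_iff[symmetric] order_less_le)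
      have "image_mset fst ?D = replicate_mset (size ?D) t"
        by (rule trans[OF image_mset_cong[of _ _ "\<lambda>_. t"]]) (auto simp: image_mset_const_eq)
      moreover have "image_mset fst ?P = ?M"
        unfolding fstP[symmetric] by (simp add: filter_mset_image_mset comp_def)
      moreover have "image_mset fst ?P + image_mset fst ?D = M" using dec fstP by (metis image_mset_union)
      ultimately have "?M + replicate_mset (size ?D) t = M" by simp
      then have "?M + replicate_mset (size ?D) t = ?M + replicate_mset (count M t) t" using M by simp
      then have sz: "size ?D = count M t" by (metis add_left_cancel size_replicate_mset)
      have dec2: "image_mset snd ?P + image_mset snd ?D = N" using dec sndP by (metis image_mset_union)
      have "count (image_mset snd ?D) y \<in> Ks" for y
      proof -
        have "image_mset (Pair t) (image_mset snd ?D) = ?D"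
          unfolding multiset.map_comp comp_def by (rule trans[OF image_mset_cong[of _ _ id]]) auto
        then have "count (image_mset snd ?D) y = count ?D (t, y)" using count_image_Pair[of t "image_mset snd ?D" t y] by simp
        then show ?thesis using P by (simp add: margins_def)
      qed
      moreover have "image_mset snd ?D \<subseteq># N" using dec2 by (metis mset_subset_eq_add_right)
      ultimately have "image_mset snd ?D \<in> ?C" using sz by simp
      moreover have "?P \<in> margins Ks ?M (N - image_mset snd ?D)"
        using \<open>image_mset fst ?P = ?M\<close> dec2[symmetric] P assms(1) by (simp add: margins_def)
      ultimately show "split P \<in> ?S" by (simp add: split_def)
    qed
  qed
  then have "card (margins Ks M N) = card ?S" by (rule bij_betw_same_card[symmetric])
  also have "\<dots> = (\<Sum>C\<in>?C. card (margins Ks ?M (N - C)))"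
    by (rule card_SigmaI) (simp_all add: finite_submultisets)
  finally show ?thesis .
qed

context kostka
begin

text \<open>Both sides obey the same recursion in the largest letter of \<open>M\<close>. On the
  left, the last horizontal strip counted by \<open>H\<close> is passed to the other factor, where
  \<open>pieri\<close> converts it into a submultiset \<open>C\<close> of \<open>N\<close>; on the
  right, \<open>C\<close> is the last row of the matrix.\<close>

lemma cauchy:
  assumes H: "kostka hstrip UNIV H" and "size M = size N" "\<forall>x\<in>#M. x < t"
  shows "(\<Sum>\<alpha>\<in>Par (size M). H \<alpha> M * K \<alpha> N) = card (margins Ks M N)"
  using assms(2,3)
proof (induction t arbitrary: M N)
  case 0
  then have MN: "M = {#}" "N = {#}" by auto
  have P0: "Par 0 = {\<lambda>_. 0}" using psize_eq_0_iff by (auto simp: Par_def)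
  have "margins Ks {#} {#} = {{#}}" using zero_Ks by (auto simp: margins_def)
  then show ?case using kostka.K_empty[OF H is_part_zero] K_empty[OF is_part_zero] by (simp add: MN P0)
next
  case (Suc t)
  define M' where "M' = filter_mset (\<lambda>x. x < t) M"
  have le: "\<forall>x\<in>#M. x \<le> t" using Suc.prems(2) by auto
  have M: "M = M' + replicate_mset (count M t) t"
    unfolding M'_def using le by (intro multiset_eqI) (auto simp: not_in_iff[symmetric] order_less_le)
  then have sz: "size M = size M' + count M t" by (metis size_replicate_mset size_union)
  let ?a = "count M t"
  let ?C = "{C. C \<subseteq># N \<and> size C = ?a \<and> (\<forall>x. count C x \<in> Ks)}"
  have "(\<Sum>\<nu>\<in>Par (size M). H \<nu> M * K \<nu> N) =
      (\<Sum>\<nu>\<in>Par (size M). \<Sum>\<alpha> | \<alpha> \<in> Par (size M') \<and> hstrip \<alpha> \<nu>. H \<alpha> M' * K \<nu> N)"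
  proof (rule sum.cong[OF refl])
    fix \<nu> assume \<nu>: "\<nu> \<in> Par (size M)"
    then have "{\<mu>. is_part \<mu> \<and> hstrip \<mu> \<nu> \<and> psize \<mu> + ?a = psize \<nu>} = {\<alpha>. \<alpha> \<in> Par (size M') \<and> hstrip \<alpha> \<nu>}"
      using sz by (auto simp: Par_def)
    then show "H \<nu> M * K \<nu> N = (\<Sum>\<alpha> | \<alpha> \<in> Par (size M') \<and> hstrip \<alpha> \<nu>. H \<alpha> M' * K \<nu> N)"
      using kostka.K_rec[OF H _ le, of \<nu>] \<nu> by (simp add: M'_def Par_def sum_distrib_right)
  qed
  also have "\<dots> = (\<Sum>\<alpha>\<in>Par (size M'). \<Sum>\<nu> | \<nu> \<in> Par (size M) \<and> hstrip \<alpha> \<nu>. H \<alpha> M' * K \<nu> N)"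
    by (intro sum.swap_restrict) auto
  also have "\<dots> = (\<Sum>\<alpha>\<in>Par (size M'). \<Sum>C\<in>?C. H \<alpha> M' * K \<alpha> (N - C))"
  proof (rule sum.cong[OF refl])
    fix \<alpha> assume \<alpha>: "\<alpha> \<in> Par (size M')"
    \<comment> \<open>The letter 0 is added so that the maximum exists even for an empty
      \<open>N\<close>.\<close>
    have "\<forall>x\<in>#N. x < Suc (Max_mset (add_mset 0 N))" by (simp add: less_Suc_eq_le)
    moreover have "{\<nu>. \<nu> \<in> Par (size M) \<and> hstrip \<alpha> \<nu>} = {\<nu>. is_part \<nu> \<and> hstrip \<alpha> \<nu> \<and> psize \<nu> = psize \<alpha> + ?a}"
      using \<alpha> sz by (auto simp: Par_def)
    ultimately have "(\<Sum>\<nu> | \<nu> \<in> Par (size M) \<and> hstrip \<alpha> \<nu>. K \<nu> N) = (\<Sum>C\<in>?C. K \<alpha> (N - C))"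
      using pieri[of \<alpha> N _ ?a] \<alpha> by (simp add: Par_def)
    then show "(\<Sum>\<nu> | \<nu> \<in> Par (size M) \<and> hstrip \<alpha> \<nu>. H \<alpha> M' * K \<nu> N) = (\<Sum>C\<in>?C. H \<alpha> M' * K \<alpha> (N - C))"
      by (simp only: sum_distrib_left[symmetric])
  qed
  also have "\<dots> = (\<Sum>C\<in>?C. \<Sum>\<alpha>\<in>Par (size M'). H \<alpha> M' * K \<alpha> (N - C))"
    by (rule sum.swap)
  also have "\<dots> = (\<Sum>C\<in>?C. card (margins Ks M' (N - C)))"
  proof (rule sum.cong[OF refl])
    fix C assume "C \<in> ?C"
    then have "size M' = size (N - C)" using Suc.prems(1) sz by (simp add: size_Diff_submset)
    then show "(\<Sum>\<alpha>\<in>Par (size M'). H \<alpha> M' * K \<alpha> (N - C)) = card (margins Ks M' (N - C))"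
      by (rule Suc.IH) (simp add: M'_def)
  qed
  also have "\<dots> = card (margins Ks M N)"
    unfolding M'_def by (rule card_margins_rec[OF zero_Ks le, symmetric])
  finally show ?case .
qed

end

section \<open>Tableaux\<close>

definition content :: "(nat \<Rightarrow> nat list) \<Rightarrow> nat multiset" where
  "content T = (\<Sum>i | T i \<noteq> []. mset (T i))"

text \<open>Semistandard fillings with a row for every index, empty from some row on when the shape
  is a partition, to fit shapes given as functions. \<open>schur_eq\<close> relates them to tableaux
  given as lists of rows.\<close>

definition tableaux :: "(nat \<Rightarrow> nat) \<Rightarrow> nat multiset \<Rightarrow> (nat \<Rightarrow> nat list) set" where
  "tableaux \<nu> N = {T. (\<forall>i. length (T i) = \<nu> i \<and> sorted (T i)) \<and>
     (\<forall>i j. j < \<nu> (Suc i) \<longrightarrow> T i ! j < T (Suc i) ! j) \<and> content T = N}"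

lemma content_eq:
  assumes "\<And>i. i \<ge> L \<Longrightarrow> T i = []"
  shows "content T = (\<Sum>i<L. mset (T i))"
proof -
  have "{i. T i \<noteq> []} \<subseteq> {..<L}"
  proof
    fix i assume "i \<in> {i. T i \<noteq> []}"
    then show "i \<in> {..<L}" using assms[of i] by (cases "L \<le> i") auto
  qed
  then show ?thesis unfolding content_def by (intro sum.mono_neutral_left) auto
qed

lemma tableaux_content:
  assumes "T \<in> tableaux \<nu> N" "\<And>i. i \<ge> L \<Longrightarrow> \<nu> i = 0"
  shows "(\<Sum>i<L. mset (T i)) = N"
proof -
  have "T i = []" if "i \<ge> L" for i
    using assms that by (metis (mono_tags, lifting) length_0_conv mem_Collect_eq tableaux_def)
  then show ?thesis using content_eq[of L T] assms(1) by (simp add: tableaux_def)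
qed

lemma tableaux_set:
  assumes "T \<in> tableaux \<nu> N" "is_part \<nu>"
  shows "set (T i) \<subseteq> set_mset N"
proof -
  obtain L where L: "\<And>i. i \<ge> L \<Longrightarrow> \<nu> i = 0" using assms(2) by (auto simp: is_part_def)
  have len: "length (T i) = \<nu> i" using assms(1) by (simp add: tableaux_def)
  show ?thesis
  proof (cases "i < L")
    case True
    then have "mset (T i) \<subseteq># (\<Sum>i<L. mset (T i))"
      by (simp add: sum.remove[of "{..<L}" i])
    then show ?thesis using tableaux_content[OF assms(1) L] by (metis set_mset_mono set_mset_mset)
  qed (use L len in auto)
qed

lemma finite_tableaux:
  assumes "is_part \<nu>"
  shows "finite (tableaux \<nu> N)"
proof -
  obtain L where L: "\<And>i. i \<ge> L \<Longrightarrow> \<nu> i = 0" using assms by (auto simp: is_part_def)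
  let ?B = "{xs. set xs \<subseteq> set_mset N \<and> length xs \<le> psize \<nu>}"
  let ?X = "{T. \<forall>i. (i \<in> {..<L} \<longrightarrow> T i \<in> ?B) \<and> (i \<notin> {..<L} \<longrightarrow> T i = [])}"
  have "tableaux \<nu> N \<subseteq> ?X"
  proof
    fix T assume T: "T \<in> tableaux \<nu> N"
    then have len: "length (T i) = \<nu> i" for i by (simp add: tableaux_def)
    have "T i \<in> ?B" for i using tableaux_set[OF T assms] len is_part_bounds(1)[OF assms] by simp
    moreover have "T i = []" if "i \<notin> {..<L}" for i using len[of i] L[of i] that by simp
    ultimately show "T \<in> ?X" by blast
  qed
  moreover have "finite ?X"
    by (rule finite_set_of_finite_funs) (simp_all add: finite_lists_length_le)
  ultimately show ?thesis by (rule finite_subset)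
qed

lemma sorted_split_max:
  "sorted xs \<Longrightarrow> \<forall>x\<in>set xs. x \<le> t \<Longrightarrow>
    xs = filter (\<lambda>x. x < t) xs @ replicate (length xs - length (filter (\<lambda>x. x < t) xs)) (t :: nat)"
proof (induction xs)
  case (Cons x xs)
  show ?case
  proof (cases "x < t")
    case True
    then show ?thesis using Cons by simp
  next
    case False
    then have eq: "\<forall>y\<in>set (x # xs). y = t" using Cons.prems by fastforce
    then have "filter (\<lambda>y. y < t) (x # xs) = []" by (simp add: filter_empty_conv)
    moreover have "x # xs = replicate (length (x # xs)) t" using eq by (intro replicate_eqI) auto
    ultimately show ?thesis by simp
  qed
qed simp

lemma filter_mset_sum: "filter_mset P (\<Sum>i<(L::nat). f i) = (\<Sum>i<L. filter_mset P (f i))"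
  by (induction L) auto

lemma sum_replicate_mset: "(\<Sum>i<(L::nat). replicate_mset (f i) t) = replicate_mset (\<Sum>i<L. f i) t"
  by (induction L) (auto simp: repeat_mset_distrib multiset_eq_iff)

lemma tableaux_empty:
  assumes "is_part \<nu>"
  shows "card (tableaux \<nu> {#}) = (if \<nu> = (\<lambda>_. 0) then 1 else 0)"
proof -
  have nil: "T i = []" if "T \<in> tableaux \<nu> {#}" for T i
    using tableaux_set[OF that assms, of i] by simp
  show ?thesis
  proof (cases "\<nu> = (\<lambda>_. 0)")
    case True
    have "(\<lambda>_. []) \<in> tableaux \<nu> {#}" by (simp add: tableaux_def True content_def)
    then have "tableaux \<nu> {#} = {\<lambda>_. []}" using nil by auto
    then show ?thesis using True by simp
  next
    case False
    have "\<nu> = (\<lambda>_. 0)" if T: "T \<in> tableaux \<nu> {#}" for T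
    proof
      fix i
      have "length (T i) = \<nu> i" using T by (simp add: tableaux_def)
      then show "\<nu> i = 0" using nil[OF T] by simp
    qed
    then have "tableaux \<nu> {#} = {}" using False by blast
    then show ?thesis using False by simp
  qed
qed

text \<open>Removing all entries equal to the largest letter \<open>t\<close> removes a horizontal strip.\<close>

lemma tableaux_rec:
  assumes \<nu>: "is_part \<nu>" and N: "\<forall>x\<in>#N. x \<le> t"
  shows "card (tableaux \<nu> N) = (\<Sum>\<mu> | is_part \<mu> \<and> hstrip \<mu> \<nu> \<and> psize \<mu> + count N t = psize \<nu>.
    card (tableaux \<mu> (filter_mset (\<lambda>x. x < t) N)))"
proof -
  let ?N = "filter_mset (\<lambda>x. x < t) N"
  let ?U = "{\<mu>. is_part \<mu> \<and> hstrip \<mu> \<nu> \<and> psize \<mu> + count N t = psize \<nu>}"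
  let ?S = "Sigma ?U (\<lambda>\<mu>. tableaux \<mu> ?N)"
  obtain L where L: "\<And>i. i \<ge> L \<Longrightarrow> \<nu> i = 0" using \<nu> by (auto simp: is_part_def)
  have N_split: "N = ?N + replicate_mset (count N t) t"
    using N by (intro multiset_eqI) (auto simp: not_in_iff[symmetric] order_less_le)
  define cut where "cut T = (\<lambda>i. length (filter (\<lambda>x. x < t) (T i)), \<lambda>i. filter (\<lambda>x. x < t) (T i))"
    for T :: "nat \<Rightarrow> nat list"
  define ext where "ext x i = snd x i @ replicate (\<nu> i - fst x i) t"
    for x :: "(nat \<Rightarrow> nat) \<times> (nat \<Rightarrow> nat list)" and i
  have cut_mem: "cut T \<in> ?S" and ext_cut: "ext (cut T) = T" if T: "T \<in> tableaux \<nu> N" for T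
  proof -
    define \<mu> where "\<mu> i = length (filter (\<lambda>x. x < t) (T i))" for i
    define T' where "T' i = filter (\<lambda>x. x < t) (T i)" for i
    have cut: "cut T = (\<mu>, T')" by (simp add: cut_def fun_eq_iff \<mu>_def T'_def)
    have len: "length (T i) = \<nu> i" and srt: "sorted (T i)" for i using T by (auto simp: tableaux_def)
    have col: "T i ! j < T (Suc i) ! j" if "j < \<nu> (Suc i)" for i j using T that by (auto simp: tableaux_def)
    have le: "\<forall>x\<in>set (T i). x \<le> t" for i using tableaux_set[OF T \<nu>, of i] N by blast
    have split: "T i = T' i @ replicate (\<nu> i - \<mu> i) t" for i
      using sorted_split_max[OF srt[of i] le[of i]] unfolding len T'_def \<mu>_def .
    have lenT': "length (T' i) = \<mu> i" for i by (simp add: T'_def \<mu>_def)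
    have \<mu>_le: "\<mu> i \<le> \<nu> i" for i using length_filter_le[of _ "T i"] len by (simp add: \<mu>_def)
    \<comment> \<open>If row \<open>Suc i\<close> reached past column \<open>\<mu> i\<close>, it
      would have a cell below a letter \<open>t\<close>, whose entry would have to exceed the
      largest letter.\<close>
    have strip: "\<nu> (Suc i) \<le> \<mu> i" for i
    proof (rule ccontr)
      assume "\<not> \<nu> (Suc i) \<le> \<mu> i"
      then have j: "\<mu> i < \<nu> (Suc i)" by simp
      then have j': "\<mu> i < \<nu> i" using is_part_Suc[OF \<nu>, of i] by simp
      have "T (Suc i) ! \<mu> i \<in> set (T (Suc i))" using j len by simp
      then have "T (Suc i) ! \<mu> i \<le> t" using le by blast
      then have "T i ! \<mu> i < t" using col[OF j] by simp
      moreover have "T i ! \<mu> i = t" using j' lenT'[of i] by (subst split) (simp add: nth_append)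
      ultimately show False by simp
    qed
    have zero: "\<mu> i = 0" if "i \<ge> L" for i using \<mu>_le[of i] L[OF that] by simp
    have part: "is_part \<mu>"
      using strip \<mu>_le zero by (intro is_partI[of _ L]) (auto intro: order_trans)
    have contT: "(\<Sum>i<L. mset (T i)) = N" using tableaux_content[OF T L] .
    have "(\<Sum>i<L. mset (T i)) = (\<Sum>i<L. mset (T' i) + replicate_mset (\<nu> i - \<mu> i) t)"
      by (subst split) simp
    also have "\<dots> = (\<Sum>i<L. mset (T' i)) + replicate_mset (\<Sum>i<L. \<nu> i - \<mu> i) t"
      by (simp add: sum.distrib sum_replicate_mset)
    finally have "N = (\<Sum>i<L. mset (T' i)) + replicate_mset (\<Sum>i<L. \<nu> i - \<mu> i) t" using contT by simp
    moreover have cont: "(\<Sum>i<L. mset (T' i)) = ?N"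
      unfolding contT[symmetric] filter_mset_sum by (simp add: T'_def)
    ultimately have "?N + replicate_mset (\<Sum>i<L. \<nu> i - \<mu> i) t = ?N + replicate_mset (count N t) t"
      using N_split by simp
    then have "(\<Sum>i<L. \<nu> i - \<mu> i) = count N t" by (metis add_left_cancel size_replicate_mset)
    moreover have "psize \<mu> + (\<Sum>i<L. \<nu> i - \<mu> i) = psize \<nu>"
    proof -
      have "psize \<mu> = (\<Sum>i<L. \<mu> i)" "psize \<nu> = (\<Sum>i<L. \<nu> i)" using zero L by (auto intro: psize_eq)
      then show ?thesis using \<mu>_le by (simp add: sum.distrib[symmetric])
    qed
    ultimately have "\<mu> \<in> ?U" using part strip \<mu>_le by (simp add: hstrip_def)
    moreover have "T' \<in> tableaux \<mu> ?N"
    proof -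
      have "T' i ! j < T' (Suc i) ! j" if j: "j < \<mu> (Suc i)" for i j
      proof -
        have "j < \<mu> i" using j \<mu>_le[of "Suc i"] strip[of i] by simp
        then have "T i ! j = T' i ! j" "T (Suc i) ! j = T' (Suc i) ! j"
          using j lenT' by (subst split, simp add: nth_append)+
        then show ?thesis using col[of j i] j \<mu>_le[of "Suc i"] by simp
      qed
      moreover have "content T' = ?N"
      proof -
        have "T' i = []" if "i \<ge> L" for i using lenT'[of i] zero[OF that] by simp
        from content_eq[of L T', OF this] show ?thesis using cont by simp
      qed
      moreover have "sorted (T' i)" for i unfolding T'_def using srt by (rule sorted_wrt_filter)
      ultimately show ?thesis using lenT' by (simp add: tableaux_def)
    qed
    ultimately show "cut T \<in> ?S" by (simp add: cut)
    have "ext (cut T) i = T i" for i unfolding ext_def cut fst_conv snd_conv by (rule split[symmetric])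
    then show "ext (cut T) = T" by (rule ext)
  qed
  have ext_mem: "ext x \<in> tableaux \<nu> N" and cut_ext: "cut (ext x) = x" if xS: "x \<in> ?S" for x
  proof -
    obtain \<mu> T' where x: "x = (\<mu>, T')" "is_part \<mu>" "hstrip \<mu> \<nu>" "psize \<mu> + count N t = psize \<nu>"
      "T' \<in> tableaux \<mu> ?N" using xS by blast
    have \<mu>: "\<mu> i \<le> \<nu> i" "\<nu> (Suc i) \<le> \<mu> i" for i using x(3) by (auto simp: hstrip_def)
    have len: "length (T' i) = \<mu> i" and srt: "sorted (T' i)" for i using x(5) by (auto simp: tableaux_def)
    have col: "T' i ! j < T' (Suc i) ! j" if "j < \<mu> (Suc i)" for i j using x(5) that by (auto simp: tableaux_def)
    have lt: "y < t" if "y \<in> set (T' i)" for y i using tableaux_set[OF x(5,2), of i] that by auto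
    have ext: "ext x i = T' i @ replicate (\<nu> i - \<mu> i) t" for i by (simp add: ext_def x(1))
    have elen: "length (ext x i) = \<nu> i" for i using \<mu>(1)[of i] len by (simp add: ext)
    have zero: "\<mu> i = 0" if "i \<ge> L" for i using \<mu>(1)[of i] L[OF that] by simp
    have "sorted (ext x i)" for i unfolding ext using srt lt by (fastforce simp: sorted_append)
    moreover have "ext x i ! j < ext x (Suc i) ! j" if j: "j < \<nu> (Suc i)" for i j
    proof -
      have ji: "j < \<mu> i" using j \<mu>(2)[of i] by simp
      then have e: "ext x i ! j = T' i ! j" using len by (simp add: ext nth_append)
      have "T' i ! j \<in> set (T' i)" using ji len[of i] by simp
      then have "T' i ! j < t" by (rule lt)
      then show ?thesis using col[of j i] j \<mu>(1)[of "Suc i"] len unfolding e unfolding ext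
        by (auto simp: nth_append)
    qed
    moreover have "content (ext x) = N"
    proof -
      have "ext x i = []" if "i \<ge> L" for i using elen[of i] L[OF that] by simp
      from content_eq[of L "ext x", OF this] have "content (ext x) = (\<Sum>i<L. mset (ext x i))" .
      also have "\<dots> = (\<Sum>i<L. mset (T' i)) + replicate_mset (\<Sum>i<L. \<nu> i - \<mu> i) t"
        by (simp add: ext sum.distrib sum_replicate_mset)
      also have "(\<Sum>i<L. mset (T' i)) = ?N" using zero by (rule tableaux_content[OF x(5)])
      also have "(\<Sum>i<L. \<nu> i - \<mu> i) = count N t"
      proof -
        have "psize \<mu> = (\<Sum>i<L. \<mu> i)" "psize \<nu> = (\<Sum>i<L. \<nu> i)" using zero L by (auto intro: psize_eq)
        moreover have "(\<Sum>i<L. \<mu> i) + (\<Sum>i<L. \<nu> i - \<mu> i) = (\<Sum>i<L. \<nu> i)"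
          using \<mu>(1) by (simp add: sum.distrib[symmetric])
        ultimately show ?thesis using x(4) by simp
      qed
      finally show ?thesis using N_split by simp
    qed
    ultimately show "ext x \<in> tableaux \<nu> N" using elen by (simp add: tableaux_def)
    have "filter (\<lambda>y. y < t) (T' i) = T' i" for i using lt by (simp add: filter_id_conv)
    then have "filter (\<lambda>y. y < t) (ext x i) = T' i" for i by (simp add: ext)
    then show "cut (ext x) = x" by (simp add: cut_def x(1) len)
  qed
  have "bij_betw cut (tableaux \<nu> N) ?S"
    using cut_mem ext_mem ext_cut cut_ext by (intro bij_betw_byWitness[where f' = ext] ballI image_subsetI)
  then have "card (tableaux \<nu> N) = card ?S" by (rule bij_betw_same_card)
  also have "\<dots> = (\<Sum>\<mu>\<in>?U. card (tableaux \<mu> ?N))"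
  proof (rule card_SigmaI)
    show "finite ?U" by (rule finite_Par_subset[of _ "psize \<nu>"]) auto
    show "\<forall>\<mu>\<in>?U. finite (tableaux \<mu> ?N)" using finite_tableaux by blast
  qed
  finally show ?thesis .
qed

lemma kostka_tableaux: "kostka hstrip UNIV (\<lambda>\<nu> N. card (tableaux \<nu> N))"
proof
  show "card {\<nu>. is_part \<nu> \<and> hstrip \<alpha> \<nu> \<and> hstrip \<mu> \<nu> \<and> psize \<nu> = psize \<alpha> + a} =
    (\<Sum>k\<in>UNIV \<inter> {..min a b}. card {\<kappa>. is_part \<kappa> \<and> hstrip \<kappa> \<alpha> \<and> hstrip \<kappa> \<mu> \<and> psize \<kappa> + b = psize \<alpha> + k})"
    if "is_part \<alpha>" "is_part \<mu>" "psize \<mu> + b = psize \<alpha> + a" for \<alpha> \<mu> a b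
    using local_rule_hstrip[OF that] by simp
qed (simp, simp only: tableaux_empty, rule tableaux_rec)

section \<open>Conjugation\<close>

definition pconj :: "(nat \<Rightarrow> nat) \<Rightarrow> nat \<Rightarrow> nat" where
  "pconj \<alpha> j = card {i. j < \<alpha> i}"

text \<open>For an antitone \<open>\<alpha>\<close> the rows longer than \<open>j\<close> form an
  initial segment. The resulting symmetry between the two indices yields all the properties of
  conjugation that follow.\<close>

lemma less_pconj_iff:
  assumes "is_part \<alpha>"
  shows "i < pconj \<alpha> j \<longleftrightarrow> j < \<alpha> i"
proof -
  obtain L where L: "\<forall>i\<ge>L. \<alpha> i = 0" using assms by (auto simp: is_part_def)
  define m where "m = (LEAST i. \<alpha> i \<le> j)"
  have ex: "\<alpha> L \<le> j" using L by simp
  have "{i. j < \<alpha> i} = {..<m}"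
  proof (intro set_eqI iffI)
    fix i assume "i \<in> {i. j < \<alpha> i}"
    then have i: "j < \<alpha> i" by simp
    have "\<alpha> m \<le> j" unfolding m_def by (rule LeastI[of "\<lambda>i. \<alpha> i \<le> j", OF ex])
    moreover have "\<alpha> i \<le> \<alpha> m" if "m \<le> i" using assms that by (auto simp: is_part_def antimono_def)
    ultimately show "i \<in> {..<m}" using i by (meson lessThan_iff not_less order_trans)
  next
    fix i assume "i \<in> {..<m}"
    then show "i \<in> {i. j < \<alpha> i}" using not_less_Least[of i "\<lambda>i. \<alpha> i \<le> j"] by (simp add: m_def not_le)
  qed
  moreover from this have "i < m \<longleftrightarrow> j < \<alpha> i" by auto
  ultimately show ?thesis by (simp add: pconj_def)
qed

lemma le_iff_less: "(a :: nat) \<le> b \<longleftrightarrow> (\<forall>x. x < a \<longrightarrow> x < b)"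
  by (meson less_irrefl not_le order_less_le_trans)

lemma is_part_pconj:
  assumes "is_part \<alpha>"
  shows "is_part (pconj \<alpha>)"
proof (rule is_partI[of _ "\<alpha> 0"])
  show "pconj \<alpha> (Suc j) \<le> pconj \<alpha> j" for j
    unfolding le_iff_less less_pconj_iff[OF assms] by simp
  show "pconj \<alpha> j = 0" if "\<alpha> 0 \<le> j" for j
    using less_pconj_iff[OF assms, of 0 j] that by simp
qed

lemma pconj_pconj:
  assumes "is_part \<alpha>"
  shows "pconj (pconj \<alpha>) = \<alpha>"
proof
  fix i
  have "j < pconj (pconj \<alpha>) i \<longleftrightarrow> j < \<alpha> i" for j
    using less_pconj_iff[OF is_part_pconj[OF assms], of j i] less_pconj_iff[OF assms, of i j] by simp
  then show "pconj (pconj \<alpha>) i = \<alpha> i" by (meson linorder_neqE_nat less_irrefl)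
qed

text \<open>Counting the cells of the diagram makes the invariance of the size under transposition
  visible.\<close>

lemma psize_eq_card:
  assumes "is_part \<alpha>"
  shows "psize \<alpha> = card {(i, j). j < \<alpha> i}"
proof -
  obtain L where L: "\<And>i. i \<ge> L \<Longrightarrow> \<alpha> i = 0" using assms by (auto simp: is_part_def)
  have "{(i, j). j < \<alpha> i} = Sigma {..<L} (\<lambda>i. {..<\<alpha> i})"
    using L by (auto, metis not_less less_nat_zero_code)
  then show ?thesis using psize_eq[OF L] by (simp add: card_SigmaI)
qed

lemma psize_pconj:
  assumes "is_part \<alpha>"
  shows "psize (pconj \<alpha>) = psize \<alpha>"
proof -
  have "{(i, j). j < pconj \<alpha> i} = prod.swap ` {(i, j). j < \<alpha> i}"
    by (auto simp: less_pconj_iff[OF assms] image_iff)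
  then show ?thesis
    using psize_eq_card[OF assms] psize_eq_card[OF is_part_pconj[OF assms]] by (simp add: card_image)
qed

lemma hstrip_pconj_iff:
  assumes "is_part \<mu>" "is_part \<nu>"
  shows "hstrip (pconj \<mu>) (pconj \<nu>) \<longleftrightarrow> vstrip \<mu> \<nu>"
proof -
  have "hstrip (pconj \<mu>) (pconj \<nu>) \<longleftrightarrow> (\<forall>j i. (j < \<mu> i \<longrightarrow> j < \<nu> i) \<and> (Suc j < \<nu> i \<longrightarrow> j < \<mu> i))"
    unfolding hstrip_def le_iff_less less_pconj_iff[OF assms(1)] less_pconj_iff[OF assms(2)] by blast
  also have "\<dots> \<longleftrightarrow> vstrip \<mu> \<nu>"
  proof -
    have *: "(\<forall>j. Suc j < a \<longrightarrow> j < b) \<longleftrightarrow> a \<le> Suc b" for a b :: nat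
    proof
      assume "\<forall>j. Suc j < a \<longrightarrow> j < b"
      then have "\<not> Suc b < a" using less_irrefl by blast
      then show "a \<le> Suc b" by simp
    qed auto
    have "(\<forall>j i. (j < \<mu> i \<longrightarrow> j < \<nu> i) \<and> (Suc j < \<nu> i \<longrightarrow> j < \<mu> i)) \<longleftrightarrow>
        (\<forall>i. (\<forall>j. j < \<mu> i \<longrightarrow> j < \<nu> i) \<and> (\<forall>j. Suc j < \<nu> i \<longrightarrow> j < \<mu> i))" by blast
    then show ?thesis unfolding vstrip_def by (simp only: * le_iff_less[symmetric])
  qed
  finally show ?thesis .
qed

text \<open>Conjugation turns the horizontal strips removed by \<open>tableaux_rec\<close> into
  vertical ones. Tableaux of conjugate shape therefore form the vertical instance, which produces
  the dual identity and the conjugate shape in the second factor.\<close>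

lemma kostka_tableaux_pconj: "kostka vstrip {0, 1} (\<lambda>\<nu> N. card (tableaux (pconj \<nu>) N))"
proof
  show "card {\<nu>. is_part \<nu> \<and> hstrip \<alpha> \<nu> \<and> vstrip \<mu> \<nu> \<and> psize \<nu> = psize \<alpha> + a} =
    (\<Sum>k\<in>{0, 1} \<inter> {..min a b}. card {\<kappa>. is_part \<kappa> \<and> vstrip \<kappa> \<alpha> \<and> hstrip \<kappa> \<mu> \<and> psize \<kappa> + b = psize \<alpha> + k})"
    if "is_part \<alpha>" "is_part \<mu>" "psize \<mu> + b = psize \<alpha> + a" for \<alpha> \<mu> a b
    using local_rule_vstrip[OF that] .
  show "card (tableaux (pconj \<nu>) {#}) = (if \<nu> = (\<lambda>_. 0) then 1 else 0)" if "is_part \<nu>" for \<nu>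
  proof -
    have "pconj \<nu> = (\<lambda>_. 0) \<longleftrightarrow> \<nu> = (\<lambda>_. 0)"
      using psize_eq_0_iff[OF that] psize_eq_0_iff[OF is_part_pconj[OF that]] psize_pconj[OF that] by simp
    then show ?thesis using tableaux_empty[OF is_part_pconj[OF that]] by simp
  qed
  show "card (tableaux (pconj \<nu>) N) = (\<Sum>\<mu> | is_part \<mu> \<and> vstrip \<mu> \<nu> \<and> psize \<mu> + count N t = psize \<nu>.
      card (tableaux (pconj \<mu>) (filter_mset (\<lambda>x. x < t) N)))"
    if "is_part \<nu>" "\<forall>x\<in>#N. x \<le> t" for \<nu> N t
    unfolding tableaux_rec[OF is_part_pconj[OF that(1)] that(2)]
  proof (rule sum.reindex_bij_witness[of _ pconj pconj])
    fix \<mu> assume "\<mu> \<in> {\<mu>. is_part \<mu> \<and> hstrip \<mu> (pconj \<nu>) \<and> psize \<mu> + count N t = psize (pconj \<nu>)}"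
    then have \<mu>: "is_part \<mu>" "hstrip \<mu> (pconj \<nu>)" "psize \<mu> + count N t = psize \<nu>"
      by (auto simp: psize_pconj[OF that(1)])
    then show "pconj (pconj \<mu>) = \<mu>" using pconj_pconj by blast
    then show "pconj \<mu> \<in> {\<mu>. is_part \<mu> \<and> vstrip \<mu> \<nu> \<and> psize \<mu> + count N t = psize \<nu>}"
      using \<mu> hstrip_pconj_iff[OF is_part_pconj[OF \<mu>(1)] that(1)] is_part_pconj[OF \<mu>(1)] psize_pconj[OF \<mu>(1)]
      by simp
    show "card (tableaux (pconj (pconj \<mu>)) (filter_mset (\<lambda>x. x < t) N)) = card (tableaux \<mu> (filter_mset (\<lambda>x. x < t) N))"
      using pconj_pconj[OF \<mu>(1)] by simp
  next
    fix \<mu> assume "\<mu> \<in> {\<mu>. is_part \<mu> \<and> vstrip \<mu> \<nu> \<and> psize \<mu> + count N t = psize \<nu>}"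
    then have \<mu>: "is_part \<mu>" "vstrip \<mu> \<nu>" "psize \<mu> + count N t = psize \<nu>" by auto
    show "pconj (pconj \<mu>) = \<mu>" using pconj_pconj[OF \<mu>(1)] .
    show "pconj \<mu> \<in> {\<mu>. is_part \<mu> \<and> hstrip \<mu> (pconj \<nu>) \<and> psize \<mu> + count N t = psize (pconj \<nu>)}"
      using \<mu> hstrip_pconj_iff[OF \<mu>(1) that(1)] is_part_pconj[OF \<mu>(1)] psize_pconj[OF \<mu>(1)] psize_pconj[OF that(1)]
      by simp
  qed
qed simp

section \<open>Schur functions\<close>

definition part_fun :: "nat list \<Rightarrow> nat \<Rightarrow> nat" where
  "part_fun l i = (if i < length l then l ! i else 0)"

lemma schur_eq: "schur l M = int (card (tableaux (part_fun l) M))"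
proof -
  define f where "f T i = (if i < length T then T ! i else [])" for T :: "nat list list" and i
  have f_content: "content (f T) = mset (concat T)" for T
  proof -
    have "content (f T) = (\<Sum>i<length T. mset (f T i))" by (rule content_eq) (simp add: f_def)
    also have "\<dots> = (\<Sum>i<length T. mset (T ! i))" by (intro sum.cong) (simp_all add: f_def)
    also have "\<dots> = mset (concat T)"
      by (simp add: mset_concat sum_list_sum_nth atLeast0LessThan)
    finally show ?thesis .
  qed
  have "bij_betw f {T. ssyt l T \<and> mset (concat T) = M} (tableaux (part_fun l) M)"
  proof (rule bij_betw_byWitness[where f' = "\<lambda>T. map T [0..<length l]"])
    show "\<forall>T\<in>{T. ssyt l T \<and> mset (concat T) = M}. map (f T) [0..<length l] = T"
      by (auto simp: f_def ssyt_def intro!: nth_equalityI)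
    have out: "T i = []" if "T \<in> tableaux (part_fun l) M" "\<not> i < length l" for T i
    proof -
      have "length (T i) = part_fun l i" using that(1) by (simp add: tableaux_def)
      then show ?thesis using that(2) by (simp add: part_fun_def)
    qed
    have inv: "f (map T [0..<length l]) = T" if "T \<in> tableaux (part_fun l) M" for T
      using out[OF that] by (intro ext) (simp add: f_def)
    then show "\<forall>T\<in>tableaux (part_fun l) M. f (map T [0..<length l]) = T" by blast
    show "f ` {T. ssyt l T \<and> mset (concat T) = M} \<subseteq> tableaux (part_fun l) M"
    proof (rule image_subsetI)
      fix T assume T: "T \<in> {T. ssyt l T \<and> mset (concat T) = M}"
      then have l: "l = map length T" by (simp add: ssyt_def)
      have "f T i ! j < f T (Suc i) ! j" if "j < part_fun l (Suc i)" for i j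
        using T that by (auto simp: l part_fun_def f_def ssyt_def split: if_splits)
      moreover have "length (f T i) = part_fun l i" "sorted (f T i)" for i
        using T by (auto simp: l part_fun_def f_def ssyt_def)
      ultimately show "f T \<in> tableaux (part_fun l) M" using T by (simp add: tableaux_def f_content)
    qed
    show "(\<lambda>T. map T [0..<length l]) ` tableaux (part_fun l) M \<subseteq> {T. ssyt l T \<and> mset (concat T) = M}"
    proof (rule image_subsetI)
      fix T assume T: "T \<in> tableaux (part_fun l) M"
      have len: "length (T i) = part_fun l i" and srt: "sorted (T i)" for i using T by (auto simp: tableaux_def)
      have col: "T i ! j < T (Suc i) ! j" if "j < part_fun l (Suc i)" for i j
        using T that by (auto simp: tableaux_def)
      have "mset (concat (map T [0..<length l])) = M"
        using f_content[of "map T [0..<length l]"] inv[OF T] T by (simp add: tableaux_def)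
      moreover have "map length (map T [0..<length l]) = l"
        by (intro nth_equalityI) (simp_all add: len part_fun_def)
      ultimately show "map T [0..<length l] \<in> {T. ssyt l T \<and> mset (concat T) = M}"
        using srt col len by (auto simp: ssyt_def)
    qed
  qed
  then show ?thesis unfolding schur_def by (simp add: bij_betw_same_card)
qed

lemma part_fun_is_part:
  assumes "l \<in> partitions n"
  shows "is_part (part_fun l)" "psize (part_fun l) = n"
proof -
  have l: "sorted_wrt (\<ge>) l" "sum_list l = n" using assms by (auto simp: partitions_def)
  show "is_part (part_fun l)"
  proof (rule is_partI[of _ "length l"])
    show "part_fun l (Suc i) \<le> part_fun l i" for i
      using sorted_wrt_nth_less[OF l(1), of i "Suc i"] by (auto simp: part_fun_def)
  qed (simp add: part_fun_def)
  have "psize (part_fun l) = (\<Sum>i<length l. part_fun l i)" by (rule psize_eq) (simp add: part_fun_def)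
  also have "\<dots> = (\<Sum>i<length l. l ! i)" by (intro sum.cong) (simp_all add: part_fun_def)
  also have "\<dots> = n" using l(2) by (simp add: sum_list_sum_nth atLeast0LessThan)
  finally show "psize (part_fun l) = n" .
qed

lemma bij_betw_part_fun: "bij_betw part_fun (partitions n) (Par n)"
\<comment> \<open>The first column length \<open>pconj g 0\<close> is the number of nonzero parts,
  hence the length of the list.\<close>
proof (rule bij_betw_byWitness[where f' = "\<lambda>g. map g [0..<pconj g 0]"])
  have pc: "pconj (part_fun l) 0 = length l" if "l \<in> partitions n" for l
  proof -
    have "0 \<notin> set l" using that by (simp add: partitions_def)
    then have "{i. 0 < part_fun l i} = {..<length l}"
      by (auto simp: part_fun_def in_set_conv_nth split: if_splits)
    then show ?thesis by (simp add: pconj_def)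
  qed
  show "\<forall>l\<in>partitions n. map (part_fun l) [0..<pconj (part_fun l) 0] = l"
    using pc by (auto intro!: nth_equalityI simp: part_fun_def)
  show "part_fun ` partitions n \<subseteq> Par n"
    using part_fun_is_part by (auto simp: Par_def)
  have inv: "part_fun (map \<alpha> [0..<pconj \<alpha> 0]) = \<alpha>" if "is_part \<alpha>" for \<alpha>
  proof
    fix i
    show "part_fun (map \<alpha> [0..<pconj \<alpha> 0]) i = \<alpha> i"
      using less_pconj_iff[OF that, of i 0] by (auto simp: part_fun_def)
  qed
  then show "\<forall>\<alpha>\<in>Par n. part_fun (map \<alpha> [0..<pconj \<alpha> 0]) = \<alpha>" by (simp add: Par_def)
  show "(\<lambda>g. map g [0..<pconj g 0]) ` Par n \<subseteq> partitions n"
  proof (rule image_subsetI)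
    fix \<alpha> assume "\<alpha> \<in> Par n"
    then have \<alpha>: "is_part \<alpha>" "psize \<alpha> = n" by (auto simp: Par_def)
    let ?l = "map \<alpha> [0..<pconj \<alpha> 0]"
    have "\<alpha> j \<le> \<alpha> i" if "i < j" for i j using \<alpha>(1) that by (simp add: is_part_def antimono_def)
    then have "sorted_wrt (\<ge>) ?l" by (simp add: sorted_wrt_iff_nth_less)
    moreover have "0 \<notin> set ?l"
    proof
      assume "0 \<in> set ?l"
      then obtain i where i: "i < pconj \<alpha> 0" "\<alpha> i = 0" by auto
      then show False using less_pconj_iff[OF \<alpha>(1), of i 0] by simp
    qed
    moreover have "sum_list ?l = n"
    proof -
      have "\<alpha> i = 0" if "i \<ge> pconj \<alpha> 0" for i using less_pconj_iff[OF \<alpha>(1), of i 0] that by simp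
      from psize_eq[OF this] show ?thesis
        using \<alpha>(2) by (simp add: sum_list_sum_nth atLeast0LessThan)
    qed
    ultimately show "?l \<in> partitions n" by (simp add: partitions_def)
  qed
qed

lemma part_fun_conj_part:
  assumes "l \<in> partitions n"
  shows "part_fun (conj_part l) = pconj (part_fun l)"
proof
  fix j
  have srt: "sorted_wrt (\<ge>) l" using assms by (simp add: partitions_def)
  have "{i. j < part_fun l i} = {i. i < length l \<and> j < l ! i}" by (auto simp: part_fun_def split: if_splits)
  then have p: "pconj (part_fun l) j = length (filter (\<lambda>r. j < r) l)"
    by (simp add: pconj_def length_filter_conv_card)
  show "part_fun (conj_part l) j = pconj (part_fun l) j"
  proof (cases "l \<noteq> [] \<and> j < hd l")
    case True
    then show ?thesis using p by (simp add: conj_part_def part_fun_def)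
  next
    case False
    have "r \<le> hd l" if "r \<in> set l" for r using srt that by (cases l) auto
    then have "filter (\<lambda>r. j < r) l = []" using False by (fastforce simp: filter_empty_conv)
    then show ?thesis using p False by (auto simp: conj_part_def part_fun_def)
  qed
qed

lemma cauchy_schur:
  assumes "size M = n" "size N = n"
  shows "(\<Sum>l\<in>partitions n. schur l M * schur l N) = int (card (margins UNIV M N))"
    and "(\<Sum>l\<in>partitions n. schur l M * schur (conj_part l) N) = int (card (margins {0, 1} M N))"
proof -
  have M: "\<forall>x\<in>#M. x < Suc (Max_mset (add_mset 0 M))" by (simp add: less_Suc_eq_le)
  have sz: "size M = size N" using assms by simp
  have "(\<Sum>l\<in>partitions n. schur l M * schur l N) =
      (\<Sum>\<alpha>\<in>Par n. int (card (tableaux \<alpha> M) * card (tableaux \<alpha> N)))"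
    using sum.reindex_bij_betw[OF bij_betw_part_fun, of "\<lambda>g. int (card (tableaux g M) * card (tableaux g N))"]
    by (simp add: schur_eq)
  then show "(\<Sum>l\<in>partitions n. schur l M * schur l N) = int (card (margins UNIV M N))"
    using kostka.cauchy[OF kostka_tableaux kostka_tableaux sz M] assms(1) by (simp only: flip: of_nat_sum)
  have "(\<Sum>l\<in>partitions n. schur l M * schur (conj_part l) N) =
      (\<Sum>l\<in>partitions n. int (card (tableaux (part_fun l) M) * card (tableaux (pconj (part_fun l)) N)))"
    by (intro sum.cong) (simp_all add: schur_eq part_fun_conj_part)
  also have "\<dots> = (\<Sum>\<alpha>\<in>Par n. int (card (tableaux \<alpha> M) * card (tableaux (pconj \<alpha>) N)))"
    by (rule sum.reindex_bij_betw[OF bij_betw_part_fun])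
  finally show "(\<Sum>l\<in>partitions n. schur l M * schur (conj_part l) N) = int (card (margins {0, 1} M N))"
    using kostka.cauchy[OF kostka_tableaux_pconj kostka_tableaux sz M] assms(1) by (simp only: flip: of_nat_sum)
qed

declare One_nat_def [simp del]

text \<open>Divisibility is extracted one alphabet at a time: with \<open>y\<close> fixed, the inner
  sums are the coefficients of the first family; as functions of \<open>y\<close> they are in turn
  expansions in the second.\<close>

lemma triangular_dvd_coeffs2:
  fixes d :: int
  assumes "triangular I b p r" "triangular J b' p' r'"
    and "\<And>x y. d dvd (\<Sum>i\<in>I. \<Sum>j\<in>J. c i j * (b i x * b' j y))"
    and "i \<in> I" "j \<in> J"
  shows "d dvd c i j"
proof -
  have "d dvd (\<Sum>j\<in>J. c i j * b' j y)" for y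
  proof (rule triangular.dvd_coeffs[OF assms(1) _ assms(4)])
    fix x
    have "(\<Sum>i\<in>I. (\<Sum>j\<in>J. c i j * b' j y) * b i x) = (\<Sum>i\<in>I. \<Sum>j\<in>J. c i j * (b i x * b' j y))"
      unfolding sum_distrib_right by (intro sum.cong refl) (simp only: mult_ac)
    then show "d dvd (\<Sum>i\<in>I. (\<Sum>j\<in>J. c i j * b' j y) * b i x)" using assms(3)[of x y] by (simp only:)
  qed
  then show ?thesis using triangular.dvd_coeffs[OF assms(2) _ assms(5), of d "c i"] by blast
qed

lemma triangular_coeffs2_unique:
  assumes "triangular I b p r" "triangular J b' p' r'"
    and "\<And>x y. (\<Sum>i\<in>I. \<Sum>j\<in>J. c i j * (b i x * b' j y)) = (\<Sum>i\<in>I. \<Sum>j\<in>J. c' i j * (b i x * b' j y))"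
    and "i \<in> I" "j \<in> J"
  shows "c i j = c' i j"
proof -
  have "0 dvd c i j - c' i j"
    by (rule triangular_dvd_coeffs2[OF assms(1,2) _ assms(4,5), of 0 "\<lambda>i j. c i j - c' i j"])
      (use assms(3) in \<open>simp_all add: left_diff_distrib sum_subtractf\<close>)
  then show ?thesis by simp
qed

section \<open>The coproduct of a fundamental function as a sum over factorizations\<close>

abbreviation perms :: "nat \<Rightarrow> (nat \<Rightarrow> nat) set" where
  "perms n \<equiv> {\<sigma>. \<sigma> permutes {1..n}}"

lemma finite_perms [simp]: "finite (perms n)"
  by (rule finite_permutations) simp

lemma Des_in_Pow: "Des n \<pi> \<in> Pow {1..<n}"
  using Des_subset by blast

text \<open>The sum over all factorizations of \<open>\<pi>\<close>, parametrized by the left factor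
  \<open>\<sigma>\<close>. It is attached to a permutation, so that its dependence on the descent
  set alone can be stated and proved.\<close>

definition comul :: "nat \<Rightarrow> (nat \<Rightarrow> nat) \<Rightarrow> nat multiset \<Rightarrow> nat multiset \<Rightarrow> int" where
  "comul n \<pi> M N = (\<Sum>\<sigma>\<in>perms n. F n (Des n (inv \<sigma> \<circ> \<pi>)) M * F n (Des n \<sigma>) N)"

text \<open>Replacing \<open>\<sigma>\<close> by its inverse gives the set counted in
  \<open>card_biwords\<close>. The number of words depends on \<open>\<pi>\<close> only through its
  descent set, which the sum does not show.\<close>

lemma comul_eq_card:
  assumes "\<pi> permutes {1..n}" "size M = n" "size N = n"
  shows "comul n \<pi> M N = int (card (biwords n (Des n \<pi>) M N))"
proof -
  have "comul n \<pi> M N = (\<Sum>\<tau>\<in>perms n. F n (Des n (\<tau> \<circ> \<pi>)) M * F n (Des n (inv \<tau>)) N)"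
    unfolding comul_def
    by (rule sum.reindex_bij_witness[of _ inv inv]) (auto simp: permutes_inv permutes_inv_inv)
  also have "\<dots> = (\<Sum>\<tau>\<in>perms n. if Des n (\<tau> \<circ> \<pi>) \<subseteq> asc M \<and> Des n (inv \<tau>) \<subseteq> asc N then 1 else 0)"
    using assms by (intro sum.cong) (simp_all add: F_eq[OF Des_subset])
  also have "\<dots> = int (card {\<tau> \<in> perms n. Des n (\<tau> \<circ> \<pi>) \<subseteq> asc M \<and> Des n (inv \<tau>) \<subseteq> asc N})"
    by (simp add: sum.If_cases Int_def)
  also have "{\<tau> \<in> perms n. Des n (\<tau> \<circ> \<pi>) \<subseteq> asc M \<and> Des n (inv \<tau>) \<subseteq> asc N} =
      {\<tau>. \<tau> permutes {1..n} \<and> Des n (\<tau> \<circ> \<pi>) \<subseteq> asc M \<and> Des n (inv \<tau>) \<subseteq> asc N}" by simp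
  finally show ?thesis using card_biwords[OF assms(1,3), of M] by simp
qed

lemma comul_eq_0: "size M \<noteq> n \<or> size N \<noteq> n \<Longrightarrow> comul n \<pi> M N = 0"
  unfolding comul_def F_eq[OF Des_subset] by (intro sum.neutral) auto

lemma comul_Des_cong:
  assumes "\<pi> permutes {1..n}" "\<pi>' permutes {1..n}" "Des n \<pi> = Des n \<pi>'"
  shows "comul n \<pi> M N = comul n \<pi>' M N"
  using comul_eq_card[OF assms(1), of M N] comul_eq_card[OF assms(2), of M N] assms(3)
    comul_eq_0[of M n N] by metis

definition factorizations ::
    "nat \<Rightarrow> (nat \<Rightarrow> nat) \<Rightarrow> nat set \<Rightarrow> nat set \<Rightarrow> ((nat \<Rightarrow> nat) \<times> (nat \<Rightarrow> nat)) set" where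
  "factorizations n \<pi> I J = {(\<sigma>\<^sub>1, \<sigma>\<^sub>2). \<sigma>\<^sub>1 permutes {1..n} \<and> \<sigma>\<^sub>2 permutes {1..n} \<and>
      Des n \<sigma>\<^sub>1 = I \<and> Des n \<sigma>\<^sub>2 = J \<and> \<sigma>\<^sub>2 \<circ> \<sigma>\<^sub>1 = \<pi>}"

lemma comp_eq_iff_inv:
  assumes "\<sigma> permutes S"
  shows "\<sigma> \<circ> \<rho> = \<pi> \<longleftrightarrow> \<rho> = inv \<sigma> \<circ> \<pi>"
  using permutes_inv_o[OF assms] by (metis comp_assoc comp_id id_comp)

lemma card_factorizations:
  assumes \<pi>: "\<pi> permutes {1..n}"
  shows "card {(\<sigma>\<^sub>1, \<sigma>\<^sub>2). \<sigma>\<^sub>1 permutes {1..n} \<and> \<sigma>\<^sub>2 permutes {1..n} \<and> P \<sigma>\<^sub>1 \<and> Q \<sigma>\<^sub>2 \<and> \<sigma>\<^sub>2 \<circ> \<sigma>\<^sub>1 = \<pi>}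
    = card {\<sigma> \<in> perms n. P (inv \<sigma> \<circ> \<pi>) \<and> Q \<sigma>}"
proof -
  have "{(\<sigma>\<^sub>1, \<sigma>\<^sub>2). \<sigma>\<^sub>1 permutes {1..n} \<and> \<sigma>\<^sub>2 permutes {1..n} \<and> P \<sigma>\<^sub>1 \<and> Q \<sigma>\<^sub>2 \<and> \<sigma>\<^sub>2 \<circ> \<sigma>\<^sub>1 = \<pi>}
    = (\<lambda>\<sigma>. (inv \<sigma> \<circ> \<pi>, \<sigma>)) ` {\<sigma> \<in> perms n. P (inv \<sigma> \<circ> \<pi>) \<and> Q \<sigma>}" (is "?L = ?h ` ?R")
  proof (intro equalityI subsetI)
    fix x assume "x \<in> ?L"
    then obtain \<sigma>\<^sub>1 \<sigma>\<^sub>2 where x: "x = (\<sigma>\<^sub>1, \<sigma>\<^sub>2)" "\<sigma>\<^sub>2 permutes {1..n}" "P \<sigma>\<^sub>1" "Q \<sigma>\<^sub>2" "\<sigma>\<^sub>2 \<circ> \<sigma>\<^sub>1 = \<pi>" by blast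
    then have "\<sigma>\<^sub>1 = inv \<sigma>\<^sub>2 \<circ> \<pi>" using comp_eq_iff_inv by blast
    then show "x \<in> ?h ` ?R" using x by blast
  next
    fix x assume "x \<in> ?h ` ?R"
    then obtain \<sigma> where \<sigma>: "x = (inv \<sigma> \<circ> \<pi>, \<sigma>)" "\<sigma> permutes {1..n}" "P (inv \<sigma> \<circ> \<pi>)" "Q \<sigma>" by blast
    then show "x \<in> ?L"
      using comp_eq_iff_inv[OF \<sigma>(2), of "inv \<sigma> \<circ> \<pi>" \<pi>] permutes_compose[OF \<pi> permutes_inv[OF \<sigma>(2)]] by simp
  qed
  moreover have "inj_on ?h ?R" by (rule inj_onI) simp
  ultimately show ?thesis by (simp only: card_image)
qed

lemma acoeff_eq: "acoeff n K I J = card (factorizations n (SOME \<pi>. \<pi> permutes {1..n} \<and> Des n \<pi> = K) I J)"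
  by (simp add: acoeff_def factorizations_def)

lemma comul_eq_sum_factorizations:
  assumes "\<pi> permutes {1..n}"
  shows "comul n \<pi> M N = (\<Sum>I\<in>Pow {1..<n}. \<Sum>J\<in>Pow {1..<n}.
    int (card (factorizations n \<pi> I J)) * (F n I M * F n J N))"
proof -
  let ?P = "Pow {1..<n}"
  have "comul n \<pi> M N = (\<Sum>\<sigma>\<in>perms n. (\<lambda>(I, J). F n I M * F n J N) (Des n (inv \<sigma> \<circ> \<pi>), Des n \<sigma>))"
    by (simp add: comul_def)
  also have "\<dots> = (\<Sum>x\<in>?P \<times> ?P. of_nat (card {\<sigma> \<in> perms n. (Des n (inv \<sigma> \<circ> \<pi>), Des n \<sigma>) = x}) *
      (\<lambda>(I, J). F n I M * F n J N) x)"
    by (rule sum_fun_comp) (auto simp del: Pow_iff intro!: Des_in_Pow)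
  also have "\<dots> = (\<Sum>(I, J)\<in>?P \<times> ?P. int (card (factorizations n \<pi> I J)) * (F n I M * F n J N))"
    by (intro sum.cong refl)
      (auto simp: factorizations_def card_factorizations[OF assms, of "\<lambda>\<sigma>. Des n \<sigma> = _" "\<lambda>\<sigma>. Des n \<sigma> = _"])
  finally show ?thesis by (simp add: sum.cartesian_product)
qed

text \<open>The two expansions agree as series, and the products of fundamental functions are
  unitriangular in both alphabets, so coefficients may be compared. This justifies the choice of a
  permutation in \<open>acoeff\<close>.\<close>

lemma card_factorizations_Des_cong:
  assumes "\<pi> permutes {1..n}" "\<pi>' permutes {1..n}" "Des n \<pi> = Des n \<pi>'" "I \<subseteq> {1..<n}" "J \<subseteq> {1..<n}"
  shows "card (factorizations n \<pi> I J) = card (factorizations n \<pi>' I J)"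
proof -
  have "int (card (factorizations n \<pi> I J)) = int (card (factorizations n \<pi>' I J))"
    by (rule triangular_coeffs2_unique[OF Ftri.triangular_axioms Ftri.triangular_axioms])
      (use assms comul_Des_cong[OF assms(1-3)] comul_eq_sum_factorizations[OF assms(1)]
        comul_eq_sum_factorizations[OF assms(2)] in simp_all)
  then show ?thesis by simp
qed

lemma Delta_F:
  assumes "K \<subseteq> {1..<n}"
  shows "Delta n (F n K) = (\<Sum>I\<in>Pow {1..<n}. \<Sum>J\<in>Pow {1..<n}. zscale (int (acoeff n K I J)) (F n I \<otimes> F n J))"
proof -
  define D where "D K = (\<Sum>I\<in>Pow {1..<n}. \<Sum>J\<in>Pow {1..<n}. zscale (int (acoeff n K I J)) (F n I \<otimes> F n J))" for K
  have rep: "zmod.representation (F n ` Pow {1..<n}) (F n K) (F n K') = (if K' = K then 1 else 0)"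
    if "K' \<in> Pow {1..<n}" for K'
    using zmod.representation_basis[OF Ftri.independent, of "F n K" n] assms that
      inj_onD[OF Ftri.inj, of n K' K] by auto
  have "Delta n (F n K) = (\<Sum>K'\<in>Pow {1..<n}. if K' = K then D K else 0)"
    unfolding Delta_def D_def[symmetric]
    by (intro sum.cong refl) (simp add: rep del: Pow_iff)
  also have "\<dots> = D K" using assms by simp
  finally show ?thesis by (simp add: D_def)
qed

text \<open>Frees the coproduct from the permutation chosen in \<open>acoeff\<close>: any one with
  the given descent set may be used. Rotated and composed permutations can then be substituted
  directly.\<close>

lemma Delta_F_Des:
  assumes \<pi>: "\<pi> permutes {1..n}"
  shows "Delta n (F n (Des n \<pi>)) (M, N) = comul n \<pi> M N"
proof -
  let ?\<rho> = "SOME \<rho>. \<rho> permutes {1..n} \<and> Des n \<rho> = Des n \<pi>"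
  have \<rho>: "?\<rho> permutes {1..n} \<and> Des n ?\<rho> = Des n \<pi>"
    by (rule someI_ex[where P = "\<lambda>\<rho>. \<rho> permutes {1..n} \<and> Des n \<rho> = Des n \<pi>"]) (use \<pi> in blast)
  have "Delta n (F n (Des n \<pi>)) (M, N) = (\<Sum>I\<in>Pow {1..<n}. \<Sum>J\<in>Pow {1..<n}.
      int (acoeff n (Des n \<pi>) I J) * (F n I M * F n J N))"
    unfolding Delta_F[OF Des_subset] by (simp add: sum_fun_apply zscale_def tens_def)
  also have "\<dots> = (\<Sum>I\<in>Pow {1..<n}. \<Sum>J\<in>Pow {1..<n}.
      int (card (factorizations n \<pi> I J)) * (F n I M * F n J N))"
    unfolding acoeff_eq
    using card_factorizations_Des_cong[of ?\<rho> n \<pi>] \<rho> \<pi> by (intro sum.cong refl) simp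
  also have "\<dots> = comul n \<pi> M N" by (rule comul_eq_sum_factorizations[OF \<pi>, symmetric])
  finally show ?thesis .
qed

lemma Delta_add:
  assumes "f \<in> QSym n" "g \<in> QSym n"
  shows "Delta n (f + g) = Delta n f + Delta n g"
  using assms unfolding Delta_def QSym_eq_span
  by (simp only: zmod.representation_add[OF Ftri.independent] zmod.scale_left_distrib sum.distrib)

lemma Delta_scale:
  assumes "f \<in> QSym n"
  shows "Delta n (zscale c f) = zscale c (Delta n f)"
  using assms unfolding Delta_def QSym_eq_span
  by (simp only: zmod.representation_scale[OF Ftri.independent] zmod.scale_sum_right zmod.scale_scale mult.assoc)

lemma Delta_0: "Delta n 0 = 0"
  by (simp add: Delta_def zmod.representation_zero)

lemma Delta_sum:
  assumes "\<And>i. i \<in> I \<Longrightarrow> f i \<in> QSym n"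
  shows "Delta n (\<Sum>i\<in>I. f i) = (\<Sum>i\<in>I. Delta n (f i))"
  using assms
proof (induction I rule: infinite_finite_induct)
  case (insert x A)
  then have "(\<Sum>i\<in>A. f i) \<in> QSym n" by (intro zmod.subspace_sum subspace_QSym) auto
  moreover have "f x \<in> QSym n" "Delta n (\<Sum>i\<in>A. f i) = (\<Sum>i\<in>A. Delta n (f i))" using insert by auto
  ultimately show ?case
    unfolding sum.insert[OF insert.hyps(1,2)] by (simp only: Delta_add)
qed (simp_all add: Delta_0)

text \<open>Every subset of \<open>{1..<n}\<close> is a descent set, so linear statements need only
  be checked on functions attached to permutations, where the group structure is available.\<close>

lemma QSym_induct [consumes 1, case_names zero add scale Des]:
  assumes "f \<in> QSym n" and "P 0"
    and "\<And>f g. f \<in> QSym n \<Longrightarrow> g \<in> QSym n \<Longrightarrow> P f \<Longrightarrow> P g \<Longrightarrow> P (f + g)"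
    and "\<And>c f. f \<in> QSym n \<Longrightarrow> P f \<Longrightarrow> P (zscale c f)"
    and "\<And>\<pi>. \<pi> permutes {1..n} \<Longrightarrow> P (F n (Des n \<pi>))"
  shows "P f"
proof -
  have sub: "zmod.subspace {f \<in> QSym n. P f}"
    by (rule zmod.subspaceI)
      (use assms subspace_QSym[of n] in \<open>auto simp: zmod.subspace_0 zmod.subspace_add zmod.subspace_scale\<close>)
  have "F n ` Pow {1..<n} \<subseteq> {f \<in> QSym n. P f}"
  proof clarify
    fix K assume K: "K \<subseteq> {1..<n}"
    then obtain \<pi> where "\<pi> permutes {1..n}" "Des n \<pi> = K" using ex_Des by blast
    then have "P (F n K)" using assms(5) by blast
    then show "F n K \<in> QSym n \<and> P (F n K)" using F_in_QSym[OF K] by blast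
  qed
  then have "zmod.span (F n ` Pow {1..<n}) \<subseteq> {f \<in> QSym n. P f}" using sub by (rule zmod.span_minimal)
  then show ?thesis using assms(1) QSym_eq_span by blast
qed

section \<open>Comodules\<close>

lemma Delta_0_apply: "Delta n 0 x = 0"
  by (simp only: Delta_0 zero_fun_apply)

lemma Delta_add_apply:
  "f \<in> QSym n \<Longrightarrow> g \<in> QSym n \<Longrightarrow> Delta n (f + g) x = Delta n f x + Delta n g x"
  by (simp only: Delta_add plus_fun_apply)

lemma Delta_scale_apply: "f \<in> QSym n \<Longrightarrow> Delta n (zscale c f) x = c * Delta n f x"
  by (simp only: Delta_scale) (simp only: zscale_def)

lemma slice_F_Des:
  assumes "\<pi> permutes {1..n}"
  shows "(\<lambda>X. Delta n (F n (Des n \<pi>)) (X, P)) =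
      (\<Sum>\<sigma>\<in>perms n. zscale (F n (Des n \<sigma>) P) (F n (Des n (inv \<sigma> \<circ> \<pi>))))"
    and "(\<lambda>Y. Delta n (F n (Des n \<pi>)) (M, Y)) =
      (\<Sum>\<sigma>\<in>perms n. zscale (F n (Des n (inv \<sigma> \<circ> \<pi>)) M) (F n (Des n \<sigma>)))"
  by (rule ext, simp only: Delta_F_Des[OF assms] comul_def sum_zscale_apply mult.commute)+

text \<open>The iterated coproduct in coassociativity is applied to slices, and the linearity lemmas
  for \<open>Delta n\<close> require their arguments to lie in \<open>QSym n\<close>.\<close>

lemma slice_in_QSym:
  assumes "f \<in> QSym n"
  shows "(\<lambda>X. Delta n f (X, P)) \<in> QSym n" "(\<lambda>Y. Delta n f (M, Y)) \<in> QSym n"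
proof -
  have "(\<lambda>X. Delta n f (X, P)) \<in> QSym n \<and> (\<lambda>Y. Delta n f (M, Y)) \<in> QSym n"
    using assms
  proof (induction rule: QSym_induct)
    case zero
    show ?case using zmod.subspace_0[OF subspace_QSym, of n]
      unfolding Delta_0_apply unfolding zero_fun_def by blast
  next
    case (add f g)
    then show ?case
      using zmod.subspace_add[OF subspace_QSym, of "\<lambda>X. Delta n f (X, P)" n "\<lambda>X. Delta n g (X, P)"]
        zmod.subspace_add[OF subspace_QSym, of "\<lambda>X. Delta n f (M, X)" n "\<lambda>X. Delta n g (M, X)"]
      by (simp only: Delta_add_apply) (simp only: plus_fun_def)
  next
    case (scale c f)
    then show ?case
      using zmod.subspace_scale[OF subspace_QSym, of "\<lambda>X. Delta n f (X, P)" n c]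
        zmod.subspace_scale[OF subspace_QSym, of "\<lambda>X. Delta n f (M, X)" n c]
      by (simp only: Delta_scale_apply) (simp only: zscale_def)
  next
    case (Des \<pi>)
    then show ?case unfolding slice_F_Des[OF Des]
      by (intro conjI zmod.subspace_sum zmod.subspace_scale subspace_QSym F_in_QSym Des_subset)
  qed
  then show "(\<lambda>X. Delta n f (X, P)) \<in> QSym n" "(\<lambda>Y. Delta n f (M, Y)) \<in> QSym n" by auto
qed

lemma Delta_sum_F_Des:
  assumes "\<And>\<sigma>. \<sigma> \<in> S \<Longrightarrow> g \<sigma> permutes {1..n}"
  shows "Delta n (\<Sum>\<sigma>\<in>S. zscale (c \<sigma>) (F n (Des n (g \<sigma>)))) (M, N) = (\<Sum>\<sigma>\<in>S. c \<sigma> * comul n (g \<sigma>) M N)"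
proof -
  have "Delta n (\<Sum>\<sigma>\<in>S. zscale (c \<sigma>) (F n (Des n (g \<sigma>)))) (M, N)
      = (\<Sum>\<sigma>\<in>S. Delta n (zscale (c \<sigma>) (F n (Des n (g \<sigma>)))) (M, N))"
    by (subst Delta_sum) (simp_all only: zmod.subspace_scale[OF subspace_QSym] F_in_QSym Des_subset sum_fun_apply)
  also have "\<dots> = (\<Sum>\<sigma>\<in>S. c \<sigma> * comul n (g \<sigma>) M N)"
    using assms by (intro sum.cong refl)
      (simp only: Delta_scale_apply[OF F_in_QSym[OF Des_subset]] Delta_F_Des)
  finally show ?thesis .
qed

text \<open>On a basis element both sides are the sum over all factorizations of
  \<open>\<pi>\<close> into three permutations; coassociativity comes from associativity of
  composition.\<close>

lemma Delta_coassoc: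
  assumes "f \<in> QSym n"
  shows "Delta n (\<lambda>X. Delta n f (X, P)) (M, N) = Delta n (\<lambda>Y. Delta n f (M, Y)) (N, P)"
  using assms
proof (induction rule: QSym_induct)
  case zero
  have "(\<lambda>X. 0 :: int) = (0 :: nat multiset \<Rightarrow> int)" by (simp add: zero_fun_def)
  then show ?case by (simp only: Delta_0_apply)
next
  case (add f g)
  have "(\<lambda>X. Delta n (f + g) (X, P)) = (\<lambda>X. Delta n f (X, P)) + (\<lambda>X. Delta n g (X, P))"
    "(\<lambda>Y. Delta n (f + g) (M, Y)) = (\<lambda>Y. Delta n f (M, Y)) + (\<lambda>Y. Delta n g (M, Y))"
    by (rule ext, simp only: Delta_add_apply[OF add.hyps(1,2)] plus_fun_apply)+
  then show ?case using add by (simp only: Delta_add_apply slice_in_QSym)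
next
  case (scale c f)
  have "(\<lambda>X. Delta n (zscale c f) (X, P)) = zscale c (\<lambda>X. Delta n f (X, P))"
    "(\<lambda>Y. Delta n (zscale c f) (M, Y)) = zscale c (\<lambda>Y. Delta n f (M, Y))"
    by (rule ext, simp only: Delta_scale_apply[OF scale.hyps(1)], simp only: zscale_def)+
  then show ?case using scale by (simp only: Delta_scale_apply slice_in_QSym)
next
  case (Des \<pi>)
  have "Delta n (\<lambda>X. Delta n (F n (Des n \<pi>)) (X, P)) (M, N)
      = (\<Sum>\<sigma>\<in>perms n. F n (Des n \<sigma>) P * comul n (inv \<sigma> \<circ> \<pi>) M N)"
    unfolding slice_F_Des(1)[OF Des]
    using permutes_compose[OF Des permutes_inv] by (intro Delta_sum_F_Des) simp
  also have "\<dots> = (\<Sum>\<sigma>\<in>perms n. \<Sum>\<rho>\<in>perms n.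
      F n (Des n \<sigma>) P * (F n (Des n (inv \<rho> \<circ> \<pi>)) M * F n (Des n (inv \<sigma> \<circ> \<rho>)) N))"
  proof (rule sum.cong[OF refl])
    fix \<sigma> assume "\<sigma> \<in> perms n"
    then have \<sigma>: "\<sigma> permutes {1..n}" by simp
    have "comul n (inv \<sigma> \<circ> \<pi>) M N = (\<Sum>\<rho>\<in>perms n. F n (Des n (inv \<rho> \<circ> \<pi>)) M * F n (Des n (inv \<sigma> \<circ> \<rho>)) N)"
      unfolding comul_def
    \<comment> \<open>Passing from \<open>\<tau>\<close> to the partial product
      \<open>\<rho> = \<sigma> \<circ> \<tau>\<close> displays the three factors as
      \<open>\<sigma>\<close>, \<open>inv \<sigma> \<circ> \<rho>\<close> and
      \<open>inv \<rho> \<circ> \<pi>\<close>, independently of the bracketing.\<close>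
    proof (rule sum.reindex_bij_witness[of _ "\<lambda>\<rho>. inv \<sigma> \<circ> \<rho>" "\<lambda>\<tau>. \<sigma> \<circ> \<tau>"])
      fix \<tau> assume "\<tau> \<in> perms n"
      then have \<tau>: "\<tau> permutes {1..n}" by simp
      show "inv \<sigma> \<circ> (\<sigma> \<circ> \<tau>) = \<tau>" "\<sigma> \<circ> (inv \<sigma> \<circ> \<tau>) = \<tau>"
        using permutes_inv_o[OF \<sigma>] by (metis comp_assoc id_comp)+
      show "\<sigma> \<circ> \<tau> \<in> perms n" "inv \<sigma> \<circ> \<tau> \<in> perms n"
        using permutes_compose[OF \<tau> \<sigma>] permutes_compose[OF \<tau> permutes_inv[OF \<sigma>]] by auto
      have "inv (\<sigma> \<circ> \<tau>) = inv \<tau> \<circ> inv \<sigma>"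
        using permutes_bij[OF \<sigma>] permutes_bij[OF \<tau>] by (rule o_inv_distrib)
      then have "inv (\<sigma> \<circ> \<tau>) \<circ> \<pi> = inv \<tau> \<circ> (inv \<sigma> \<circ> \<pi>)" by (simp only: comp_assoc)
      then show "F n (Des n (inv (\<sigma> \<circ> \<tau>) \<circ> \<pi>)) M * F n (Des n (inv \<sigma> \<circ> (\<sigma> \<circ> \<tau>))) N
          = F n (Des n (inv \<tau> \<circ> (inv \<sigma> \<circ> \<pi>))) M * F n (Des n \<tau>) N"
        using \<open>inv \<sigma> \<circ> (\<sigma> \<circ> \<tau>) = \<tau>\<close> by (simp only:)
    qed
    then show "F n (Des n \<sigma>) P * comul n (inv \<sigma> \<circ> \<pi>) M N = (\<Sum>\<rho>\<in>perms n.
      F n (Des n \<sigma>) P * (F n (Des n (inv \<rho> \<circ> \<pi>)) M * F n (Des n (inv \<sigma> \<circ> \<rho>)) N))"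
      by (simp only: sum_distrib_left)
  qed
  also have "\<dots> = (\<Sum>\<rho>\<in>perms n. \<Sum>\<sigma>\<in>perms n.
      F n (Des n \<sigma>) P * (F n (Des n (inv \<rho> \<circ> \<pi>)) M * F n (Des n (inv \<sigma> \<circ> \<rho>)) N))"
    by (rule sum.swap)
  also have "\<dots> = (\<Sum>\<rho>\<in>perms n. F n (Des n (inv \<rho> \<circ> \<pi>)) M * comul n \<rho> N P)"
    unfolding comul_def sum_distrib_left by (intro sum.cong refl) (simp only: mult_ac)
  also have "\<dots> = Delta n (\<lambda>Y. Delta n (F n (Des n \<pi>)) (M, Y)) (N, P)"
    unfolding slice_F_Des(2)[OF Des] by (rule Delta_sum_F_Des[symmetric]) simp
  finally show ?case .
qed

text \<open>With a single second variable the word of second indices is constant. Only the clause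
  for equal neighbours can hold, and it says that all descents of \<open>\<pi>\<close> are ascents
  of \<open>M\<close>.\<close>

lemma Delta_counit:
  assumes "f \<in> QSym n"
  shows "counit n (\<lambda>Y. Delta n f (M, Y)) = f M"
  using assms
proof (induction rule: QSym_induct)
  case (Des \<pi>)
  let ?N = "replicate_mset n 0"
  have F: "F n (Des n \<pi>) M = (if size M = n \<and> Des n \<pi> \<subseteq> asc M then 1 else 0)"
    by (rule F_eq[OF Des_subset])
  show ?case
  proof (cases "size M = n")
    case True
    have "biwords n (Des n \<pi>) M ?N = (if Des n \<pi> \<subseteq> asc M then {replicate n 0} else {})"
    proof -
      have "y \<in> biwords n (Des n \<pi>) M ?N \<longleftrightarrow> y = replicate n 0 \<and> Des n \<pi> \<subseteq> asc M" for y
      proof -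
        have "length y = n \<and> mset y = ?N \<longleftrightarrow> y = replicate n 0"
        proof
          assume y: "length y = n \<and> mset y = ?N"
          then have "set y \<subseteq> {0}" by (metis set_mset_mset set_mset_replicate_mset_subset order_refl empty_subsetI)
          then show "y = replicate n 0" using y by (intro replicate_eqI) auto
        qed simp
        moreover have "(\<forall>k\<in>{1..<n} - asc M. k \<notin> Des n \<pi>) \<longleftrightarrow> Des n \<pi> \<subseteq> asc M"
          using Des_subset[of n \<pi>] by blast
        moreover have "replicate n (0::nat) ! (k - 1) = replicate n 0 ! k" if "k \<in> {1..<n} - asc M" for k
          using that by auto
        ultimately show ?thesis unfolding biwords_def by auto
      qed
      then show ?thesis by auto
    qed
    then show ?thesis
      using comul_eq_card[OF Des True, of ?N] F True by (simp add: counit_def Delta_F_Des[OF Des])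
  next
    case False
    then show ?thesis using F by (simp add: counit_def Delta_F_Des[OF Des] comul_eq_0)
  qed
next
  case zero
  show ?case unfolding counit_def Delta_0_apply by (rule zero_fun_apply[symmetric])
next
  case (add f g)
  then show ?case by (simp only: counit_def Delta_add_apply) (simp only: plus_fun_apply)
next
  case (scale c f)
  then show ?case by (simp only: counit_def Delta_scale_apply) (simp only: zscale_def)
qed

lemma subspace_tensor_group: "zmod.subspace (tensor_group A B)"
  unfolding tensor_group_def by (rule zmod.subspace_span)

lemma tens_in_tensor_group: "f \<in> A \<Longrightarrow> g \<in> B \<Longrightarrow> f \<otimes> g \<in> tensor_group A B"
  unfolding tensor_group_def by (rule zmod.span_base) blast

lemma tensor_group_mono: "A \<subseteq> A' \<Longrightarrow> B \<subseteq> B' \<Longrightarrow> tensor_group A B \<subseteq> tensor_group A' B'"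
  unfolding tensor_group_def by (rule zmod.span_mono) blast

text \<open>Linearity of \<open>Delta n\<close> is available on \<open>QSym n\<close>, so the
  subspace that is to contain the span is cut out inside \<open>QSym n\<close>.\<close>

lemma Delta_span_subset:
  assumes "S \<subseteq> QSym n" "zmod.subspace T" "\<And>f. f \<in> S \<Longrightarrow> Delta n f \<in> T"
  shows "Delta n ` zmod.span S \<subseteq> T"
proof -
  have "zmod.subspace {f \<in> QSym n. Delta n f \<in> T}"
  proof (rule zmod.subspaceI)
    show "0 \<in> {f \<in> QSym n. Delta n f \<in> T}"
      using zmod.subspace_0[OF assms(2)] zmod.subspace_0[OF subspace_QSym] by (simp only: Delta_0 mem_Collect_eq)
  next
    fix f g assume "f \<in> {f \<in> QSym n. Delta n f \<in> T}" "g \<in> {f \<in> QSym n. Delta n f \<in> T}"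
    then show "f + g \<in> {f \<in> QSym n. Delta n f \<in> T}"
      using zmod.subspace_add[OF assms(2)] zmod.subspace_add[OF subspace_QSym]
      by (simp only: Delta_add mem_Collect_eq)
  next
    fix c f assume "f \<in> {f \<in> QSym n. Delta n f \<in> T}"
    then show "zscale c f \<in> {f \<in> QSym n. Delta n f \<in> T}"
      using zmod.subspace_scale[OF assms(2)] zmod.subspace_scale[OF subspace_QSym]
      by (simp only: Delta_scale mem_Collect_eq)
  qed
  moreover have "S \<subseteq> {f \<in> QSym n. Delta n f \<in> T}" using assms(1,3) by blast
  ultimately have "zmod.span S \<subseteq> {f \<in> QSym n. Delta n f \<in> T}" by (intro zmod.span_minimal)
  then show ?thesis by blast
qed

lemma Delta_QSym: "Delta n ` QSym n \<subseteq> tensor_group (QSym n) (QSym n)"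
  unfolding QSym_eq_span[of n]
proof (rule Delta_span_subset)
  show "F n ` Pow {1..<n} \<subseteq> QSym n" using F_in_QSym by blast
  fix f assume "f \<in> F n ` Pow {1..<n}"
  then obtain K where K: "K \<subseteq> {1..<n}" "f = F n K" by blast
  show "Delta n f \<in> tensor_group (zmod.span (F n ` Pow {1..<n})) (zmod.span (F n ` Pow {1..<n}))"
    unfolding K(2) Delta_F[OF K(1)]
    by (intro zmod.subspace_sum zmod.subspace_scale subspace_tensor_group tens_in_tensor_group
        zmod.span_base imageI)
qed (rule subspace_tensor_group)

lemma right_comoduleI:
  assumes "zmod.subspace V" "V \<subseteq> QSym n" "Delta n ` V \<subseteq> tensor_group V (QSym n)"
  shows "right_comodule n V"
  unfolding right_comodule_def
  using assms(1,3) subsetD[OF assms(2)] Delta_coassoc Delta_counit assms(2) by metis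

section \<open>The coproduct of the cyclic fundamental functions\<close>

definition rot :: "nat \<Rightarrow> nat \<Rightarrow> nat \<Rightarrow> nat" where
  "rot n s i = (if i \<in> {1..n} then (csucc n ^^ s) i else i)"

lemma rot_permutes: "rot n s permutes {1..n}"
proof (rule bij_imp_permutes)
  have "rot n s ` {1..n} \<subseteq> {1..n}" using csucc_pow_mem by (auto simp: rot_def)
  moreover have "inj_on (rot n s) {1..n}"
    using inj_on_csucc_pow[of s n] by (rule iffD2[OF inj_on_cong, rotated]) (simp add: rot_def)
  ultimately show "bij_betw (rot n s) {1..n} {1..n}"
    using endo_inj_surj[of "{1..n}" "rot n s"] by (simp add: bij_betw_def)
  show "rot n s i = i" if "i \<notin> {1..n}" for i
    using that unfolding rot_def by presburger
qed

lemma cDes_subset: "cDes n \<pi> \<subseteq> {1..n}"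
  by (auto simp: cDes_def)

text \<open>Reading \<open>\<pi>\<close> cyclically from another starting point shifts its cyclic
  descents. The descent that would straddle the new end sits at n, where \<open>Des\<close> does not
  look.\<close>

lemma Des_rot:
  assumes "s < n"
  shows "Des n (\<pi> \<circ> rot n (n - s)) = cshift n s (cDes n \<pi>) - {n}"
proof -
  have iff: "i \<in> Des n (\<pi> \<circ> rot n (n - s)) \<longleftrightarrow> i \<in> cshift n s (cDes n \<pi>)" if i: "i \<in> {1..<n}" for i
  proof -
    have i': "i \<in> {1..n}" "i + 1 \<in> {1..n}" "csucc n i = i + 1" using i by (auto simp: csucc_def)
    define c where "c = (csucc n ^^ (n - s)) i"
    have c: "c \<in> {1..n}" unfolding c_def using csucc_pow_mem[OF i'(1)] .
    have ci: "(csucc n ^^ s) c = i"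
      unfolding c_def funpow_add[symmetric, THEN fun_cong, simplified comp_def]
      using assms by (intro csucc_pow_n[OF i'(1)]) simp
    have "(csucc n ^^ (n - s)) (i + 1) = csucc n c"
      unfolding c_def i'(3)[symmetric] by (rule funpow_swap1[symmetric])
    then have "i \<in> Des n (\<pi> \<circ> rot n (n - s)) \<longleftrightarrow> c \<in> cDes n \<pi>"
      using i i' c by (simp add: Des_def cDes_def rot_def c_def)
    also have "\<dots> \<longleftrightarrow> i \<in> cshift n s (cDes n \<pi>)"
    proof
      assume "c \<in> cDes n \<pi>"
      then show "i \<in> cshift n s (cDes n \<pi>)" unfolding cshift_def using ci by (metis imageI)
    next
      assume "i \<in> cshift n s (cDes n \<pi>)"
      then obtain c' where c': "c' \<in> cDes n \<pi>" "i = (csucc n ^^ s) c'" unfolding cshift_def by blast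
      have "c' \<in> {1..n}" using c'(1) cDes_subset by blast
      then have "c' = c" using inj_onD[OF inj_on_csucc_pow, of s n c' c] ci c c'(2) by metis
      then show "c \<in> cDes n \<pi>" using c' by simp
    qed
    finally show ?thesis .
  qed
  show ?thesis
  proof (intro equalityI subsetI)
    fix i assume i: "i \<in> Des n (\<pi> \<circ> rot n (n - s))"
    then have "i \<in> {1..<n}" using Des_subset by (rule subsetD[rotated])
    then show "i \<in> cshift n s (cDes n \<pi>) - {n}" using iff i by simp
  next
    fix i assume i: "i \<in> cshift n s (cDes n \<pi>) - {n}"
    then have "i \<in> {1..n}" using cshift_subset[OF cDes_subset, of n s \<pi>] by blast
    then have "i \<in> {1..<n}" using i by auto
    then show "i \<in> Des n (\<pi> \<circ> rot n (n - s))" using iff i by simp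
  qed
qed

text \<open>Deleting n in \<open>Des_rot\<close> and adjoining n to the ascent set in
  \<open>Fcyc_eq\<close> impose the same condition, so the two sums agree shift by shift.\<close>

lemma Fcyc_cDes:
  assumes "0 < n"
  shows "Fcyc n (cDes n \<pi>) = (\<Sum>s<n. F n (Des n (\<pi> \<circ> rot n (n - s))))"
proof
  fix M
  have "(\<Sum>s<n. F n (Des n (\<pi> \<circ> rot n (n - s))) M) =
      (\<Sum>s<n. if size M = n \<and> cshift n s (cDes n \<pi>) \<subseteq> insert n (asc M) then 1 else 0)"
    unfolding F_eq[OF Des_subset] by (intro sum.cong refl) (simp add: Des_rot subset_insert_iff)
  also have "\<dots> = (if size M = n then int (card {s. s < n \<and> cshift n s (cDes n \<pi>) \<subseteq> insert n (asc M)}) else 0)"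
    by (simp add: sum.If_cases Int_def)
  finally show "Fcyc n (cDes n \<pi>) M = (\<Sum>s<n. F n (Des n (\<pi> \<circ> rot n (n - s)))) M"
    by (simp add: Fcyc_eq[OF assms cDes_subset] sum_fun_apply)
qed

lemma Delta_Fcyc_cDes:
  assumes "0 < n" and \<pi>: "\<pi> permutes {1..n}"
  shows "Delta n (Fcyc n (cDes n \<pi>)) (M, N) =
    (\<Sum>\<sigma>\<in>perms n. Fcyc n (cDes n (inv \<sigma> \<circ> \<pi>)) M * F n (Des n \<sigma>) N)"
proof -
  have "Delta n (Fcyc n (cDes n \<pi>)) (M, N) = (\<Sum>s<n. comul n (\<pi> \<circ> rot n (n - s)) M N)"
    using Delta_sum_F_Des[of "{..<n}" "\<lambda>s. \<pi> \<circ> rot n (n - s)" n "\<lambda>s. 1" M N]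
      permutes_compose[OF rot_permutes \<pi>] by (simp add: Fcyc_cDes[OF assms(1)])
  also have "\<dots> = (\<Sum>\<sigma>\<in>perms n. \<Sum>s<n. F n (Des n (inv \<sigma> \<circ> \<pi> \<circ> rot n (n - s))) M * F n (Des n \<sigma>) N)"
    unfolding comul_def comp_assoc by (rule sum.swap)
  also have "\<dots> = (\<Sum>\<sigma>\<in>perms n. Fcyc n (cDes n (inv \<sigma> \<circ> \<pi>)) M * F n (Des n \<sigma>) N)"
    by (simp only: Fcyc_cDes[OF assms(1)] sum_fun_apply sum_distrib_right)
  finally show ?thesis .
qed

text \<open>The position of the value n is a cyclic descent and the position of the value 1 is not,
  so the cyclic descent set is nonempty and proper.\<close>

lemma cDes_orbit:
  assumes "1 < n" "\<pi> permutes {1..n}"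
  shows "cyc_orbit n (cDes n \<pi>) \<in> corbits n"
proof -
  have ne: "csucc n i \<noteq> i" "csucc n i \<in> {1..n}" if "i \<in> {1..n}" for i
    using that assms(1) by (auto simp: csucc_def)
  have \<pi>i: "inv \<pi> k \<in> {1..n}" "\<pi> (inv \<pi> k) = k" if "k \<in> {1..n}" for k
    using that permutes_in_image[OF permutes_inv[OF assms(2)]] permutes_inverses(1)[OF assms(2)] by blast+
  have mem: "\<pi> (csucc n i) \<in> {1..n}" "\<pi> (csucc n i) \<noteq> \<pi> i" if "i \<in> {1..n}" for i
    using permutes_in_image[OF assms(2)] ne[OF that] permutes_inj[OF assms(2)] by (auto simp: inj_eq)
  have n1: "n \<in> {1..n}" "1 \<in> {1..n}" using assms(1) by auto
  have "inv \<pi> n \<in> cDes n \<pi>"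
    using mem[OF \<pi>i(1)[OF n1(1)]] \<pi>i[OF n1(1)] by (auto simp: cDes_def)
  moreover have "inv \<pi> 1 \<notin> cDes n \<pi>"
    using mem[OF \<pi>i(1)[OF n1(2)]] \<pi>i[OF n1(2)] by (auto simp: cDes_def)
  ultimately have "cDes n \<pi> \<noteq> {}" "cDes n \<pi> \<noteq> {1..n}" using \<pi>i(1)[OF n1(2)] by auto
  then show ?thesis unfolding corbits_eq using cDes_subset by blast
qed

lemma Fcyc_eq_orb_Fhat:
  assumes "0 < n" "A \<in> cyc_orbits n" "K \<in> A"
  shows "Fcyc n K M = int (orb_d n A) * orb_Fhat n A M"
  using Fcyc_eq_Fhat[OF assms(1) cyc_orbitsE(1)[OF assms]] orb_Fhat_eq_Fhat[OF assms] orb_d_eq[OF assms]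
  by simp

lemma orb_d_pos: "0 < n \<Longrightarrow> 0 < orb_d n A"
  by (simp add: orb_d_def stab_order_pos)

lemma orb_Fhat_in_QSym:
  assumes "0 < n" "A \<in> cyc_orbits n"
  shows "orb_Fhat n A \<in> QSym n"
  unfolding orb_Fhat_def
  using Fhat_in_cQSym[OF assms(1) cyc_orbitsE(1)[OF assms cyc_orbits_nonempty[OF assms]]]
    cQSym_subset_QSym by blast

text \<open>Kept multiplied by \<open>orb_d n B\<close>, the formula has evidently integral
  coefficients and a left side that does not mention \<open>\<pi>\<close>. Independence of
  \<open>\<pi>\<close> and divisibility are both read off from this form.\<close>

lemma Delta_orb_Fhat_scaled:
  assumes n: "1 < n" and B: "B \<in> corbits n" and \<pi>: "\<pi> permutes {1..n}" "cDes n \<pi> \<in> B"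
  shows "int (orb_d n B) * Delta n (orb_Fhat n B) (M, N) =
    (\<Sum>A\<in>corbits n. \<Sum>J\<in>Pow {1..<n}.
      (int (cyc_count n \<pi> A J) * int (orb_d n A)) * (orb_Fhat n A M * F n J N))"
proof -
  have n0: "0 < n" using n by simp
  have B1: "B \<in> cyc_orbits n" using B corbits_subset by blast
  let ?R = "corbits n \<times> Pow {1..<n}"
  let ?f = "\<lambda>(A, J). int (orb_d n A) * (orb_Fhat n A M * F n J N)"
  let ?g = "\<lambda>\<sigma>. (cyc_orbit n (cDes n (inv \<sigma> \<circ> \<pi>)), Des n \<sigma>)"
  have "Fcyc n (cDes n \<pi>) = zscale (int (orb_d n B)) (orb_Fhat n B)"
    using Fcyc_eq_orb_Fhat[OF n0 B1 \<pi>(2)] by (simp add: zscale_def fun_eq_iff)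
  then have "int (orb_d n B) * Delta n (orb_Fhat n B) (M, N) = Delta n (Fcyc n (cDes n \<pi>)) (M, N)"
    by (simp only: Delta_scale_apply[OF orb_Fhat_in_QSym[OF n0 B1]])
  also have "\<dots> = (\<Sum>\<sigma>\<in>perms n. ?f (?g \<sigma>))"
    unfolding Delta_Fcyc_cDes[OF n0 \<pi>(1)]
  proof (rule sum.cong[OF refl])
    fix \<sigma> assume "\<sigma> \<in> perms n"
    then have "inv \<sigma> \<circ> \<pi> permutes {1..n}" using permutes_compose[OF \<pi>(1) permutes_inv] by simp
    from cDes_orbit[OF n this] have "cyc_orbit n (cDes n (inv \<sigma> \<circ> \<pi>)) \<in> cyc_orbits n"
      using corbits_subset by blast
    from Fcyc_eq_orb_Fhat[OF n0 this self_in_cyc_orbit[OF n0], of M]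
    show "Fcyc n (cDes n (inv \<sigma> \<circ> \<pi>)) M * F n (Des n \<sigma>) N = ?f (?g \<sigma>)" by simp
  qed
  \<comment> \<open>The factorizations are grouped by the orbit of the cyclic descents of the right
    factor and by the descent set of the left one.\<close>
  also have "\<dots> = (\<Sum>x\<in>?R. of_nat (card {\<sigma> \<in> perms n. ?g \<sigma> = x}) * ?f x)"
  proof (rule sum_fun_comp)
    show "?g ` perms n \<subseteq> ?R"
      using cDes_orbit[OF n permutes_compose[OF \<pi>(1) permutes_inv]] Des_in_Pow by blast
  qed simp_all
  also have "\<dots> = (\<Sum>(A, J)\<in>?R. (int (cyc_count n \<pi> A J) * int (orb_d n A)) * (orb_Fhat n A M * F n J N))"
  proof (rule sum.cong[OF refl])
    fix x assume "x \<in> ?R"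
    then obtain A J where x: "x = (A, J)" "A \<in> corbits n" "J \<subseteq> {1..<n}" by blast
    then have A: "A \<in> cyc_orbits n" using corbits_subset by blast
    have "cDes n \<rho> \<in> A \<longleftrightarrow> cyc_orbit n (cDes n \<rho>) = A" for \<rho>
      using cyc_orbitsE(3)[OF n0 A] self_in_cyc_orbit[OF n0] by metis
    then have "{\<sigma> \<in> perms n. ?g \<sigma> = x} = {\<sigma> \<in> perms n. cDes n (inv \<sigma> \<circ> \<pi>) \<in> A \<and> Des n \<sigma> = J}"
      by (simp add: x(1))
    also have "card \<dots> = cyc_count n \<pi> A J"
      unfolding cyc_count_def
      by (rule card_factorizations[OF \<pi>(1), of "\<lambda>\<rho>. cDes n \<rho> \<in> A" "\<lambda>\<sigma>. Des n \<sigma> = J", symmetric])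
    finally show "of_nat (card {\<sigma> \<in> perms n. ?g \<sigma> = x}) * ?f x = (case x of (A, J) \<Rightarrow>
        (int (cyc_count n \<pi> A J) * int (orb_d n A)) * (orb_Fhat n A M * F n J N))"
      by (simp add: x(1))
  qed
  finally show ?thesis by (simp add: sum.cartesian_product)
qed

text \<open>Two permutations give two expansions of the same series; coefficients are compared and
  the positive factor \<open>orb_d n A\<close> is cancelled.\<close>

lemma cyc_count_indep:
  assumes "1 < n" "B \<in> corbits n" "A \<in> corbits n" "J \<subseteq> {1..<n}"
    and "\<pi> permutes {1..n}" "cDes n \<pi> \<in> B" "\<pi>' permutes {1..n}" "cDes n \<pi>' \<in> B"
  shows "cyc_count n \<pi> A J = cyc_count n \<pi>' A J"
proof -
  have n0: "0 < n" using assms(1) by simp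
  have "int (cyc_count n \<pi> A J) * int (orb_d n A) = int (cyc_count n \<pi>' A J) * int (orb_d n A)"
  proof (rule triangular_coeffs2_unique[OF triangular_orb_Fhat[OF n0 corbits_subset] Ftri.triangular_axioms])
    show "J \<in> Pow {1..<n}" using assms(4) by simp
    show "(\<Sum>A\<in>corbits n. \<Sum>J\<in>Pow {1..<n}. int (cyc_count n \<pi> A J) * int (orb_d n A) * (orb_Fhat n A M * F n J N))
      = (\<Sum>A\<in>corbits n. \<Sum>J\<in>Pow {1..<n}. int (cyc_count n \<pi>' A J) * int (orb_d n A) * (orb_Fhat n A M * F n J N))" for M N
      using Delta_orb_Fhat_scaled[OF assms(1,2,5,6)] Delta_orb_Fhat_scaled[OF assms(1,2,7,8)] by metis
  qed (rule assms(3))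
  then show ?thesis using orb_d_pos[OF n0, of A] by simp
qed

lemma atilde_eq:
  assumes "1 < n" "B \<in> corbits n" "A \<in> corbits n" "J \<subseteq> {1..<n}" "\<pi> permutes {1..n}" "cDes n \<pi> \<in> B"
  shows "cyc_count n \<pi> A J = atilde n B A J"
  unfolding atilde_def
  using someI_ex[OF ex_cDes[OF assms(1,2)]] by (intro cyc_count_indep[OF assms]) auto

text \<open>The expansion in \<open>Delta_orb_Fhat_scaled\<close> takes only values divisible by
  \<open>orb_d n B\<close>, so each coefficient is divisible by it.\<close>

lemma struct_const_dvd:
  assumes n: "1 < n" and B: "B \<in> corbits n" and A: "A \<in> corbits n" and J: "J \<subseteq> {1..<n}"
  shows "orb_d n B dvd orb_d n A * atilde n B A J"
proof -
  have n0: "0 < n" using n by simp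
  obtain \<pi> where \<pi>: "\<pi> permutes {1..n}" "cDes n \<pi> \<in> B" using ex_cDes[OF n B] by blast
  have "int (orb_d n B) dvd int (cyc_count n \<pi> A J) * int (orb_d n A)"
  proof (rule triangular_dvd_coeffs2[OF triangular_orb_Fhat[OF n0 corbits_subset] Ftri.triangular_axioms])
    show "J \<in> Pow {1..<n}" using J by simp
    show "int (orb_d n B) dvd (\<Sum>A\<in>corbits n. \<Sum>J\<in>Pow {1..<n}.
        int (cyc_count n \<pi> A J) * int (orb_d n A) * (orb_Fhat n A M * F n J N))" for M N
      using Delta_orb_Fhat_scaled[OF n B \<pi>, of M N] dvd_triv_left by metis
  qed (rule A)
  then have "int (orb_d n B) dvd int (orb_d n A * atilde n B A J)"
    using atilde_eq[OF n B A J \<pi>] by (simp add: mult.commute)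
  then show ?thesis by (simp only: int_dvd_int_iff)
qed

lemma struct_const_eq:
  assumes "1 < n" "B \<in> corbits n" "A \<in> corbits n" "J \<subseteq> {1..<n}"
  shows "struct_const n B A J = of_nat (orb_d n A * atilde n B A J div orb_d n B)"
proof -
  have pos: "orb_d n B \<noteq> 0" using orb_d_pos[of n B] assms(1) by simp
  obtain k where k: "orb_d n A * atilde n B A J = orb_d n B * k"
    using struct_const_dvd[OF assms] by (elim dvdE)
  have "struct_const n B A J = of_nat (orb_d n A * atilde n B A J) / of_nat (orb_d n B)"
    by (simp add: struct_const_def)
  then show ?thesis using pos unfolding k by simp
qed

lemma Delta_orb_Fhat:
  assumes n: "1 < n" and B: "B \<in> corbits n"
  shows "Delta n (orb_Fhat n B) = (\<Sum>A\<in>corbits n. \<Sum>J\<in>Pow {1..<n}.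
    zscale \<lfloor>struct_const n B A J\<rfloor> (orb_Fhat n A \<otimes> F n J))"
proof (rule ext, clarify)
  fix M N
  have n0: "0 < n" using n by simp
  obtain \<pi> where \<pi>: "\<pi> permutes {1..n}" "cDes n \<pi> \<in> B" using ex_cDes[OF n B] by blast
  \<comment> \<open>The constant is an integer by \<open>struct_const_dvd\<close>, so taking its
    floor loses nothing and multiplying back by \<open>orb_d n B\<close> recovers the counted
    coefficient.\<close>
  have c: "int (cyc_count n \<pi> A J) * int (orb_d n A) = int (orb_d n B) * \<lfloor>struct_const n B A J\<rfloor>"
    if "A \<in> corbits n" "J \<in> Pow {1..<n}" for A J
  proof -
    have J: "J \<subseteq> {1..<n}" using that by simp
    have "int (orb_d n B) * \<lfloor>struct_const n B A J\<rfloor> = int (orb_d n B * (orb_d n A * atilde n B A J div orb_d n B))"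
      by (simp only: struct_const_eq[OF n B that(1) J] floor_of_nat of_nat_mult)
    also have "\<dots> = int (orb_d n A * atilde n B A J)"
      using struct_const_dvd[OF n B that(1) J] by (simp only: dvd_mult_div_cancel)
    finally show ?thesis using atilde_eq[OF n B that(1) J \<pi>] by simp
  qed
  have "int (orb_d n B) * Delta n (orb_Fhat n B) (M, N) = (\<Sum>A\<in>corbits n. \<Sum>J\<in>Pow {1..<n}.
      int (orb_d n B) * \<lfloor>struct_const n B A J\<rfloor> * (orb_Fhat n A M * F n J N))"
    unfolding Delta_orb_Fhat_scaled[OF n B \<pi>] using c by (intro sum.cong refl) simp
  also have "\<dots> = int (orb_d n B) * (\<Sum>A\<in>corbits n. \<Sum>J\<in>Pow {1..<n}.
      \<lfloor>struct_const n B A J\<rfloor> * (orb_Fhat n A M * F n J N))"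
    by (simp only: sum_distrib_left mult.assoc)
  finally have "Delta n (orb_Fhat n B) (M, N) = (\<Sum>A\<in>corbits n. \<Sum>J\<in>Pow {1..<n}.
      \<lfloor>struct_const n B A J\<rfloor> * (orb_Fhat n A M * F n J N))"
    using orb_d_pos[OF n0, of B] by simp
  then show "Delta n (orb_Fhat n B) (M, N) = (\<Sum>A\<in>corbits n. \<Sum>J\<in>Pow {1..<n}.
    zscale \<lfloor>struct_const n B A J\<rfloor> (orb_Fhat n A \<otimes> F n J)) (M, N)"
    by (simp add: sum_fun_apply zscale_def tens_def)
qed

section \<open>The coproducts of the complete and elementary symmetric functions\<close>

text \<open>For a transitive relation neighbours suffice. At an ascent of \<open>w\<close> the first
  entries already decide; elsewhere they are equal and only \<open>r\<close> on the second entries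
  is tested. This covers the weak and the strict lexicographic order at once.\<close>

lemma sorted_zip_iff:
  fixes w y :: "nat list" and r :: "nat \<Rightarrow> nat \<Rightarrow> bool"
  assumes "sorted w" "length w = n" "length y = n"
    and R: "\<And>a b. R a b \<longleftrightarrow> fst a < fst b \<or> fst a \<le> fst b \<and> r (snd a) (snd b)" "transp R"
  shows "sorted_wrt R (zip w y) \<longleftrightarrow> (\<forall>k\<in>{1..<n} - ascents w. r (y ! (k - 1)) (y ! k))"
proof -
  have "sorted_wrt R (zip w y) \<longleftrightarrow> (\<forall>i. Suc i < n \<longrightarrow> R (zip w y ! i) (zip w y ! Suc i))"
    using sorted_wrt_iff_nth_Suc_transp[OF R(2), of "zip w y"] assms(2,3) by simp
  also have "\<dots> \<longleftrightarrow> (\<forall>i. Suc i < n \<longrightarrow> Suc i \<notin> ascents w \<longrightarrow> r (y ! i) (y ! Suc i))"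
  proof (intro all_cong1 imp_cong refl)
    fix i assume i: "Suc i < n"
    then have "w ! i \<le> w ! Suc i" using assms(1,2) by (intro sorted_nth_mono) auto
    then show "R (zip w y ! i) (zip w y ! Suc i) \<longleftrightarrow> (Suc i \<notin> ascents w \<longrightarrow> r (y ! i) (y ! Suc i))"
      using i assms(2,3) by (auto simp: R(1) ascents_def)
  qed
  also have "\<dots> \<longleftrightarrow> (\<forall>k\<in>{1..<n} - ascents w. r (y ! (k - 1)) (y ! k))"
  proof
    assume *: "\<forall>i. Suc i < n \<longrightarrow> Suc i \<notin> ascents w \<longrightarrow> r (y ! i) (y ! Suc i)"
    show "\<forall>k\<in>{1..<n} - ascents w. r (y ! (k - 1)) (y ! k)"
    proof
      fix k assume "k \<in> {1..<n} - ascents w"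
      then show "r (y ! (k - 1)) (y ! k)" using *[rule_format, of "k - 1"] by simp
    qed
  next
    assume *: "\<forall>k\<in>{1..<n} - ascents w. r (y ! (k - 1)) (y ! k)"
    show "\<forall>i. Suc i < n \<longrightarrow> Suc i \<notin> ascents w \<longrightarrow> r (y ! i) (y ! Suc i)"
    proof (intro allI impI)
      fix i assume "Suc i < n" "Suc i \<notin> ascents w"
      then show "r (y ! i) (y ! Suc i)" using bspec[OF *, of "Suc i"] by simp
    qed
  qed
  finally show ?thesis .
qed

text \<open>A matrix with margins \<open>M\<close> and \<open>N\<close>, listed in lexicographic
  order, has the sorted list of \<open>M\<close> as its first row of indices, so it is determined by
  the second.\<close>

lemma card_sorted_zip:
  fixes R :: "nat \<times> nat \<Rightarrow> nat \<times> nat \<Rightarrow> bool"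
  assumes R: "\<And>xs. sorted_wrt R xs \<Longrightarrow> sorted xs" and M: "size M = n" and N: "size N = n"
  defines "w \<equiv> sorted_list_of_multiset M"
  shows "card {y. length y = n \<and> mset y = N \<and> sorted_wrt R (zip w y)} =
    card {P. image_mset fst P = M \<and> image_mset snd P = N \<and> sorted_wrt R (sorted_list_of_multiset P)}"
    (is "card ?Y = card ?P")
proof (rule bij_betw_same_card[of "\<lambda>y. mset (zip w y)"], rule bij_betw_byWitness[where f' = "\<lambda>P. map snd (sorted_list_of_multiset P)"])
  have w: "length w = n" "mset w = M" by (simp_all add: w_def M)
  have zip: "sorted_list_of_multiset (mset (zip w y)) = zip w y" if "y \<in> ?Y" for y
  proof -
    have "sorted (zip w y)" using that R by blast
    then show ?thesis by (rule sorted_list_of_multiset_unique[OF _ refl])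
  qed
  have fstP: "zip w (map snd (sorted_list_of_multiset P)) = sorted_list_of_multiset P" if P: "P \<in> ?P" for P
  proof -
    let ?xs = "sorted_list_of_multiset P"
    have "sorted ?xs" by simp
    then have "sorted (map fst ?xs)"
      unfolding sorted_map by (rule sorted_wrt_mono_rel[rotated]) (auto simp: less_eq_prod_def)
    moreover have "mset (map fst ?xs) = M" using P by simp
    ultimately have "w = map fst ?xs" unfolding w_def by (rule sorted_list_of_multiset_unique)
    then show ?thesis by (simp add: zip_map_fst_snd)
  qed
  show "\<forall>y\<in>?Y. map snd (sorted_list_of_multiset (mset (zip w y))) = y"
  proof
    fix y assume y: "y \<in> ?Y"
    then have "length w = length y" using w by simp
    then show "map snd (sorted_list_of_multiset (mset (zip w y))) = y" unfolding zip[OF y] by simp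
  qed
  show "\<forall>P\<in>?P. mset (zip w (map snd (sorted_list_of_multiset P))) = P"
  proof
    fix P assume "P \<in> ?P"
    then show "mset (zip w (map snd (sorted_list_of_multiset P))) = P"
      unfolding fstP[OF \<open>P \<in> ?P\<close>] by simp
  qed
  show "(\<lambda>y. mset (zip w y)) ` ?Y \<subseteq> ?P"
  proof (rule image_subsetI)
    fix y assume y: "y \<in> ?Y"
    have "image_mset fst (mset (zip w y)) = M" "image_mset snd (mset (zip w y)) = N"
      using y w by (simp_all flip: mset_map)
    then show "mset (zip w y) \<in> ?P" using y unfolding mem_Collect_eq zip[OF y] by simp
  qed
  show "(\<lambda>P. map snd (sorted_list_of_multiset P)) ` ?P \<subseteq> ?Y"
  proof (rule image_subsetI)
    fix P assume P: "P \<in> ?P"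
    then have N': "mset (map snd (sorted_list_of_multiset P)) = N" by simp
    then have "length (map snd (sorted_list_of_multiset P)) = n" using N size_mset by metis
    moreover have "sorted_wrt R (zip w (map snd (sorted_list_of_multiset P)))"
      unfolding fstP[OF P] using P by simp
    ultimately show "map snd (sorted_list_of_multiset P) \<in> ?Y" using N' by simp
  qed
qed

text \<open>For the empty set a pair of indices may be repeated, so all natural matrices occur; for
  the full set the list of pairs is strictly increasing, so every entry is 0 or 1.\<close>

lemma card_biwords_margins:
  assumes M: "size M = n" and N: "size N = n"
  shows "card (biwords n {} M N) = card (margins UNIV M N)"
    and "card (biwords n {1..<n} M N) = card (margins {0, 1} M N)"
proof -
  define w where "w = sorted_list_of_multiset M"
  have w: "sorted w" "length w = n" "asc M = ascents w" by (simp_all add: w_def M asc_def)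
  have "biwords n {} M N = {y. length y = n \<and> mset y = N \<and> sorted_wrt (\<le>) (zip w y)}"
  proof -
    have "(\<forall>k\<in>{1..<n} - asc M. y ! (k - 1) < y ! k \<or> y ! (k - 1) = y ! k \<and> k \<notin> {}) \<longleftrightarrow> sorted_wrt (\<le>) (zip w y)"
      if "length y = n" for y :: "nat list"
      unfolding w(3) using sorted_zip_iff[OF w(1,2) that, of "(\<le>)" "(\<le>)"]
      by (simp add: less_eq_prod_def le_less)
    then show ?thesis unfolding biwords_def by blast
  qed
  moreover have "margins UNIV M N =
      {P. image_mset fst P = M \<and> image_mset snd P = N \<and> sorted_wrt (\<le>) (sorted_list_of_multiset P)}"
    by (simp add: margins_def)
  ultimately show "card (biwords n {} M N) = card (margins UNIV M N)"
    using card_sorted_zip[OF _ M N, of "(\<le>)"] by (simp add: w_def)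
  have "biwords n {1..<n} M N = {y. length y = n \<and> mset y = N \<and> sorted_wrt (<) (zip w y)}"
  proof -
    have "(\<forall>k\<in>{1..<n} - asc M. y ! (k - 1) < y ! k \<or> y ! (k - 1) = y ! k \<and> k \<notin> {1..<n}) \<longleftrightarrow> sorted_wrt (<) (zip w y)"
      if "length y = n" for y :: "nat list"
    proof -
      have "sorted_wrt (<) (zip w y) \<longleftrightarrow> (\<forall>k\<in>{1..<n} - ascents w. y ! (k - 1) < y ! k)"
      proof (rule sorted_zip_iff[OF w(1,2) that])
        show "a < b \<longleftrightarrow> fst a < fst b \<or> fst a \<le> fst b \<and> snd a < snd b" for a b :: "nat \<times> nat"
          by (simp add: less_prod_def)
        show "transp ((<) :: nat \<times> nat \<Rightarrow> nat \<times> nat \<Rightarrow> bool)" by (rule transp_on_less)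
      qed
      then show ?thesis unfolding w(3) by blast
    qed
    then show ?thesis unfolding biwords_def by blast
  qed
  moreover have "margins {0, 1} M N =
      {P. image_mset fst P = M \<and> image_mset snd P = N \<and> sorted_wrt (<) (sorted_list_of_multiset P)}"
  proof -
    have "(\<forall>p. count P p \<in> {0, 1}) \<longleftrightarrow> sorted_wrt (<) (sorted_list_of_multiset P)" for P :: "(nat \<times> nat) multiset"
    proof -
      have "sorted_wrt (<) (sorted_list_of_multiset P) \<longleftrightarrow> distinct (sorted_list_of_multiset P)"
        by (simp add: strict_sorted_iff)
      also have "\<dots> \<longleftrightarrow> (\<forall>p. count P p = (if p \<in># P then 1 else 0))"
        unfolding distinct_count_atmost_1 by simp
      also have "\<dots> \<longleftrightarrow> (\<forall>p. count P p \<in> {0, 1})"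
        by (metis count_eq_zero_iff insert_iff singletonD zero_neq_one)
      finally show ?thesis ..
    qed
    then show ?thesis unfolding margins_def by blast
  qed
  ultimately show "card (biwords n {1..<n} M N) = card (margins {0, 1} M N)"
    using card_sorted_zip[OF _ M N, of "(<)"] by (simp add: w_def strict_sorted_iff)
qed

lemma Delta_F_eq_card:
  assumes "K \<subseteq> {1..<n}"
  shows "Delta n (F n K) (M, N) =
    (if size M = n \<and> size N = n then int (card (biwords n K M N)) else 0)"
proof -
  obtain \<pi> where \<pi>: "\<pi> permutes {1..n}" "Des n \<pi> = K" using ex_Des[OF assms] by blast
  show ?thesis
    using Delta_F_Des[OF \<pi>(1), of M N] comul_eq_card[OF \<pi>(1), of M N] comul_eq_0[of M n N \<pi>]
    by (simp add: \<pi>(2))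
qed

lemma Delta_hsym:
  "Delta n (hsym n) (M, N) = (if size M = n \<and> size N = n then int (card (margins UNIV M N)) else 0)"
  unfolding hsym_eq_F using Delta_F_eq_card[of "{}" n M N] card_biwords_margins(1)[of M n N] by simp

lemma Delta_esym:
  "Delta n (esym n) (M, N) = (if size M = n \<and> size N = n then int (card (margins {0, 1} M N)) else 0)"
  unfolding esym_eq_F using Delta_F_eq_card[of "{1..<n}" n M N] card_biwords_margins(2)[of M n N] by simp

text \<open>Stated through \<open>part_fun l\<close> so that it also applies to
  \<open>conj_part l\<close>, which is known through its row function.\<close>

lemma schur_eq_0:
  assumes "is_part (part_fun l)" "psize (part_fun l) = n" "size M \<noteq> n"
  shows "schur l M = 0"
proof -
  obtain L where L: "\<And>i. i \<ge> L \<Longrightarrow> part_fun l i = 0" using assms(1) by (auto simp: is_part_def)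
  have size_sum: "size (\<Sum>i<(L::nat). f i) = (\<Sum>i<L. size (f i))" for f :: "nat \<Rightarrow> nat multiset" and L
    by (induction L) auto
  have "size M = n" if T: "T \<in> tableaux (part_fun l) M" for T
  proof -
    have "size M = (\<Sum>i<L. length (T i))"
      using tableaux_content[OF T L] size_sum[of "\<lambda>i. mset (T i)" L] by simp
    also have "\<dots> = (\<Sum>i<L. part_fun l i)" using T by (simp add: tableaux_def)
    also have "\<dots> = n" using psize_eq[OF L] assms(2) by simp
    finally show ?thesis .
  qed
  then have "tableaux (part_fun l) M = {}" using assms(3) by blast
  then show ?thesis by (simp add: schur_eq)
qed

lemma Delta_hsym_schur: "Delta n (hsym n) = (\<Sum>l\<in>partitions n. schur l \<otimes> schur l)"
proof (rule ext, clarify)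
  fix M N
  have z: "schur l X = 0" if "l \<in> partitions n" "size X \<noteq> n" for l X
    using schur_eq_0[OF part_fun_is_part[OF that(1)] that(2)] .
  show "Delta n (hsym n) (M, N) = (\<Sum>l\<in>partitions n. schur l \<otimes> schur l) (M, N)"
  proof (cases "size M = n \<and> size N = n")
    case True
    then show ?thesis using cauchy_schur(1)[of M n N] by (simp add: Delta_hsym sum_fun_apply tens_def)
  next
    case False
    then have "(\<Sum>l\<in>partitions n. schur l M * schur l N) = 0"
      using z by (intro sum.neutral ballI) auto
    then have "(\<Sum>l\<in>partitions n. schur l \<otimes> schur l) (M, N) = 0" by (simp add: sum_fun_apply tens_def)
    then show ?thesis unfolding Delta_hsym if_not_P[OF False] ..
  qed
qed

lemma Delta_esym_schur: "Delta n (esym n) = (\<Sum>l\<in>partitions n. schur l \<otimes> schur (conj_part l))"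
proof (rule ext, clarify)
  fix M N
  have z: "schur l X = 0" "schur (conj_part l) X = 0" if l: "l \<in> partitions n" and X: "size X \<noteq> n" for l X
  proof -
    note p = part_fun_is_part[OF l]
    show "schur l X = 0" using schur_eq_0[OF p X] .
    show "schur (conj_part l) X = 0"
      using X p is_part_pconj[OF p(1)] psize_pconj[OF p(1)]
      by (intro schur_eq_0) (simp_all add: part_fun_conj_part[OF l])
  qed
  show "Delta n (esym n) (M, N) = (\<Sum>l\<in>partitions n. schur l \<otimes> schur (conj_part l)) (M, N)"
  proof (cases "size M = n \<and> size N = n")
    case True
    then show ?thesis using cauchy_schur(2)[of M n N] by (simp add: Delta_esym sum_fun_apply tens_def)
  next
    case False
    then have "(\<Sum>l\<in>partitions n. schur l M * schur (conj_part l) N) = 0"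
      using z by (intro sum.neutral ballI) auto
    then have "(\<Sum>l\<in>partitions n. schur l \<otimes> schur (conj_part l)) (M, N) = 0"
      by (simp add: sum_fun_apply tens_def)
    then show ?thesis unfolding Delta_esym if_not_P[OF False] ..
  qed
qed

section \<open>Symmetric functions\<close>

text \<open>The complements of \<open>A\<close> and of \<open>B\<close> in their union have equal
  size, so \<open>f\<close> can be completed to a permutation of the union and extended by the
  identity.\<close>

lemma ex_bij_extension:
  fixes f :: "'a \<Rightarrow> 'a"
  assumes "finite A" "bij_betw f A B"
  shows "\<exists>p. bij p \<and> (\<forall>x\<in>A. p x = f x)"
proof -
  have fin: "finite B" "card A = card B" using assms bij_betw_finite bij_betw_same_card by blast+
  let ?S = "A \<union> B"
  have "card (?S - A) = card (?S - B)" using assms(1) fin by (simp add: card_Diff_subset)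
  then obtain g where g: "bij_betw g (?S - A) (?S - B)"
    using finite_same_card_bij[of "?S - A" "?S - B"] assms(1) fin by blast
  define p where "p x = (if x \<in> A then f x else if x \<in> ?S then g x else x)" for x
  have "bij_betw p A B" using assms(2) by (rule bij_betw_cong[THEN iffD1, rotated]) (simp add: p_def)
  moreover have "bij_betw p (?S - A) (?S - B)"
    using g by (rule bij_betw_cong[THEN iffD1, rotated]) (auto simp: p_def)
  ultimately have "bij_betw p (A \<union> (?S - A)) (B \<union> (?S - B))" by (rule bij_betw_combine) blast
  moreover have "A \<union> (?S - A) = ?S" "B \<union> (?S - B) = ?S" by auto
  ultimately have "bij_betw p ?S ?S" by (simp only:)
  moreover have "p x = x" if "x \<notin> ?S" for x using that by (simp add: p_def)
  ultimately have "p permutes ?S" by (rule bij_imp_permutes)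
  then have "bij p" by (rule permutes_bij)
  moreover have "\<forall>x\<in>A. p x = f x" by (simp add: p_def)
  ultimately show ?thesis by blast
qed

lemma ex_bij_map:
  fixes u v :: "'a list"
  assumes "distinct u" "distinct v" "length u = length v"
  shows "\<exists>p. bij p \<and> map p u = v"
proof -
  define f where "f = (!) v \<circ> inv_into {..<length u} ((!) u)"
  have u: "bij_betw ((!) u) {..<length u} (set u)" using assms(1) by (intro bij_betw_nth) auto
  have v: "bij_betw ((!) v) {..<length u} (set v)" using assms(2,3) by (intro bij_betw_nth) auto
  have "bij_betw f (set u) (set v)"
    unfolding f_def by (rule bij_betw_trans[OF bij_betw_inv_into[OF u] v])
  from ex_bij_extension[OF finite_set this]
  obtain p where p: "bij p" "\<forall>x\<in>set u. p x = f x" by blast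
  have "map p u = v"
  proof (rule nth_equalityI)
    fix i assume "i < length (map p u)"
    then have i: "i < length u" by simp
    then have "inv_into {..<length u} ((!) u) (u ! i) = i"
      using inv_into_f_f[OF bij_betw_imp_inj_on[OF u]] by simp
    then show "map p u ! i = v ! i" using i p(2) by (simp add: f_def)
  qed (simp add: assms(3))
  then show ?thesis using p(1) by blast
qed

lemma Sym_D: "f \<in> Sym n \<Longrightarrow> bij p \<Longrightarrow> f (image_mset p M) = f M"
  unfolding Sym_def by blast

text \<open>Rotating the exponents amounts to rotating the variables the other way, and any two
  lists of distinct variables of the same length are related by a bijection.\<close>

lemma Sym_subset_cQSym: "Sym n \<subseteq> cQSym n"
proof
  fix f assume f: "f \<in> Sym n"
  then have "homogeneous n f" unfolding Sym_def by blast
  moreover have "f (var_monom u m) = f (var_monom v (rotate s m))"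
    if uv: "sorted_wrt (<) u" "sorted_wrt (<) v" "length u = length m" "length v = length m" for u v m s
  proof -
    define m1 m2 where "m1 = take (s mod length m) m" and "m2 = drop (s mod length m) m"
    have m: "m = m1 @ m2" "rotate s m = m2 @ m1" by (simp_all add: m1_def m2_def rotate_drop_take)
    define v1 v2 where "v1 = drop (length m2) v" and "v2 = take (length m2) v"
    have len: "length v2 = length m2" "length v1 = length m1" using uv(4) m(1) by (simp_all add: v1_def v2_def)
    have v: "v = v2 @ v1" by (simp add: v1_def v2_def)
    have "var_monom v (rotate s m) = var_monom (v1 @ v2) m"
      unfolding m(2) unfolding v m(1) var_monom_append[OF len(1)] var_monom_append[OF len(2)]
      by (rule add.commute)
    moreover have "distinct u" "distinct v" using uv by (simp_all add: strict_sorted_iff)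
    moreover have "length u = length (v1 @ v2)" using uv(3) len m(1) by simp
    ultimately obtain p where "bij p" "map p u = v1 @ v2" using ex_bij_map[of u "v1 @ v2"] v by auto
    then show ?thesis
      using Sym_D[OF f, of p "var_monom u m"] \<open>var_monom v (rotate s m) = var_monom (v1 @ v2) m\<close>
      by (simp add: image_var_monom)
  qed
  ultimately show "f \<in> cQSym n" unfolding cQSym_def by blast
qed

lemma hsym_in_Sym: "hsym n \<in> Sym n"
  by (simp add: Sym_def homogeneous_def hsym_def)

definition sym_class :: "nat multiset \<Rightarrow> nat multiset set" where
  "sym_class M = {image_mset p M | p. bij p}"

lemma sym_class_refl: "M \<in> sym_class M"
proof -
  have "M = image_mset id M" by simp
  then show ?thesis unfolding sym_class_def using bij_id by blast
qed

lemma sym_class_eq: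
  assumes "M' \<in> sym_class M"
  shows "sym_class M' = sym_class M"
proof -
  obtain p where p: "bij p" "M' = image_mset p M" using assms by (auto simp: sym_class_def)
  have M: "M = image_mset (inv p) M'"
    using p by (simp add: multiset.map_comp comp_def bij_is_inj)
  have sub: "sym_class (image_mset q X) \<subseteq> sym_class X" if "bij q" for q X
    using that by (auto simp: sym_class_def multiset.map_comp intro: bij_comp)
  have "sym_class M' \<subseteq> sym_class M" using sub[OF p(1), of M] p(2) by (simp only:)
  moreover have "sym_class M \<subseteq> sym_class M'"
    using sub[OF bij_imp_bij_inv[OF p(1)], of M'] unfolding M[symmetric] .
  ultimately show ?thesis by (rule subset_antisym)
qed

text \<open>A monomial of degree n involves at most n variables, so it can be moved into the first n
  of them. Hence there are only finitely many classes of that degree.\<close>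

lemma sym_class_bounded:
  assumes "size M = n"
  shows "\<exists>M'. M' \<in> sym_class M \<and> set_mset M' \<subseteq> {..<n}"
proof -
  have "card (set_mset M) \<le> card {..<n}"
    using assms by (metis card_lessThan size_mset_set size_mset_mono mset_set_set_mset_msubset)
  then obtain f where f: "inj_on f (set_mset M)" "f ` set_mset M \<subseteq> {..<n}"
    using card_le_inj[of "set_mset M" "{..<n}"] by auto
  obtain p where p: "bij p" "\<forall>x\<in>set_mset M. p x = f x"
    using ex_bij_extension[OF finite_set_mset inj_on_imp_bij_betw[OF f(1)]] by blast
  then have "set_mset (image_mset p M) \<subseteq> {..<n}" using f(2) by auto
  then show ?thesis using p(1) unfolding sym_class_def by blast
qed

text \<open>Expansion in monomial symmetric functions of the first alphabet, with slices in the
  second alphabet as coefficients. It is applied to matrix counts, whose symmetry is evident from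
  permuting rows and columns.\<close>

lemma symmetric_in_tensor_group:
  assumes hom: "\<And>M N. size M \<noteq> n \<or> size N \<noteq> n \<Longrightarrow> g (M, N) = 0"
    and sym1: "\<And>p M N. bij p \<Longrightarrow> g (image_mset p M, N) = g (M, N)"
    and sym2: "\<And>p M N. bij p \<Longrightarrow> g (M, image_mset p N) = g (M, N)"
  shows "g \<in> tensor_group (Sym n) (Sym n)"
proof -
  let ?X = "{M. size M = n \<and> set_mset M \<subseteq> {..<n}}"
  define C where "C = sym_class ` ?X"
  define rep where "rep c = (SOME M. M \<in> ?X \<and> sym_class M = c)" for c
  \<comment> \<open>The monomial symmetric function of a class.\<close>
  define m :: "nat multiset set \<Rightarrow> series" where "m c M = (if M \<in> c then 1 else 0)" for c M
  have rep: "rep c \<in> ?X" "sym_class (rep c) = c" if "c \<in> C" for c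
  proof -
    have "\<exists>M. M \<in> ?X \<and> sym_class M = c" using that by (auto simp: C_def)
    from someI_ex[OF this] show "rep c \<in> ?X" "sym_class (rep c) = c" unfolding rep_def by auto
  qed
  have "?X \<subseteq> mset ` {xs. set xs \<subseteq> {..<n} \<and> length xs = n}"
  proof
    fix M assume M: "M \<in> ?X"
    obtain xs where "M = mset xs" using ex_mset by metis
    then show "M \<in> mset ` {xs. set xs \<subseteq> {..<n} \<and> length xs = n}" using M by auto
  qed
  then have "finite ?X" by (rule finite_subset) (simp add: finite_lists_length_eq)
  then have finC: "finite C" by (simp add: C_def)
  have size: "size M = n" if "M \<in> c" "c \<in> C" for M c
    using that by (auto simp: C_def sym_class_def)
  have unique: "c = sym_class M" if "M \<in> c" "c \<in> C" for M c
    using sym_class_eq[of M "rep c"] rep(2)[OF that(2)] that(1) by simp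
  have m_Sym: "m c \<in> Sym n" if c: "c \<in> C" for c
  proof -
    have "image_mset p M \<in> c \<longleftrightarrow> M \<in> c" if "bij p" for p M
    proof -
      have "image_mset p M \<in> sym_class M" using that unfolding sym_class_def by blast
      then have eq: "sym_class (image_mset p M) = sym_class M" by (rule sym_class_eq)
      show ?thesis using unique[OF _ c] eq sym_class_refl by metis
    qed
    then show ?thesis using size[OF _ c] by (auto simp: Sym_def homogeneous_def m_def)
  qed
  have slice: "(\<lambda>N. g (M, N)) \<in> Sym n" for M
    using hom sym2 by (fastforce simp: Sym_def homogeneous_def)
  have "g = (\<Sum>c\<in>C. m c \<otimes> (\<lambda>N. g (rep c, N)))"
  proof (rule ext, clarify)
    fix M N
    have "(\<Sum>c\<in>C. m c \<otimes> (\<lambda>N. g (rep c, N))) (M, N) = (\<Sum>c\<in>C. m c M * g (rep c, N))"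
      by (simp add: sum_fun_apply tens_def)
    also have "\<dots> = g (M, N)"
    proof (cases "size M = n")
      case True
      obtain M' where M': "M' \<in> sym_class M" "set_mset M' \<subseteq> {..<n}" using sym_class_bounded[OF True] by blast
      have "size M' = n" using M'(1) True by (auto simp: sym_class_def)
      then have cC: "sym_class M \<in> C" unfolding C_def using M' sym_class_eq[OF M'(1)] by blast
      have "(\<Sum>c\<in>C. m c M * g (rep c, N)) = (\<Sum>c\<in>C. if c = sym_class M then g (rep c, N) else 0)"
      proof (rule sum.cong[OF refl])
        fix c assume "c \<in> C"
        then show "m c M * g (rep c, N) = (if c = sym_class M then g (rep c, N) else 0)"
          using unique sym_class_refl by (auto simp: m_def)
      qed
      also have "\<dots> = g (rep (sym_class M), N)" using finC cC by simp
      also have "\<dots> = g (M, N)"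
      proof -
        have "M \<in> sym_class (rep (sym_class M))" using rep(2)[OF cC] sym_class_refl by simp
        then obtain p where "bij p" "M = image_mset p (rep (sym_class M))" by (auto simp: sym_class_def)
        then show ?thesis using sym1[of p "rep (sym_class M)" N] by simp
      qed
      finally show ?thesis .
    next
      case False
      then have "m c M = 0" if "c \<in> C" for c using size that by (auto simp: m_def)
      then show ?thesis using hom[of M N] False by simp
    qed
    finally show "g (M, N) = (\<Sum>c\<in>C. m c \<otimes> (\<lambda>N. g (rep c, N))) (M, N)" by simp
  qed
  moreover have "(\<Sum>c\<in>C. m c \<otimes> (\<lambda>N. g (rep c, N))) \<in> tensor_group (Sym n) (Sym n)"
    by (intro zmod.subspace_sum subspace_tensor_group tens_in_tensor_group m_Sym slice)
  ultimately show ?thesis by (simp only:)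
qed

text \<open>The rows are permuted by \<open>p\<close> and the columns by \<open>q\<close>. Applied
  to the inverse bijections this also gives the opposite inequality.\<close>

lemma card_margins_image_le:
  assumes "bij p" "bij q"
  shows "card (margins Ks M N) \<le> card (margins Ks (image_mset p M) (image_mset q N))"
proof (rule card_inj_on_le)
  let ?f = "map_prod p q"
  have bij: "bij ?f" using assms by (simp add: bij_def prod.inj_map map_prod_surj)
  have "count (image_mset ?f P) x = count P (inv ?f x)" for P x
  proof -
    have "?f -` {x} = {inv ?f x}" using bij_vimage_eq_inv_image[OF bij, of "{x}"] by simp
    then show ?thesis by (cases "inv ?f x \<in># P") (simp_all add: count_image_mset not_in_iff)
  qed
  then show "image_mset ?f ` margins Ks M N \<subseteq> margins Ks (image_mset p M) (image_mset q N)"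
    by (auto simp: margins_def multiset.map_comp comp_def simp del: split_paired_All)
  have "inj (image_mset ?f)" using bij by (simp add: bij_is_inj multiset.inj_map)
  then show "inj_on (image_mset ?f) (margins Ks M N)" by (rule inj_on_subset) simp
qed simp

lemma card_margins_image:
  assumes "bij p" "bij q"
  shows "card (margins Ks (image_mset p M) (image_mset q N)) = card (margins Ks M N)"
proof (rule antisym)
  have "image_mset (inv p) (image_mset p M) = M" "image_mset (inv q) (image_mset q N) = N"
    using assms by (simp_all add: multiset.map_comp comp_def bij_is_inj)
  then show "card (margins Ks (image_mset p M) (image_mset q N)) \<le> card (margins Ks M N)"
    using card_margins_image_le[OF assms[THEN bij_imp_bij_inv], of Ks "image_mset p M" "image_mset q N"] by simp
qed (rule card_margins_image_le[OF assms])

lemma Delta_hsym_in_Sym: "Delta n (hsym n) \<in> tensor_group (Sym n) (Sym n)"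
  using card_margins_image[OF _ bij_id] card_margins_image[OF bij_id]
  by (intro symmetric_in_tensor_group) (auto simp: Delta_hsym)

lemma Delta_esym_in_Sym: "Delta n (esym n) \<in> tensor_group (Sym n) (Sym n)"
  using card_margins_image[OF _ bij_id] card_margins_image[OF bij_id]
  by (intro symmetric_in_tensor_group) (auto simp: Delta_esym)

section \<open>The comodules of cyclic quasi-symmetric functions\<close>

lemma QSym_0: "cQSym 0 = QSym 0"
proof
  have "F 0 ` Pow {1..<0} \<subseteq> cQSym 0"
    using hsym_in_Sym[of 0] Sym_subset_cQSym[of 0] by (auto simp: hsym_eq_F)
  then show "QSym 0 \<subseteq> cQSym 0" unfolding QSym_eq_span by (rule zmod.span_minimal[OF _ subspace_cQSym])
qed (rule cQSym_subset_QSym)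

text \<open>In degrees 0 and 1 the only fundamental function is \<open>F n {}\<close>, and the
  special clauses in the definition give its multiples; the comodule inclusion then reduces to
  \<open>Delta_QSym\<close>.\<close>

lemma cQSym_minus_small:
  assumes "n \<le> 1"
  shows "cQSym_minus n = QSym n"
proof -
  have "F n ` Pow {1..<n} = {F n {}}" using assms by auto
  then have Q: "QSym n = zmod.span {F n {}}" by (simp only: QSym_eq_span)
  consider "n = 0" | "n = 1" using assms by linarith
  then show ?thesis
  proof cases
    case 1
    have "(\<lambda>M. if M = {#} then 1 else 0) = hsym 0" by (simp add: hsym_def fun_eq_iff)
    then show ?thesis using Q 1 by (simp add: cQSym_minus_def hsym_eq_F)
  next
    case 2
    have "esym 1 = F 1 {}" by (simp add: esym_eq_F)
    then show ?thesis using Q 2 by (simp add: cQSym_minus_def)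
  qed
qed

lemma Fhat_corbit:
  assumes "0 < n" "J \<subseteq> {1..n}" "J \<noteq> {}" "J \<noteq> {1..n}"
  shows "cyc_orbit n J \<in> corbits n" "Fhat n J = orb_Fhat n (cyc_orbit n J)"
proof -
  show B: "cyc_orbit n J \<in> corbits n" unfolding corbits_eq using assms by blast
  then have "cyc_orbit n J \<in> cyc_orbits n" using corbits_subset by blast
  from orb_Fhat_eq_Fhat[OF assms(1) this self_in_cyc_orbit[OF assms(1)]]
  show "Fhat n J = orb_Fhat n (cyc_orbit n J)" ..
qed

lemma Delta_Fhat_in_tensor_group:
  assumes n: "1 < n" and J: "J \<subseteq> {1..n}" "J \<noteq> {}" "J \<noteq> {1..n}"
  shows "Delta n (Fhat n J) \<in> tensor_group (cQSym_minus n) (QSym n)"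
proof -
  have n0: "0 < n" using n by simp
  have "orb_Fhat n A \<in> cQSym_minus n" if A: "A \<in> corbits n" for A
  proof -
    have "A \<in> cyc_orbits n" using A corbits_subset by blast
    then have S: "(SOME K. K \<in> A) \<in> A" by (rule cyc_orbits_nonempty[OF n0])
    show ?thesis unfolding cQSym_minus_eq_span[OF n] orb_Fhat_def
      using corbitsE[OF n0 A S] by (intro zmod.span_base imageI) simp
  qed
  moreover have "F n K \<in> QSym n" if "K \<in> Pow {1..<n}" for K using that F_in_QSym by simp
  ultimately show ?thesis
    unfolding Fhat_corbit(2)[OF n0 J] Delta_orb_Fhat[OF n Fhat_corbit(1)[OF n0 J]]
    by (intro zmod.subspace_sum zmod.subspace_scale subspace_tensor_group tens_in_tensor_group)
qed

lemma Fhat_in_QSym: "0 < n \<Longrightarrow> J \<subseteq> {1..n} \<Longrightarrow> Fhat n J \<in> QSym n"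
  using Fhat_in_cQSym cQSym_subset_QSym by blast

lemma subspace_cQSym_minus: "zmod.subspace (cQSym_minus n)"
  unfolding cQSym_minus_def by (simp only: if_split zmod.subspace_span simp_thms)

lemma cQSym_minus_subset_cQSym:
  assumes "1 < n"
  shows "cQSym_minus n \<subseteq> cQSym n"
  unfolding cQSym_minus_eq_span[OF assms]
  using assms by (intro zmod.span_minimal subspace_cQSym image_subsetI Fhat_in_cQSym) auto

lemma cQSym_minus_subset_QSym: "cQSym_minus n \<subseteq> QSym n"
proof (cases "1 < n")
  case True
  then show ?thesis using cQSym_minus_subset_cQSym cQSym_subset_QSym by blast
next
  case False
  then show ?thesis using cQSym_minus_small[of n] by simp
qed

lemma Delta_cQSym_minus: "Delta n ` cQSym_minus n \<subseteq> tensor_group (cQSym_minus n) (QSym n)"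
proof (cases "1 < n")
  case True
  have "Delta n ` zmod.span (Fhat n ` (Pow {1..n} - {{}, {1..n}})) \<subseteq> tensor_group (cQSym_minus n) (QSym n)"
  proof (rule Delta_span_subset[OF _ subspace_tensor_group])
    show "Fhat n ` (Pow {1..n} - {{}, {1..n}}) \<subseteq> QSym n"
      using True by (intro image_subsetI Fhat_in_QSym) auto
    fix f assume "f \<in> Fhat n ` (Pow {1..n} - {{}, {1..n}})"
    then obtain J where "J \<subseteq> {1..n}" "J \<noteq> {}" "J \<noteq> {1..n}" "f = Fhat n J" by blast
    then show "Delta n f \<in> tensor_group (cQSym_minus n) (QSym n)"
      using Delta_Fhat_in_tensor_group[OF True] by simp
  qed
  then show ?thesis by (simp only: cQSym_minus_eq_span[OF True, symmetric])
next
  case False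
  then show ?thesis using cQSym_minus_small[of n] Delta_QSym[of n] by simp
qed

text \<open>Among the generators, nonempty proper sets are covered by the cyclic formula. The full
  set gives the elementary symmetric function, whose coproduct is already symmetric in both
  alphabets.\<close>

lemma Delta_cQSym: "Delta n ` cQSym n \<subseteq> tensor_group (cQSym n) (QSym n)"
proof (cases "n = 0")
  case True
  then show ?thesis using Delta_QSym[of n] QSym_0 by simp
next
  case False
  then have n: "0 < n" by simp
  have "Delta n ` zmod.span (Fhat n ` (Pow {1..n} - {{}})) \<subseteq> tensor_group (cQSym n) (QSym n)"
  proof (rule Delta_span_subset[OF _ subspace_tensor_group])
    show "Fhat n ` (Pow {1..n} - {{}}) \<subseteq> QSym n"
      using n by (intro image_subsetI Fhat_in_QSym) auto
    fix f assume "f \<in> Fhat n ` (Pow {1..n} - {{}})"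
    then obtain J where J: "J \<subseteq> {1..n}" "J \<noteq> {}" "f = Fhat n J" by blast
    show "Delta n f \<in> tensor_group (cQSym n) (QSym n)"
    proof (cases "J = {1..n}")
      case True
      have "Sym n \<subseteq> QSym n" using Sym_subset_cQSym cQSym_subset_QSym by blast
      then show ?thesis
        using Delta_esym_in_Sym[of n] tensor_group_mono[OF Sym_subset_cQSym, of "Sym n" "QSym n" n]
          J(3) True Fhat_full[OF n] by auto
    next
      case False
      have "n \<noteq> 1"
      proof
        assume "n = 1"
        then have "J \<subseteq> {1}" using J(1) by simp
        then show False using J(2) False \<open>n = 1\<close> by auto
      qed
      then have "1 < n" using n by simp
      then show ?thesis
        using Delta_Fhat_in_tensor_group[OF _ J(1,2) False] J(3)
          tensor_group_mono[OF cQSym_minus_subset_cQSym order_refl] by blast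
    qed
  qed
  then show ?thesis by (simp only: cQSym_eq_span[OF n, symmetric])
qed

theorem theorem6p1:
  fixes n :: nat
  shows "Delta n ` cQSym n \<subseteq> tensor_group (cQSym n) (QSym n)
    \<and> Delta n ` cQSym_minus n \<subseteq> tensor_group (cQSym_minus n) (QSym n)
    \<and> right_comodule n (cQSym n)
    \<and> right_comodule n (cQSym_minus n)
    \<and> (n > 1 \<longrightarrow> (\<forall>B\<in>corbits n.
          (\<forall>A\<in>corbits n. \<forall>J\<in>Pow {1..<n}.
             (\<forall>\<pi>. \<pi> permutes {1..n} \<and> cDes n \<pi> \<in> B \<longrightarrow> cyc_count n \<pi> A J = atilde n B A J)
             \<and> struct_const n B A J \<in> \<nat>)
          \<and> Delta n (orb_Fhat n B) =
              (\<Sum>A\<in>corbits n. \<Sum>J\<in>Pow {1..<n}.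
                 zscale \<lfloor>struct_const n B A J\<rfloor> (orb_Fhat n A \<otimes> F n J))))
    \<and> (n \<ge> 1 \<longrightarrow>
          Delta n (Fhat n {}) = Delta n (hsym n)
          \<and> Delta n (hsym n) = (\<Sum>l\<in>partitions n. schur l \<otimes> schur l)
          \<and> Delta n (hsym n) \<in> tensor_group (Sym n) (Sym n)
          \<and> Delta n (Fhat n {1..n}) = Delta n (esym n)
          \<and> Delta n (esym n) = (\<Sum>l\<in>partitions n. schur l \<otimes> schur (conj_part l))
          \<and> Delta n (esym n) \<in> tensor_group (Sym n) (Sym n))"
proof (intro conjI impI ballI allI)
  show "right_comodule n (cQSym n)"
    by (rule right_comoduleI[OF subspace_cQSym cQSym_subset_QSym Delta_cQSym])
  show "right_comodule n (cQSym_minus n)"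
    by (rule right_comoduleI[OF subspace_cQSym_minus cQSym_minus_subset_QSym Delta_cQSym_minus])
next
  fix B A J \<pi>
  assume n: "n > 1" and B: "B \<in> corbits n" and A: "A \<in> corbits n" and "J \<in> Pow {1..<n}"
  then have J: "J \<subseteq> {1..<n}" by simp
  show "struct_const n B A J \<in> \<nat>"
    unfolding struct_const_eq[OF n B A J] by (rule of_nat_in_Nats)
  assume "\<pi> permutes {1..n} \<and> cDes n \<pi> \<in> B"
  then show "cyc_count n \<pi> A J = atilde n B A J" using atilde_eq[OF n B A J] by blast
qed (use Delta_cQSym Delta_cQSym_minus Delta_orb_Fhat Delta_hsym_schur Delta_esym_schur
      Delta_hsym_in_Sym Delta_esym_in_Sym Fhat_empty Fhat_full in auto)

end
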